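(* There is a BSS algorithm with an input consisting of a point $X\in\mathcal{P}(n)$ and a finite list of elements $A_1',\dots,A'_{k'}\in Sym_n(\mathbb{R})$ which yields an output describing the poset structure of the face set $\mathcal{F}(P)$, where $$P=\bigcap_{i=1}^{k'}\{Y\in\mathcal{P}(n):\mathrm{tr}(A_i'Y)\ge0\}.$$ Specifically, the output consists of the data $\mathcal{A}$, $L^{face}$, $L^{pos}$ and $L^{samp}$, where: (1) $\mathcal{A}=\{A_1,\dots,A_k\}$ is a subset of the input set $\{A_1',\dots,A'_{k'}\}$. (2) $L^{face}=\{L^{face}_1,\dots,L^{face}_m\}$ is a two-dimensional array of numbers from $\{1,\dots,k\}$, with $m=|\mathcal{F}(P)|$, describing the set $\{F_1,\dots,F_m\}$ of faces of $P$, in the sense that $$span(F_j)=\bigcap_{i\in L^{face}_j}A_i^\perp,\quad j=1,\dots,m.$$ (3) $L^{pos}$ is a two-dimensional array of numbers from $\{1,\dots,m\}$ describing the inclusion relation among the faces of $P$, namely $$L^{pos}_j=\{1\le l\le m: F_l\subsetneq F_j\},\quad j=1,\dots,m.$$ (4) $L^{samp}$ is an array of elements of $\mathcal{P}(n)$ giving sample points of the faces of $P$: $L^{samp}_j\in F_j$, $j=1,\dots,m$.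
   Context: $Sym_n(\mathbb{R})$ is the space of real symmetric $n\times n$ matrices; $\mathcal{P}(n)$ is the set of positive definite elements, either normalized to determinant $1$ or, equivalently, taken up to positive scaling (projective model $\{[X]\in\mathbf{P}(Sym_n(\mathbb{R})):X>0\}$). For $A\in Sym_n(\mathbb{R})$, $A^\perp=\{X\in\mathcal{P}(n):\mathrm{tr}(XA)=0\}$. An empty intersection of hyperplanes is $\mathcal{P}(n)$. A $d$-plane of $\mathcal{P}(n)$ is a non-empty intersection of $\mathcal{P}(n)$ with a $(d+1)$-dimensional linear subspace of $Sym_n(\mathbb{R})$; a hyperplane is a plane of codimension $1$, its complement has two components called open half-spaces, whose closures are closed half-spaces. A convex polyhedron is the intersection of a locally finite collection of closed half-spaces of $\mathcal{P}(n)$. For a convex polyhedron $P$, $span(P)$ is the minimal plane containing $P$, and the dimension of $P$ is that of $span(P)$. A facet of $P$ is a maximal subset of $\partial P$ that is itself a convex polyhedron. Faces are defined inductively: $P$ is a face of itself, and a facet of a face of $P$ is a face of $P$. Here $\mathcal{F}(P)$ is the set of all faces of $P$ (including $P$), partially ordered by inclusion. BSS (Blum–Shub–Smale) algorithm: in this computational model arbitrarily many real numbers can be stored, and rational functions over real numbers can be computed (and real numbers compared) in a single step. *)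

theory Defs
  imports "HOL-Analysis.Analysis"
begin

section \<open>The space of positive definite symmetric matrices\<close>

definition Sym :: "(real ^ 'n ^ 'n) set" where
  "Sym = {A. transpose A = A}"

definition positive_definite :: "real ^ 'n ^ 'n \<Rightarrow> bool" where
  "positive_definite A \<longleftrightarrow> (\<forall>v. v \<noteq> 0 \<longrightarrow> v \<bullet> (A *v v) > 0)"

text \<open>The space of positive definite matrices, normalized to determinant 1. All topological
  notions below refer to this subspace of the matrix space.\<close>

definition Pspace :: "(real ^ 'n ^ 'n) set" where
  "Pspace = {X \<in> Sym. positive_definite X \<and> det X = 1}"

text \<open>A positive definite matrix, of arbitrary determinant, represents the point of
  \<open>Pspace\<close> on the ray that it spans (homogeneous coordinates). Machines read and write points
  in this form, because the normalization to determinant 1 is not a rational function.\<close>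

definition represents :: "real ^ 'n ^ 'n \<Rightarrow> real ^ 'n ^ 'n \<Rightarrow> bool" where
  "represents Z X \<longleftrightarrow> X \<in> Pspace \<and> (\<exists>c>0. Z = c *\<^sub>R X)"

definition perp :: "real ^ 'n ^ 'n \<Rightarrow> (real ^ 'n ^ 'n) set" where
  "perp A = {X \<in> Pspace. trace (X ** A) = 0}"


section \<open>Planes, half-spaces, convex polyhedra and their faces\<close>

definition is_plane :: "nat \<Rightarrow> (real ^ 'n ^ 'n) set \<Rightarrow> bool" where
  "is_plane d S \<longleftrightarrow>
     S \<noteq> {} \<and> (\<exists>L. subspace L \<and> L \<subseteq> Sym \<and> dim L = d + 1 \<and> S = Pspace \<inter> L)"

text \<open>\<open>Pspace\<close> itself is a plane of dimension \<open>dim Sym - 1\<close>.\<close>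

definition is_hyperplane :: "(real ^ 'n ^ 'n) set \<Rightarrow> bool" where
  "is_hyperplane S \<longleftrightarrow> (\<exists>d. is_plane d S \<and> d + 2 = dim (Sym :: (real ^ 'n ^ 'n) set))"

definition open_half_space :: "(real ^ 'n ^ 'n) set \<Rightarrow> bool" where
  "open_half_space U \<longleftrightarrow> (\<exists>S. is_hyperplane S \<and> U \<in> components (Pspace - S))"

definition closed_half_space :: "(real ^ 'n ^ 'n) set \<Rightarrow> bool" where
  "closed_half_space H \<longleftrightarrow> (\<exists>U. open_half_space U \<and> H = top_of_set Pspace closure_of U)"

text \<open>Local finiteness of a collection of half-spaces is understood, as usual, as local
  finiteness of the collection of their bounding hyperplanes: the half-spaces themselves all
  contain the polyhedron. Convex polyhedra are non-empty, just as planes are; otherwise span and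
  dimension would be undefined, and the empty set would be a facet of any polyhedron without
  boundary.\<close>

definition convex_polyhedron :: "(real ^ 'n ^ 'n) set \<Rightarrow> bool" where
  "convex_polyhedron P \<longleftrightarrow> P \<noteq> {} \<and>
     (\<exists>\<H>. (\<forall>H\<in>\<H>. closed_half_space H) \<and>
          locally_finite_in (top_of_set Pspace) ((\<lambda>H. top_of_set Pspace frontier_of H) ` \<H>) \<and>
          P = Pspace \<inter> \<Inter>\<H>)"

definition plane_span :: "(real ^ 'n ^ 'n) set \<Rightarrow> (real ^ 'n ^ 'n) set" where
  "plane_span P = (LEAST S. (\<exists>d. is_plane d S) \<and> P \<subseteq> S)"

text \<open>The boundary of a polyhedron is its boundary in its span, so that polyhedra of positive
  codimension (faces in particular) have facets too.\<close>

definition poly_boundary :: "(real ^ 'n ^ 'n) set \<Rightarrow> (real ^ 'n ^ 'n) set" where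
  "poly_boundary P = top_of_set (plane_span P) frontier_of P"

definition is_facet :: "(real ^ 'n ^ 'n) set \<Rightarrow> (real ^ 'n ^ 'n) set \<Rightarrow> bool" where
  "is_facet F P \<longleftrightarrow> convex_polyhedron F \<and> F \<subseteq> poly_boundary P \<and>
     (\<forall>G. convex_polyhedron G \<and> G \<subseteq> poly_boundary P \<and> F \<subseteq> G \<longrightarrow> G = F)"

text \<open>The empty set is not a polyhedron and has no faces.\<close>

inductive_set faces :: "(real ^ 'n ^ 'n) set \<Rightarrow> (real ^ 'n ^ 'n) set set"
  for P :: "(real ^ 'n ^ 'n) set"
where
  self: "P \<noteq> {} \<Longrightarrow> P \<in> faces P"
| facet: "F \<in> faces P \<Longrightarrow> is_facet G F \<Longrightarrow> G \<in> faces P"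

definition polyhedron_of :: "(real ^ 'n ^ 'n) list \<Rightarrow> (real ^ 'n ^ 'n) set" where
  "polyhedron_of As = {Y \<in> Pspace. \<forall>A\<in>set As. trace (A ** Y) \<ge> 0}"


section \<open>Blum--Shub--Smale machines over the reals\<close>

text \<open>Rational functions, with arbitrary real constants, of the real numbers in store.\<close>

datatype ratfun =
    RConst real
  | RVar nat
  | RAdd ratfun ratfun
  | RSub ratfun ratfun
  | RMul ratfun ratfun
  | RDiv ratfun ratfun

primrec rat_eval :: "ratfun \<Rightarrow> (nat \<Rightarrow> real) \<Rightarrow> real" where
  "rat_eval (RConst c) x = c"
| "rat_eval (RVar r) x = x r"
| "rat_eval (RAdd f g) x = rat_eval f x + rat_eval g x"
| "rat_eval (RSub f g) x = rat_eval f x - rat_eval g x"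
| "rat_eval (RMul f g) x = rat_eval f x * rat_eval g x"
| "rat_eval (RDiv f g) x = rat_eval f x / rat_eval g x"

primrec rat_defined :: "ratfun \<Rightarrow> (nat \<Rightarrow> real) \<Rightarrow> bool" where
  "rat_defined (RConst c) x \<longleftrightarrow> True"
| "rat_defined (RVar r) x \<longleftrightarrow> True"
| "rat_defined (RAdd f g) x \<longleftrightarrow> rat_defined f x \<and> rat_defined g x"
| "rat_defined (RSub f g) x \<longleftrightarrow> rat_defined f x \<and> rat_defined g x"
| "rat_defined (RMul f g) x \<longleftrightarrow> rat_defined f x \<and> rat_defined g x"
| "rat_defined (RDiv f g) x \<longleftrightarrow> rat_defined f x \<and> rat_defined g x \<and> rat_eval g x \<noteq> 0"

text \<open>The nodes of a machine in the sense of Blum, Shub and Smale: computation nodes, branch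
  nodes, nodes that reset or increment one of the two index registers \<open>i\<close>, \<open>j\<close>, and
  the node that copies \<open>x\<^sub>j\<close> to \<open>x\<^sub>i\<close>; the latter gives a fixed finite program access to
  unboundedly many reals. A node of a machine is named by its position in the list.\<close>

datatype bss_node =
    Compute nat ratfun
  | Branch ratfun nat nat
  | ResetI
  | IncrI
  | ResetJ
  | IncrJ
  | Copy
  | Halt

type_synonym bss_machine = "bss_node list"

text \<open>A configuration consists of the current node, the index registers and the real store.\<close>

type_synonym bss_config = "nat \<times> nat \<times> nat \<times> (nat \<Rightarrow> real)"

text \<open>A machine that attempts a division by zero gets stuck and does not halt.\<close>

inductive bss_step :: "bss_machine \<Rightarrow> bss_config \<Rightarrow> bss_config \<Rightarrow> bool"
  for M :: bss_machine
where
  "q < length M \<Longrightarrow> M ! q = Compute r f \<Longrightarrow> rat_defined f x \<Longrightarrow>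
     bss_step M (q, i, j, x) (Suc q, i, j, x(r := rat_eval f x))"
| "q < length M \<Longrightarrow> M ! q = Branch f p p' \<Longrightarrow> rat_defined f x \<Longrightarrow>
     bss_step M (q, i, j, x) (if rat_eval f x \<ge> 0 then p else p', i, j, x)"
| "q < length M \<Longrightarrow> M ! q = ResetI \<Longrightarrow> bss_step M (q, i, j, x) (Suc q, 0, j, x)"
| "q < length M \<Longrightarrow> M ! q = IncrI \<Longrightarrow> bss_step M (q, i, j, x) (Suc q, Suc i, j, x)"
| "q < length M \<Longrightarrow> M ! q = ResetJ \<Longrightarrow> bss_step M (q, i, j, x) (Suc q, i, 0, x)"
| "q < length M \<Longrightarrow> M ! q = IncrJ \<Longrightarrow> bss_step M (q, i, j, x) (Suc q, i, Suc j, x)"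
| "q < length M \<Longrightarrow> M ! q = Copy \<Longrightarrow> bss_step M (q, i, j, x) (Suc q, i, j, x(i := x j))"

text \<open>Input and output are finite sequences of reals. The length is stored at address 0 and the
  entries are stored at the odd addresses; initially the remaining even addresses are 0 and serve
  as working space.\<close>

definition bss_init :: "real list \<Rightarrow> bss_config" where
  "bss_init xs = (0, 0, 0, \<lambda>a. if a = 0 then real (length xs)
                             else if odd a \<and> a div 2 < length xs then xs ! (a div 2) else 0)"

definition bss_computes :: "bss_machine \<Rightarrow> real list \<Rightarrow> real list \<Rightarrow> bool" where
  "bss_computes M xs ys \<longleftrightarrow>
     (\<exists>q i j x. (bss_step M)\<^sup>*\<^sup>* (bss_init xs) (q, i, j, x) \<and> q < length M \<and> M ! q = Halt \<and>
        x 0 = real (length ys) \<and> (\<forall>a<length ys. x (2 * a + 1) = ys ! a))"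


section \<open>Encoding of the input and of the output\<close>

text \<open>A list \<open>ns\<close> enumerating the index type fixes the order of the matrix entries.\<close>

definition enc_matrix :: "'n list \<Rightarrow> real ^ 'n ^ 'n \<Rightarrow> real list" where
  "enc_matrix ns A = concat (map (\<lambda>r. map (\<lambda>c. A $ r $ c) ns) ns)"

definition enc_matrices :: "'n list \<Rightarrow> (real ^ 'n ^ 'n) list \<Rightarrow> real list" where
  "enc_matrices ns As = real (length As) # concat (map (enc_matrix ns) As)"

definition enc_array :: "nat list list \<Rightarrow> real list" where
  "enc_array L = real (length L) # concat (map (\<lambda>row. real (length row) # map real row) L)"

definition enc_input :: "'n list \<Rightarrow> real ^ 'n ^ 'n \<Rightarrow> (real ^ 'n ^ 'n) list \<Rightarrow> real list" where
  "enc_input ns X As' = enc_matrix ns X @ enc_matrices ns As'"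

definition enc_output ::
  "'n list \<Rightarrow> (real ^ 'n ^ 'n) list \<Rightarrow> nat list list \<Rightarrow> nat list list \<Rightarrow> (real ^ 'n ^ 'n) list \<Rightarrow> real list"
where
  "enc_output ns As Lface Lpos Lsamp =
     enc_matrices ns As @ enc_array Lface @ enc_array Lpos @ enc_matrices ns Lsamp"

text \<open>The arrays are numbered from 1, whence the shift in the list accesses. The sample points are
  given in homogeneous coordinates.\<close>

definition describes_faces ::
  "(real ^ 'n ^ 'n) list \<Rightarrow> (real ^ 'n ^ 'n) list \<Rightarrow> nat list list \<Rightarrow> nat list list \<Rightarrow>
   (real ^ 'n ^ 'n) list \<Rightarrow> bool"
where
  "describes_faces As' As Lface Lpos Lsamp \<longleftrightarrow>
     (let P = polyhedron_of As'; k = length As; m = card (faces P) in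
        distinct As \<and> set As \<subseteq> set As' \<and>
        finite (faces P) \<and> length Lface = m \<and> length Lpos = m \<and> length Lsamp = m \<and>
        (\<exists>F. bij_betw F {1..m} (faces P) \<and>
          (\<forall>j\<in>{1..m}.
             set (Lface ! (j - 1)) \<subseteq> {1..k} \<and>
             plane_span (F j) = Pspace \<inter> (\<Inter>i\<in>set (Lface ! (j - 1)). perp (As ! (i - 1))) \<and>
             set (Lpos ! (j - 1)) = {l \<in> {1..m}. F l \<subset> F j} \<and>
             (\<exists>Y\<in>F j. represents (Lsamp ! (j - 1)) Y))))"

end

(* A machine may use arbitrary real constants, and the base-16 digits of one constant can hold an
   infinite word over eleven primitive operations. A fixed interpreter for such words therefore
   executes any countable sequence of stages, each consisting of a guard and an output, both given by
   polynomials and sign tests; it performs the first stage whose guard holds. So no algorithm has to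
   be programmed: a stage is a guess of the whole combinatorial output (number of matrices, retained
   matrices, list of faces) together with integer matrices from which the sample points are computed,
   and the guard says that the guess is correct.

   The faces of P correspond to the sign vectors in {0,+} realized on positive definite matrices by
   the functionals tr(A_i Y), since a convex set in the boundary of P lies in one of its supporting
   hyperplanes. For a fixed number of matrices the existence of a Y with given signs is a first-order
   condition, hence decided by signs of polynomials (Tarski-Seidenberg, proved by the
   Cohen-Hoermander method). The realizing Y form an open cone in a linear subspace, so projecting a
   suitable integer matrix to the subspace, by Gram-Schmidt without divisions, gives a sample point. *)

theory Submission
  imports Defs
begin

section \<open>Quantifier elimination over the reals\<close>

text \<open>The guard has to certify a negative fact, that no sign vector beyond the guessed ones is
  realized, and this is the only reason for quantifier elimination. A non-effective form of it
  suffices: truth depends on the signs of finitely many integer polynomials. So two parameter points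
  with equal signs are compared directly, without formulas or computed sign diagrams, and the finite
  table of signs is just another part of the word that the constant encodes.

  Only countably many stages are available, although the input is real. Hence nothing real may be
  guessed: a sample point comes from an integer matrix, and since its hyperplanes may contain no
  rational point, the integer matrix is moved onto them by a computation with the input. Polynomials
  carry integer coefficients for the same reason, so that the primitive operations need no constants
  but 1.

  Base 16 leaves room above the digit 10: every tail of the expansion stays below 1, so the integer
  part after one shift is exactly the next digit, which comparisons with 1 can read off.\<close>

text \<open>\<open>corr T E\<close>: the relation \<open>E\<close> matches the points of two real lines such that, for every
  \<open>(p, q) \<in> T\<close>, \<open>p\<close> on the first and \<open>q\<close> on the second line have the same signs at matching points, and
  matching points lie on the same side of matching roots. It plays the part of the sign diagrams in
  the Cohen-Hoermander method.\<close>

definition corr :: "(real poly \<times> real poly) set \<Rightarrow> (real \<times> real) set \<Rightarrow> bool" where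
  "corr T E \<longleftrightarrow> (\<forall>s. \<exists>t. (s, t) \<in> E) \<and> (\<forall>t. \<exists>s. (s, t) \<in> E) \<and>
     (\<forall>p q. (p, q) \<in> T \<longrightarrow> (\<forall>s t. (s, t) \<in> E \<longrightarrow> sgn (poly p s) = sgn (poly q t))) \<and>
     (\<forall>p q. (p, q) \<in> T \<longrightarrow> p \<noteq> 0 \<longrightarrow> (\<forall>s t z w. (s, t) \<in> E \<longrightarrow> (z, w) \<in> E \<longrightarrow>
        poly p z = 0 \<longrightarrow> sgn (s - z) = sgn (t - w)))"

lemma corr_left: "corr T E \<Longrightarrow> \<exists>t. (s, t) \<in> E"
  and corr_right: "corr T E \<Longrightarrow> \<exists>s. (s, t) \<in> E"
  and corr_sgn: "corr T E \<Longrightarrow> (p, q) \<in> T \<Longrightarrow> (s, t) \<in> E \<Longrightarrow> sgn (poly p s) = sgn (poly q t)"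
  and corr_root: "corr T E \<Longrightarrow> (p, q) \<in> T \<Longrightarrow> p \<noteq> 0 \<Longrightarrow> (s, t) \<in> E \<Longrightarrow> (z, w) \<in> E \<Longrightarrow>
    poly p z = 0 \<Longrightarrow> sgn (s - z) = sgn (t - w)"
  unfolding corr_def by metis+

lemma corrI:
  assumes "\<And>s. \<exists>t. (s, t) \<in> E" "\<And>t. \<exists>s. (s, t) \<in> E"
    "\<And>p q s t. (p, q) \<in> T \<Longrightarrow> (s, t) \<in> E \<Longrightarrow> sgn (poly p s) = sgn (poly q t)"
    "\<And>p q s t z w. (p, q) \<in> T \<Longrightarrow> p \<noteq> 0 \<Longrightarrow> (s, t) \<in> E \<Longrightarrow> (z, w) \<in> E \<Longrightarrow>
       poly p z = 0 \<Longrightarrow> sgn (s - z) = sgn (t - w)"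
  shows "corr T E"
  unfolding corr_def by (intro conjI allI impI) (rule assms; assumption)+

lemma corr_mono: "corr T E \<Longrightarrow> T' \<subseteq> T \<Longrightarrow> corr T' E"
  by (rule corrI) (auto intro: corr_left corr_right corr_sgn corr_root dest: subsetD)

section \<open>Signs and growth of real polynomials on intervals\<close>

lemma sgn_poly_eq_if_no_root:
  fixes p :: "real poly"
  assumes "\<And>x. min a b \<le> x \<Longrightarrow> x \<le> max a b \<Longrightarrow> poly p x \<noteq> 0"
  shows "sgn (poly p a) = sgn (poly p b)"
proof -
  have *: "sgn (poly p a) = sgn (poly p b)"
    if "a < b" "\<And>x. a \<le> x \<Longrightarrow> x \<le> b \<Longrightarrow> poly p x \<noteq> 0" for a b
  proof (rule ccontr)
    assume neq: "sgn (poly p a) \<noteq> sgn (poly p b)"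
    have "poly p a \<noteq> 0" "poly p b \<noteq> 0" using that by auto
    with neq have "poly p a < 0 \<and> 0 < poly p b \<or> poly p b < 0 \<and> 0 < poly p a"
      by (auto simp: sgn_if split: if_splits)
    then obtain x where "a < x" "x < b" "poly p x = 0"
      using poly_IVT_pos[OF \<open>a < b\<close>, of p] poly_IVT_neg[OF \<open>a < b\<close>, of p] by blast
    then show False using that(2)[of x] by auto
  qed
  show ?thesis
  proof (cases a b rule: linorder_cases)
    case less
    then show ?thesis using *[of a b] assms by auto
  next
    case greater
    then show ?thesis using *[of b a] assms by auto
  qed simp
qed

lemma poly_less_if_deriv_pos:
  fixes q :: "real poly"
  assumes "a < b" "\<And>x. a < x \<Longrightarrow> x < b \<Longrightarrow> poly (pderiv q) x > 0"
  shows "poly q a < poly q b"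
proof -
  obtain x where "a < x" "x < b" "poly q b - poly q a = (b - a) * poly (pderiv q) x"
    using poly_MVT[OF \<open>a < b\<close>, of q] by blast
  moreover have "(b - a) * poly (pderiv q) x > 0"
    using assms \<open>a < x\<close> \<open>x < b\<close> by simp
  ultimately show ?thesis by linarith
qed

text \<open>A nonconstant polynomial is unbounded. If the leading coefficient were negative,
  \<open>q\<close> would fall below its value at \<open>t0\<close>, which contradicts that it
  increases from there on.\<close>

lemma ex_poly_pos_above:
  fixes q :: "real poly"
  assumes "\<And>x. x \<ge> t0 \<Longrightarrow> poly (pderiv q) x > 0"
  shows "\<exists>t>t0. poly q t > 0"
proof -
  have deg: "degree q \<noteq> 0"
    using assms[of t0] pderiv_eq_0_iff[of q] by auto
  have big: "\<exists>n. \<forall>x\<ge>n. poly r x > M" if "degree r \<noteq> 0" "lead_coeff r > 0" for r :: "real poly" and M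
  proof -
    define r' where "r' = r + [:- M:]"
    have "degree r' = degree r"
      unfolding r'_def using that(1) by (intro degree_add_eq_left) simp
    then have lc: "lead_coeff r' = lead_coeff r"
      using that(1) by (cases "degree r") (auto simp: r'_def)
    then have "lead_coeff r' > 0" using that by simp
    then obtain n where n: "\<forall>x\<ge>n. poly r' x \<ge> lead_coeff r'"
      using poly_pinfty_gt_lc[of r'] that by auto
    have "poly r x > M" if x: "x \<ge> n" for x
    proof -
      have "lead_coeff r \<le> poly r x - M" using n[rule_format, OF x] lc by (simp add: r'_def)
      then show ?thesis using \<open>lead_coeff r > 0\<close> by linarith
    qed
    then show ?thesis by blast
  qed
  show ?thesis
  proof (cases "lead_coeff q > 0")
    case True
    then obtain n where "\<forall>x\<ge>n. poly q x > 0" using big[of q 0] deg by auto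
    then show ?thesis by (intro exI[of _ "max n (t0 + 1)"]) auto
  next
    case False
    moreover have "lead_coeff q \<noteq> 0" using deg by (metis degree_0 leading_coeff_0_iff)
    ultimately have "lead_coeff (- q) > 0" by (simp add: not_less less_le)
    then obtain n where n: "\<forall>x\<ge>n. poly (- q) x > - poly q t0" using big[of "- q" "- poly q t0"] deg by (metis degree_minus)
    have "poly q t0 < poly q (max n (t0 + 1))"
      by (rule poly_less_if_deriv_pos) (use assms in auto)
    with n[rule_format, of "max n (t0 + 1)"] show ?thesis by auto
  qed
qed

section \<open>Transfer of a sign from a point to the matching cell\<close>

definition cell_of :: "real set \<Rightarrow> (real \<times> real) set \<Rightarrow> real \<Rightarrow> real set" where
  "cell_of Z E s = {t. \<forall>(z, w) \<in> E. z \<in> Z \<longrightarrow> sgn (s - z) = sgn (t - w)}"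

text \<open>The cell of \<open>s\<close> and the one of its partner \<open>t0\<close> are complementary intervals of the roots; being
  monotone there in the same direction, \<open>q2\<close> takes the sign of \<open>q1 s\<close> in the latter.\<close>

locale matched_cells =
  fixes q1 q2 :: "real poly" and E :: "(real \<times> real) set" and Z :: "real set" and s t0 :: real
  assumes fin: "finite Z"
    and ord: "\<And>s t z w. (s, t) \<in> E \<Longrightarrow> (z, w) \<in> E \<Longrightarrow> z \<in> Z \<Longrightarrow> sgn (s - z) = sgn (t - w)"
    and tot: "\<And>s. \<exists>t. (s, t) \<in> E"
    and st: "(s, t0) \<in> E" "s \<notin> Z"
    and sq: "\<And>z w. (z, w) \<in> E \<Longrightarrow> z \<in> Z \<Longrightarrow> sgn (poly q1 z) = sgn (poly q2 w)"
    and d1: "\<And>x. poly (pderiv q1) x = 0 \<Longrightarrow> x \<in> Z"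
    and d2: "\<And>w. poly (pderiv q2) w = 0 \<Longrightarrow> \<exists>z\<in>Z. (z, w) \<in> E"
    and pos: "poly (pderiv q1) s > 0" "poly (pderiv q2) t0 > 0"
begin

abbreviation "cell \<equiv> cell_of Z E s"

text \<open>From \<open>s\<close> to the next point \<open>b\<close> of \<open>Z\<close> the
  polynomial \<open>q1\<close> increases, so it is positive at \<open>b\<close>, and
  \<open>q2\<close> is positive at the partner of \<open>b\<close>; by continuity it is positive
  slightly to the left, inside the cell. If no point of \<open>Z\<close> lies to the right of
  \<open>s\<close>, the cell is unbounded on that side and \<open>q2\<close> increases there, hence
  becomes positive.\<close>

lemma positive_in_cell:
  assumes q1s: "poly q1 s \<ge> 0"
  shows "\<exists>t\<in>cell. poly q2 t > 0"
proof (cases "\<exists>z\<in>Z. s < z")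
  case True
  define b where "b = Min {z\<in>Z. s < z}"
  have "b \<in> {z\<in>Z. s < z}" unfolding b_def by (rule Min_in) (use fin True in auto)
  then have b: "b \<in> Z" "s < b" by auto
  have bmin: "b \<le> z" if "z \<in> Z" "s < z" for z
    unfolding b_def using that fin by auto
  obtain b' where b': "(b, b') \<in> E" using tot by blast
  have tb: "t0 < b'" using ord[OF st(1) b' b(1)] b(2) by (auto simp: sgn_if split: if_splits)
  have "poly q1 s < poly q1 b"
  proof (rule poly_less_if_deriv_pos[OF b(2)])
    fix x assume x: "s < x" "x < b"
    have "sgn (poly (pderiv q1) s) = sgn (poly (pderiv q1) x)"
    proof (rule sgn_poly_eq_if_no_root)
      fix y assume "min s x \<le> y" "y \<le> max s x"
      then show "poly (pderiv q1) y \<noteq> 0"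
        using x d1[of y] bmin[of y] st(2) pos(1) by (cases "y = s") auto
    qed
    then show "poly (pderiv q1) x > 0" using pos(1) by (simp add: sgn_if split: if_splits)
  qed
  then have q2b: "poly q2 b' > 0" using q1s sq[OF b' b(1)] by (simp add: sgn_if split: if_splits)
  have mid: "t \<in> cell" if "t0 < t" "t < b'" for t
    unfolding cell_of_def
  proof (clarify)
    fix z w assume zw: "(z, w) \<in> E" "z \<in> Z"
    have 1: "sgn (s - z) = sgn (t0 - w)" using ord st(1) zw by blast
    have "z \<noteq> s" using zw st(2) by blast
    show "sgn (s - z) = sgn (t - w)"
    proof (cases "z < s")
      case True then show ?thesis using 1 that by (auto simp: sgn_if split: if_splits)
    next
      case False
      then have "b \<le> z" using bmin zw \<open>z \<noteq> s\<close> by auto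
      moreover have "sgn (b - z) = sgn (b' - w)" using ord b' zw by blast
      ultimately have "b' \<le> w" by (auto simp: sgn_if split: if_splits)
      then show ?thesis using False \<open>z \<noteq> s\<close> that by (auto simp: sgn_if)
    qed
  qed
  have "isCont (poly q2) b'" by simp
  then obtain e where e: "e > 0" "\<And>x. \<bar>x - b'\<bar> < e \<Longrightarrow> \<bar>poly q2 x - poly q2 b'\<bar> < poly q2 b'"
    using q2b unfolding continuous_at_eps_delta dist_real_def by blast
  \<comment> \<open>The first bound keeps \<open>t\<close> to the right of \<open>t0\<close>, the
    second keeps it within \<open>e\<close> of \<open>b'\<close>.\<close>
  define t where "t = max ((t0 + b') / 2) (b' - e / 2)"
  have "(t0 + b') / 2 \<le> t" "b' - e / 2 \<le> t" "t < b'" using tb e(1) unfolding t_def by auto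
  moreover have "t0 < (t0 + b') / 2" using tb by simp
  ultimately have "t0 < t" "t < b'" "\<bar>t - b'\<bar> < e" using e(1) by (auto simp: abs_if)
  then show ?thesis using mid[of t] e(2)[of t] by (intro bexI[of _ t]) auto
next
  case False
  have mid: "t \<in> cell" if "t0 \<le> t" for t
    unfolding cell_of_def
  proof (clarify)
    fix z w assume zw: "(z, w) \<in> E" "z \<in> Z"
    have 1: "sgn (s - z) = sgn (t0 - w)" using ord st(1) zw by blast
    have "z < s" using zw st(2) False by (metis linorder_neqE_linordered_idom)
    then show "sgn (s - z) = sgn (t - w)" using 1 that by (auto simp: sgn_if split: if_splits)
  qed
  have "\<exists>t>t0. poly q2 t > 0"
  proof (rule ex_poly_pos_above)
    fix x assume x: "x \<ge> t0"
    have "sgn (poly (pderiv q2) t0) = sgn (poly (pderiv q2) x)"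
    proof (rule sgn_poly_eq_if_no_root)
      fix y assume y: "min t0 x \<le> y" "y \<le> max t0 x"
      show "poly (pderiv q2) y \<noteq> 0"
      proof
        assume "poly (pderiv q2) y = 0"
        then obtain z where z: "z \<in> Z" "(z, y) \<in> E" using d2 by blast
        moreover have "y \<in> cell" using mid y x by simp
        ultimately have "sgn (s - z) = sgn (y - y)" unfolding cell_of_def by blast
        then show False using z st(2) by (auto simp: sgn_if split: if_splits)
      qed
    qed
    then show "poly (pderiv q2) x > 0" using pos(2) by (simp add: sgn_if split: if_splits)
  qed
  then show ?thesis using mid by (meson less_imp_le)
qed

text \<open>Reflect both lines at 0 and negate the values: the derivative of
  \<open>- q (- x)\<close> is \<open>q' (- x)\<close>, so the hypotheses are preserved, while
  negative values become positive ones.\<close>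

lemma negative_in_cell:
  assumes q1s: "poly q1 s \<le> 0"
  shows "\<exists>t\<in>cell. poly q2 t < 0"
proof -
  define r where "r q = - pcompose q [:0, -1 :: real:]" for q
  have r: "poly (r q) x = - poly q (- x)" "poly (pderiv (r q)) x = poly (pderiv q) (- x)" for q x
    by (simp_all add: r_def poly_pcompose pderiv_pcompose pderiv_minus pderiv_pCons)
  define E' where "E' = {(s, t). (- s, - t) \<in> E}"
  have E': "(s, t) \<in> E' \<longleftrightarrow> (- s, - t) \<in> E" for s t by (simp add: E'_def)
  have Z: "z \<in> uminus ` Z \<longleftrightarrow> - z \<in> Z" for z by (metis add.inverse_inverse image_iff)
  have sgn: "sgn (- a - - b) = - sgn (a - b)" for a b :: real by (simp add: sgn_if)
  interpret r: matched_cells "r q1" "r q2" E' "uminus ` Z" "- s" "- t0"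
  proof
    show "sgn (s - z) = sgn (t - w)" if "(s, t) \<in> E'" "(z, w) \<in> E'" "z \<in> uminus ` Z" for s t z w
      using ord[of "- s" "- t" "- z" "- w"] that unfolding E' Z sgn by simp
    show "\<exists>t. (s, t) \<in> E'" for s
      unfolding E' using tot[of "- s"] by (metis add.inverse_inverse)
    show "\<exists>z\<in>uminus ` Z. (z, w) \<in> E'" if "poly (pderiv (r q2)) w = 0" for w
      using d2[of "- w"] that unfolding r E' by auto
    show "sgn (poly (r q1) z) = sgn (poly (r q2) w)" if "(z, w) \<in> E'" "z \<in> uminus ` Z" for z w
      using sq[of "- z" "- w"] that unfolding r E' Z by (simp add: sgn_minus)
    show "x \<in> uminus ` Z" if "poly (pderiv (r q1)) x = 0" for x
      using d1[of "- x"] that unfolding r Z by simp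
  qed (use fin st pos in \<open>simp_all add: r E' Z\<close>)
  obtain t where t: "t \<in> r.cell" "poly (r q2) t > 0" using r.positive_in_cell q1s by (auto simp: r)
  have "- t \<in> cell"
    unfolding cell_of_def
  proof clarify
    fix z w assume "(z, w) \<in> E" "z \<in> Z"
    then have "(- z, - w) \<in> E'" "- z \<in> uminus ` Z" by (simp_all add: E')
    then have "sgn (- s - - z) = sgn (t - - w)" using t(1) unfolding cell_of_def by blast
    then show "sgn (s - z) = sgn (- t - w)" by (auto simp: sgn_if split: if_splits)
  qed
  then show ?thesis using t(2) unfolding r by auto
qed

text \<open>If \<open>q1 s\<close> is 0, both preceding lemmas apply, so \<open>q2\<close> changes
  sign in the cell; the cell is an interval and therefore contains a root of
  \<open>q2\<close>.\<close>

lemma same_sign_in_cell: "\<exists>t\<in>cell. sgn (poly q1 s) = sgn (poly q2 t)"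
proof -
  have conv: "x \<in> cell" if "a \<in> cell" "b \<in> cell" "a \<le> x" "x \<le> b" for a b x
    unfolding cell_of_def
  proof (clarify)
    fix z w assume zw: "(z, w) \<in> E" "z \<in> Z"
    have "sgn (s - z) = sgn (a - w)" "sgn (s - z) = sgn (b - w)" using that(1,2) zw unfolding cell_of_def by blast+
    then show "sgn (s - z) = sgn (x - w)" using that(3,4) by (auto simp: sgn_if split: if_splits)
  qed
  show ?thesis
  proof (cases "poly q1 s" "0 :: real" rule: linorder_cases)
    case less
    then obtain t where "t \<in> cell" "poly q2 t < 0" using negative_in_cell by auto
    then show ?thesis using less by (intro bexI[of _ t]) auto
  next
    case greater
    then obtain t where "t \<in> cell" "poly q2 t > 0" using positive_in_cell by auto
    then show ?thesis using greater by (intro bexI[of _ t]) auto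
  next
    case equal
    then obtain a b where ab: "a \<in> cell" "poly q2 a < 0" "b \<in> cell" "poly q2 b > 0" using positive_in_cell negative_in_cell by auto
    have "\<exists>x. min a b \<le> x \<and> x \<le> max a b \<and> poly q2 x = 0"
      using sgn_poly_eq_if_no_root[of a b q2] ab by (auto simp: sgn_if)
    then obtain x where "min a b \<le> x" "x \<le> max a b" "poly q2 x = 0" by blast
    then have "x \<in> cell" using conv[of "min a b" "max a b" x] ab by (auto simp: min_def max_def split: if_splits)
    then show ?thesis using equal \<open>poly q2 x = 0\<close> by (intro bexI[of _ x]) auto
  qed
qed

end

text \<open>The two remaining cases reduce to the locale: a point of \<open>Z\<close> keeps its
  partner, and a negative derivative becomes positive when both polynomials are negated.\<close>

lemma same_sign_in_cell':
  fixes q1 q2 :: "real poly" and E :: "(real \<times> real) set"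
  assumes fin: "finite Z"
    and ord: "\<And>s t z w. (s, t) \<in> E \<Longrightarrow> (z, w) \<in> E \<Longrightarrow> z \<in> Z \<Longrightarrow> sgn (s - z) = sgn (t - w)"
    and tot: "\<And>s. \<exists>t. (s, t) \<in> E"
    and sq: "\<And>z w. (z, w) \<in> E \<Longrightarrow> z \<in> Z \<Longrightarrow> sgn (poly q1 z) = sgn (poly q2 w)"
    and d1: "\<And>x. poly (pderiv q1) x = 0 \<Longrightarrow> x \<in> Z"
    and d2: "\<And>w. poly (pderiv q2) w = 0 \<Longrightarrow> \<exists>z\<in>Z. (z, w) \<in> E"
    and d12: "\<And>s t. (s, t) \<in> E \<Longrightarrow> sgn (poly (pderiv q1) s) = sgn (poly (pderiv q2) t)"
  shows "\<exists>t. (\<forall>z w. (z, w) \<in> E \<longrightarrow> z \<in> Z \<longrightarrow> sgn (s - z) = sgn (t - w)) \<and> sgn (poly q1 s) = sgn (poly q2 t)"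
proof -
  obtain t0 where st: "(s, t0) \<in> E" using tot by blast
  show ?thesis
  proof (cases "s \<in> Z")
    case True
    then show ?thesis using ord[OF st] sq[OF st] by blast
  next
    case False
    show ?thesis
    proof (cases "poly (pderiv q1) s > 0")
      case True
      then have "poly (pderiv q2) t0 > 0" using d12[OF st] by (simp add: sgn_if split: if_splits)
      then show ?thesis
        using matched_cells.same_sign_in_cell[OF matched_cells.intro[OF fin ord tot st False sq d1 d2]] True
        unfolding cell_of_def by blast
    next
      case np: False
      then have "poly (pderiv q1) s < 0" using d1[of s] False by fastforce
      moreover then have "poly (pderiv q2) t0 < 0" using d12[OF st] by (simp add: sgn_if split: if_splits)
      ultimately have "\<exists>t\<in>cell_of Z E s. sgn (poly (- q1) s) = sgn (poly (- q2) t)"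
        using sq d1 d2
        by (intro matched_cells.same_sign_in_cell[OF matched_cells.intro[OF fin ord tot st False]])
           (simp_all add: pderiv_minus sgn_minus)
      then show ?thesis unfolding cell_of_def by (simp add: sgn_minus) blast
    qed
  qed
qed

lemma corr_insert_const:
  assumes "corr T E" "degree q1 = 0" "degree q2 = 0" "sgn (coeff q1 0) = sgn (coeff q2 0)"
  shows "corr (insert (q1, q2) T) E"
proof -
  obtain a b where "q1 = [:a:]" "q2 = [:b:]" using assms(2,3) by (meson degree_eq_zeroE)
  then show ?thesis
    using assms(1,4) by (intro corrI) (auto intro: corr_left corr_right corr_sgn corr_root)
qed

text \<open>The induction step of the Cohen-Hoermander method. The roots of the derivative are among
  the old roots, so the new polynomial is strictly monotone between consecutive old roots, and its
  signs at these roots, given by \<open>sq\<close>, determine its behaviour in between.\<close>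

lemma corr_insert:
  assumes fin: "finite T" and corr: "corr T E"
    and zero: "\<And>p q. (p, q) \<in> T \<Longrightarrow> p = 0 \<longleftrightarrow> q = 0"
    and dT: "(pderiv q1, pderiv q2) \<in> T" and deg: "degree q1 \<noteq> 0" "degree q2 \<noteq> 0"
    and sq: "\<And>p q z w. (p, q) \<in> T \<Longrightarrow> p \<noteq> 0 \<Longrightarrow> (z, w) \<in> E \<Longrightarrow> poly p z = 0 \<Longrightarrow>
      sgn (poly q1 z) = sgn (poly q2 w)"
  shows "\<exists>E'. corr (insert (q1, q2) T) E'"
proof -
  define Z where "Z = {z. \<exists>p q. (p, q) \<in> T \<and> p \<noteq> 0 \<and> poly p z = 0}"
  define W where "W = {w. \<exists>p q. (p, q) \<in> T \<and> q \<noteq> 0 \<and> poly q w = 0}"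
  have "Z \<subseteq> (\<Union>x\<in>{x\<in>T. fst x \<noteq> 0}. {z. poly (fst x) z = 0})" unfolding Z_def by force
  then have finZ: "finite Z" by (rule finite_subset) (use fin in \<open>auto simp: poly_roots_finite\<close>)
  have "W \<subseteq> (\<Union>x\<in>{x\<in>T. snd x \<noteq> 0}. {z. poly (snd x) z = 0})" unfolding W_def by force
  then have finW: "finite W" by (rule finite_subset) (use fin in \<open>auto simp: poly_roots_finite\<close>)
  have root_iff: "poly p z = 0 \<longleftrightarrow> poly q w = 0" if "(p, q) \<in> T" "(z, w) \<in> E" for p q z w
    using corr_sgn[OF corr that] by (metis sgn_0_0)
  have ZW: "z \<in> Z \<longleftrightarrow> w \<in> W" if "(z, w) \<in> E" for z w
    unfolding Z_def W_def using root_iff[OF _ that] zero by blast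
  have ord: "sgn (s - z) = sgn (t - w)" if "(s, t) \<in> E" "(z, w) \<in> E" "z \<in> Z" for s t z w
    using that(3) corr_root[OF corr _ _ that(1,2)] unfolding Z_def by blast
  have sqZ: "sgn (poly q1 z) = sgn (poly q2 w)" if "(z, w) \<in> E" "z \<in> Z" for z w
    using that(2) sq[OF _ _ that(1)] unfolding Z_def by blast
  have dn0: "pderiv q1 \<noteq> 0" "pderiv q2 \<noteq> 0" using deg by (simp_all add: pderiv_eq_0_iff)
  have dZ: "x \<in> Z" if "poly (pderiv q1) x = 0" for x
    using that dT dn0 unfolding Z_def by blast
  have dW: "x \<in> W" if "poly (pderiv q2) x = 0" for x
    using that dT dn0 unfolding W_def by blast
  have d12: "sgn (poly (pderiv q1) s) = sgn (poly (pderiv q2) t)" if "(s, t) \<in> E" for s t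
    by (rule corr_sgn[OF corr dT that])
  \<comment> \<open>Points are matched anew: every point of the cell of \<open>s\<close> at which
    \<open>q2\<close> has the sign of \<open>q1 s\<close> becomes a partner of
    \<open>s\<close>.\<close>
  define E' where "E' = {(s, t). (\<forall>z w. (z, w) \<in> E \<longrightarrow> z \<in> Z \<longrightarrow> sgn (s - z) = sgn (t - w)) \<and>
    sgn (poly q1 s) = sgn (poly q2 t)}"
  have cut: "sgn (s - z) = sgn (t - w)" if "(s, t) \<in> E'" "(z, w) \<in> E" "z \<in> Z" for s t z w
    using that unfolding E'_def by blast
  have q12: "sgn (poly q1 s) = sgn (poly q2 t)" if "(s, t) \<in> E'" for s t
    using that unfolding E'_def by blast
  have left: "\<exists>t. (s, t) \<in> E'" for s
  proof -
    have "\<exists>t. (\<forall>z w. (z, w) \<in> E \<longrightarrow> z \<in> Z \<longrightarrow> sgn (s - z) = sgn (t - w)) \<and>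
        sgn (poly q1 s) = sgn (poly q2 t)"
    proof (rule same_sign_in_cell'[OF finZ ord corr_left[OF corr] sqZ dZ _ d12])
      fix w assume "poly (pderiv q2) w = 0"
      then show "\<exists>z\<in>Z. (z, w) \<in> E" using dW ZW corr_right[OF corr] by blast
    qed
    then show ?thesis unfolding E'_def by blast
  qed
  have right: "\<exists>s. (s, t) \<in> E'" for t
  proof -
    have "\<exists>s. (\<forall>w z. (w, z) \<in> E\<inverse> \<longrightarrow> w \<in> W \<longrightarrow> sgn (t - w) = sgn (s - z)) \<and>
        sgn (poly q2 t) = sgn (poly q1 s)"
    proof (rule same_sign_in_cell'[OF finW])
      fix w assume "poly (pderiv q1) w = 0"
      then show "\<exists>z\<in>W. (z, w) \<in> E\<inverse>" using dZ ZW corr_left[OF corr] by blast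
    next
      fix s t z w assume "(s, t) \<in> E\<inverse>" "(z, w) \<in> E\<inverse>" "z \<in> W"
      then show "sgn (s - z) = sgn (t - w)" using ord[of t s w z] ZW by simp
    next
      fix s show "\<exists>t. (s, t) \<in> E\<inverse>" using corr_right[OF corr] by simp
    next
      fix z w assume "(z, w) \<in> E\<inverse>" "z \<in> W"
      then show "sgn (poly q2 z) = sgn (poly q1 w)" using sqZ[of w z] ZW by simp
    next
      fix s t assume "(s, t) \<in> E\<inverse>"
      then show "sgn (poly (pderiv q2) s) = sgn (poly (pderiv q1) t)" using d12[of t s] by simp
    qed (rule dW)
    then obtain s where "\<forall>w z. (w, z) \<in> E\<inverse> \<longrightarrow> w \<in> W \<longrightarrow> sgn (t - w) = sgn (s - z)"
        "sgn (poly q2 t) = sgn (poly q1 s)" by blast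
    then have "(s, t) \<in> E'" unfolding E'_def using ZW by simp
    then show ?thesis by blast
  qed
  \<comment> \<open>The cell of an old root consists of the partner alone, so a pair of
    \<open>E'\<close> over an old root belongs to \<open>E\<close>.\<close>
  have E'Z: "(z, w) \<in> E" if "(z, w) \<in> E'" "z \<in> Z" for z w
  proof -
    obtain w0 where "(z, w0) \<in> E" using corr_left[OF corr] by blast
    with cut[OF that(1) this that(2)] show ?thesis by (simp add: sgn_if split: if_splits)
  qed
  \<comment> \<open>A sign change of \<open>q\<close> produces a root of \<open>q\<close>, and the
    partner of this root is an old root on the first line.\<close>
  have between: "\<exists>z w. (z, w) \<in> E \<and> z \<in> Z \<and> min t t' \<le> w \<and> w \<le> max t t'"
    if h: "(p, q) \<in> T" "p \<noteq> 0" "sgn (poly q t) \<noteq> sgn (poly q t')" for p q t t'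
  proof -
    obtain w where w: "min t t' \<le> w" "w \<le> max t t'" "poly q w = 0"
      using sgn_poly_eq_if_no_root[of t t' q] h(3) by blast
    obtain z where z: "(z, w) \<in> E" using corr_right[OF corr] by blast
    have "poly p z = 0" using root_iff[OF h(1) z] w by simp
    then show ?thesis using z w h unfolding Z_def by blast
  qed
  have sgn_T: "sgn (poly p s) = sgn (poly q t)" if pq: "(p, q) \<in> T" and st: "(s, t) \<in> E'" for p q s t
  proof (cases "s \<in> Z")
    case True
    then show ?thesis using E'Z corr_sgn[OF corr pq] st by blast
  next
    case False
    obtain t0 where t0: "(s, t0) \<in> E" using corr_left[OF corr] by blast
    show ?thesis
    proof (cases "p = 0")
      case True then show ?thesis using zero[OF pq] by simp
    next
      case p0: False
      have "sgn (poly q t) = sgn (poly q t0)"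
      proof (rule ccontr)
        assume "sgn (poly q t) \<noteq> sgn (poly q t0)"
        then obtain z w where zw: "(z, w) \<in> E" "z \<in> Z" "min t t0 \<le> w" "w \<le> max t t0"
          using between[OF pq p0] by blast
        have "sgn (t - w) = sgn (t0 - w)" using cut[OF st zw(1,2)] ord[OF t0 zw(1,2)] by simp
        moreover have "sgn (s - z) = sgn (t0 - w)" using ord[OF t0 zw(1,2)] .
        moreover have "s \<noteq> z" using False zw by blast
        ultimately show False using zw(3,4) by (auto simp: sgn_if min_def max_def split: if_splits)
      qed
      then show ?thesis using corr_sgn[OF corr pq t0] by simp
    qed
  qed
  text \<open>Away from the old roots \<open>q1\<close> and \<open>q2\<close> are monotone in the same direction, so that their
    signs decide on which side of a new root a point lies.\<close>
  have new_root: "sgn (s - z) = sgn (t - w)" if st: "(s, t) \<in> E'" and zw: "(z, w) \<in> E'" and z0: "poly q1 z = 0" for s t z w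
  proof (cases "\<exists>c\<in>Z. min s z \<le> c \<and> c \<le> max s z")
    case True
    then obtain c where c: "c \<in> Z" "min s z \<le> c" "c \<le> max s z" by blast
    obtain d where d: "(c, d) \<in> E" using corr_left[OF corr] by blast
    have "sgn (s - c) = sgn (t - d)" "sgn (z - c) = sgn (w - d)"
      using cut[OF st d c(1)] cut[OF zw d c(1)] by auto
    then show ?thesis using c(2,3) by (auto simp: sgn_if min_def max_def split: if_splits)
  next
    case no: False
    have no': "\<not> (min t w \<le> d \<and> d \<le> max t w)" if "(c, d) \<in> E" "c \<in> Z" for c d
    proof
      assume "min t w \<le> d \<and> d \<le> max t w"
      moreover have "sgn (s - c) = sgn (t - d)" "sgn (z - c) = sgn (w - d)"
        using cut[OF st that] cut[OF zw that] by auto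
      ultimately have "min s z \<le> c \<and> c \<le> max s z"
        by (auto simp: sgn_if min_def max_def split: if_splits)
      then show False using no that by blast
    qed
    have w0: "poly q2 w = 0" using q12[OF zw] z0 by (metis sgn_0_0)
    define D where "D = sgn (poly (pderiv q1) s)"
    have D1: "sgn (poly (pderiv q1) x) = D" if "min s z \<le> x" "x \<le> max s z" for x
      unfolding D_def using sgn_poly_eq_if_no_root[of x s "pderiv q1"] dZ no that
      by (smt (verit) max_def min_def)
    have D2: "sgn (poly (pderiv q2) x) = D" if "min t w \<le> x" "x \<le> max t w" for x
    proof -
      have "sgn (poly (pderiv q2) x) = sgn (poly (pderiv q2) t)"
      proof (rule sgn_poly_eq_if_no_root)
        fix y assume "min x t \<le> y" "y \<le> max x t"
        then have "min t w \<le> y" "y \<le> max t w" using that by auto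
        then show "poly (pderiv q2) y \<noteq> 0" using no' dW ZW corr_right[OF corr] by blast
      qed
      then show ?thesis using sgn_T[OF dT st] unfolding D_def by simp
    qed
    have Dn0: "D \<noteq> 0"
    proof
      assume "D = 0"
      then have "s \<in> Z" using dZ unfolding D_def by (simp add: sgn_0_0)
      then show False using no by auto
    qed
    have mono: "sgn (poly q b - poly q a) = sgn (b - a) * D"
      if "\<And>x. min a b \<le> x \<Longrightarrow> x \<le> max a b \<Longrightarrow> sgn (poly (pderiv q) x) = D" for q :: "real poly" and a b
    proof -
      have *: "\<exists>x. min a b \<le> x \<and> x \<le> max a b \<and> poly q b - poly q a = (b - a) * poly (pderiv q) x"
      proof (cases a b rule: linorder_cases)
        case less then show ?thesis using poly_MVT[OF less, of q] by (auto intro: less_imp_le)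
      next
        case greater
        then obtain x where "b < x" "x < a" "poly q a - poly q b = (a - b) * poly (pderiv q) x"
          using poly_MVT[OF greater, of q] by blast
        then show ?thesis by (intro exI[of _ x]) (auto simp: algebra_simps)
      qed (auto intro: exI[of _ a])
      then show ?thesis using that by (auto simp: sgn_mult)
    qed
    have "sgn (z - s) * D = - sgn (poly q1 s)" using mono[of s z q1] D1 z0 by (simp add: sgn_minus)
    moreover have "sgn (w - t) * D = - sgn (poly q2 t)" using mono[of t w q2] D2 w0 by (simp add: sgn_minus)
    ultimately have "sgn (z - s) = sgn (w - t)" using q12[OF st] Dn0 by (metis mult_right_cancel)
    then show ?thesis by (auto simp: sgn_if split: if_splits)
  qed
  have "corr (insert (q1, q2) T) E'"
  proof (rule corrI)
    fix p q s t assume "(p, q) \<in> insert (q1, q2) T" "(s, t) \<in> E'"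
    then show "sgn (poly p s) = sgn (poly q t)" using sgn_T q12 by blast
  next
    fix p q s t z w
    assume pq: "(p, q) \<in> insert (q1, q2) T" "p \<noteq> 0" and st: "(s, t) \<in> E'" and zw: "(z, w) \<in> E'"
      and z0: "poly p z = 0"
    show "sgn (s - z) = sgn (t - w)"
    proof (cases "(p, q) \<in> T")
      case True
      then have "z \<in> Z" unfolding Z_def using pq z0 by blast
      then show ?thesis using cut[OF st E'Z[OF zw]] by blast
    next
      case False
      then have "poly q1 z = 0" using pq z0 by simp
      from new_root[OF st zw this] show ?thesis .
    qed
  qed (use left right in blast)+
  then show ?thesis by blast
qed


section \<open>Polynomials with polynomial coefficients and their pseudo-remainders\<close>

inductive pf :: "((nat \<Rightarrow> real) \<Rightarrow> real) \<Rightarrow> bool" where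
  pf_one: "pf (\<lambda>e. 1)"
| pf_minus: "pf f \<Longrightarrow> pf (\<lambda>e. - f e)"
| pf_add: "pf f \<Longrightarrow> pf g \<Longrightarrow> pf (\<lambda>e. f e + g e)"
| pf_mult: "pf f \<Longrightarrow> pf g \<Longrightarrow> pf (\<lambda>e. f e * g e)"
| pf_var: "pf (\<lambda>e. e k)"

lemma pf_diff: "pf f \<Longrightarrow> pf g \<Longrightarrow> pf (\<lambda>e. f e - g e)"
  using pf_add[OF _ pf_minus, of f g] by simp

lemma pf_zero: "pf (\<lambda>e. 0)"
  using pf_diff[OF pf_one pf_one] by simp

lemma pf_sum: "(\<And>i. i \<in> I \<Longrightarrow> pf (f i)) \<Longrightarrow> pf (\<lambda>e. \<Sum>i\<in>I. f i e)"
  by (induction I rule: infinite_finite_induct) (auto intro: pf_zero pf_add)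

lemma pf_of_nat: "pf (\<lambda>e. real n)"
  using pf_sum[of "{..<n}" "\<lambda>i e. 1"] pf_one by simp

lemmas pf_intros = pf_one pf_minus pf_add pf_mult pf_var pf_diff pf_zero pf_sum pf_of_nat

definition pp :: "((nat \<Rightarrow> real) \<Rightarrow> real) list \<Rightarrow> (nat \<Rightarrow> real) \<Rightarrow> real poly" where
  "pp cs e = Poly (map (\<lambda>c. c e) cs)"

lemma coeff_pp: "coeff (pp cs e) i = (if i < length cs then (cs ! i) e else 0)"
  unfolding pp_def coeff_Poly_eq nth_default_def by simp

text \<open>One step of pseudo-division. With leading coefficients \<open>c\<close> of
  \<open>p\<close> and \<open>a\<close> of \<open>q\<close>, the difference of
  \<open>c * c * q\<close> and \<open>c * a * x ^ (m - j) * p\<close> has no term of degree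
  \<open>m\<close>. The factor is a square so that the sign of \<open>q\<close> at the roots of
  \<open>p\<close> is kept; multiplying by \<open>c\<close> alone could reverse it.\<close>

lemma prem_step:
  assumes "\<forall>f\<in>set q. pf f" "\<forall>f\<in>set p. pf f" "length q = Suc m" "length p = Suc j" "j \<le> m"
  shows "\<exists>r. length r = m \<and> (\<forall>f\<in>set r. pf f) \<and> (\<forall>e z. last p e \<noteq> 0 \<longrightarrow> poly (pp p e) z = 0 \<longrightarrow>
    sgn (poly (pp r e) z) = sgn (poly (pp q e) z))"
proof -
  define c where "c = p ! j"
  define a where "a = q ! m"
  define r where "r = map (\<lambda>i e. c e * c e * (q ! i) e - c e * a e * (if i < m - j then 0 else (p ! (i - (m - j))) e)) [0..<m]"
  have pf: "pf c" "pf a" using assms by (auto simp: c_def a_def)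
  have "pf (\<lambda>e. c e * c e * (q ! i) e - c e * a e * (if i < m - j then 0 else (p ! (i - (m - j))) e))"
    if "i < m" for i
  proof -
    have "pf (q ! i)" using assms that by simp
    moreover have "pf (p ! (i - (m - j)))" using assms that by simp
    ultimately show ?thesis using pf by (cases "i < m - j") (auto intro!: pf_intros)
  qed
  then have pfr: "\<forall>f\<in>set r. pf f" unfolding r_def by auto
  have pr: "pp r e = smult (c e * c e) (pp q e) - smult (c e * a e) (monom 1 (m - j) * pp p e)" for e
  proof (rule poly_eqI)
    fix i
    show "coeff (pp r e) i = coeff (smult (c e * c e) (pp q e) - smult (c e * a e) (monom 1 (m - j) * pp p e)) i"
      using assms(3-5) by (cases i m rule: linorder_cases) (auto simp: coeff_pp coeff_monom_mult r_def c_def a_def)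
  qed
  have "last p = c" using assms(4) unfolding c_def by (cases p rule: rev_cases) (auto simp: nth_append)
  moreover have "poly (pp r e) z = c e * c e * poly (pp q e) z" if "poly (pp p e) z = 0" for e z
    using that by (simp add: pr)
  ultimately show ?thesis using pfr by (intro exI[of _ r]) (auto simp: r_def sgn_mult)
qed

lemma prem_exists:
  assumes "\<forall>f\<in>set q. pf f" "\<forall>f\<in>set p. pf f" "p \<noteq> []"
  shows "\<exists>r. length r < length p \<and> (\<forall>f\<in>set r. pf f) \<and> (\<forall>e z. last p e \<noteq> 0 \<longrightarrow> poly (pp p e) z = 0 \<longrightarrow>
    sgn (poly (pp r e) z) = sgn (poly (pp q e) z))"
  using assms(1)
proof (induction "length q" arbitrary: q rule: less_induct)
  case less
  show ?case
  proof (cases "length q < length p")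
    case True
    then show ?thesis using less.prems by blast
  next
    case False
    then obtain m j where mj: "length q = Suc m" "length p = Suc j" "j \<le> m"
      using assms(3) by (cases "length q"; cases "length p") auto
    obtain r where r: "length r = m" "\<forall>f\<in>set r. pf f"
      "\<forall>e z. last p e \<noteq> 0 \<longrightarrow> poly (pp p e) z = 0 \<longrightarrow> sgn (poly (pp r e) z) = sgn (poly (pp q e) z)"
      using prem_step[OF less.prems assms(2) mj] by blast
    obtain r' where "length r' < length p" "\<forall>f\<in>set r'. pf f"
      "\<forall>e z. last p e \<noteq> 0 \<longrightarrow> poly (pp p e) z = 0 \<longrightarrow> sgn (poly (pp r' e) z) = sgn (poly (pp r e) z)"
      using less.hyps[of r] r mj by auto
    then show ?thesis using r(3) by (intro exI[of _ r']) auto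
  qed
qed

definition pderiv_list :: "((nat \<Rightarrow> real) \<Rightarrow> real) list \<Rightarrow> ((nat \<Rightarrow> real) \<Rightarrow> real) list" where
  "pderiv_list q = map (\<lambda>i e. real (Suc i) * (q ! Suc i) e) [0..<length q - 1]"

lemma pp_pderiv_list: "pp (pderiv_list q) e = pderiv (pp q e)"
  by (rule poly_eqI) (auto simp: coeff_pp coeff_pderiv pderiv_list_def)

lemma pf_pderiv_list: "\<forall>f\<in>set q. pf f \<Longrightarrow> \<forall>f\<in>set (pderiv_list q). pf f"
  unfolding pderiv_list_def by (auto intro!: pf_mult pf_of_nat simp del: of_nat_Suc)

definition same_signs :: "((nat \<Rightarrow> real) \<Rightarrow> real) set \<Rightarrow> (nat \<Rightarrow> real) \<Rightarrow> (nat \<Rightarrow> real) \<Rightarrow> bool" where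
  "same_signs Q x y \<longleftrightarrow> (\<forall>c\<in>Q. sgn (c x) = sgn (c y))"

lemma same_signs_mono: "same_signs Q x y \<Longrightarrow> Q' \<subseteq> Q \<Longrightarrow> same_signs Q' x y"
  by (auto simp: same_signs_def)

lemma degree_eq_if_same_signs:
  assumes "same_signs (set p) x y"
  shows "degree (pp p x) = degree (pp p y)" "pp p x = 0 \<longleftrightarrow> pp p y = 0"
proof -
  have *: "coeff (pp p x) i = 0 \<longleftrightarrow> coeff (pp p y) i = 0" for i
    using assms unfolding same_signs_def coeff_pp by (metis nth_mem sgn_0_0)
  show "degree (pp p x) = degree (pp p y)" unfolding degree_def * ..
  show "pp p x = 0 \<longleftrightarrow> pp p y = 0" unfolding poly_eq_iff using * by simp
qed

lemma pp_take:
  assumes "pp p e \<noteq> 0" "j = Suc (degree (pp p e))"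
  shows "j \<le> length p" "pp (take j p) e = pp p e" "last (take j p) e \<noteq> 0" "take j p \<noteq> []"
proof -
  have lc: "coeff (pp p e) (degree (pp p e)) \<noteq> 0" using assms by simp
  then show jl: "j \<le> length p" using assms unfolding coeff_pp by (auto split: if_splits)
  then show ne: "take j p \<noteq> []" using assms by auto
  show "pp (take j p) e = pp p e"
  proof (rule poly_eqI)
    fix i
    show "coeff (pp (take j p) e) i = coeff (pp p e) i"
    proof (cases "i < j")
      case True then show ?thesis by (simp add: coeff_pp)
    next
      case False
      then have "coeff (pp p e) i = 0" using assms by (intro coeff_eq_0) simp
      then show ?thesis using False by (simp add: coeff_pp)
    qed
  qed
  have "last (take j p) = p ! degree (pp p e)"
    using ne jl assms by (simp add: last_conv_nth)
  then show "last (take j p) e \<noteq> 0" using lc jl assms by (simp add: coeff_pp)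
qed

abbreviation pairs :: "(nat \<Rightarrow> real) \<Rightarrow> (nat \<Rightarrow> real) \<Rightarrow> ((nat \<Rightarrow> real) \<Rightarrow> real) list set \<Rightarrow> (real poly \<times> real poly) set" where
  "pairs x y S \<equiv> (\<lambda>p. (pp p x, pp p y)) ` S"

text \<open>The truncations \<open>take j p\<close> provide for vanishing leading coefficients: one of them has the actual
  leading coefficient of \<open>p\<close>, and the remainder modulo it has the sign of \<open>q\<close> at the roots of \<open>p\<close>.\<close>

lemma corr_of_same_signs:
  assumes "finite S" "\<forall>p\<in>S. \<forall>f\<in>set p. pf f" "\<forall>p\<in>S. length p \<le> d"
  shows "\<exists>Q. finite Q \<and> (\<forall>f\<in>Q. pf f) \<and>
    (\<forall>x y. same_signs Q x y \<longrightarrow> (\<exists>E. corr (pairs x y S) E))"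
  using assms
proof (induction d arbitrary: S)
  case 0
  then have "S \<subseteq> {[]}" by auto
  then have "corr (pairs x y S) UNIV" for x y
    by (intro corrI) (auto simp: pp_def)
  then show ?case by (intro exI[of _ "{}"]) blast
next
  case (Suc d S)
  note outer = Suc.IH
  show ?case using Suc.prems
  \<comment> \<open>The outer induction bounds the length, the inner one counts the lists of maximal
    length. A list \<open>q\<close> of maximal length is traded for its derivative and for
    remainders of \<open>q\<close>, all of which are strictly shorter.\<close>
  proof (induction "card {p\<in>S. length p = Suc d}" arbitrary: S)
    case 0
    then have "{p\<in>S. length p = Suc d} = {}" by simp
    with 0(4) have "\<forall>p\<in>S. length p \<le> d" by (auto simp: le_Suc_eq)
    then show ?case using outer 0 by blast
  next
    case (Suc n)
    then obtain q where q: "q \<in> S" "length q = Suc d"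
      by (metis (mono_tags, lifting) card.empty empty_Collect_eq nat.distinct(1))
    define R where "R = S - {q}"
    define U where "U = insert (pderiv_list q) R"
    have lenD: "length (pderiv_list q) = d" using q by (simp add: pderiv_list_def)
    have finU: "finite U" and pfU: "\<forall>p\<in>U. \<forall>f\<in>set p. pf f" and lenU: "\<forall>p\<in>U. length p \<le> Suc d"
      unfolding U_def R_def using Suc.prems q pf_pderiv_list lenD by auto
    have pfq: "\<forall>f\<in>set q. pf f" using Suc.prems q by blast
    have "\<forall>p. \<exists>r. (\<forall>f\<in>set p. pf f) \<longrightarrow> p \<noteq> [] \<longrightarrow> length r < length p \<and> (\<forall>f\<in>set r. pf f) \<and>
       (\<forall>e z. last p e \<noteq> 0 \<longrightarrow> poly (pp p e) z = 0 \<longrightarrow> sgn (poly (pp r e) z) = sgn (poly (pp q e) z))"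
      using prem_exists[OF pfq] by meson
    then obtain f where f: "\<And>p. (\<forall>f\<in>set p. pf f) \<Longrightarrow> p \<noteq> [] \<Longrightarrow> length (f p) < length p \<and> (\<forall>f\<in>set (f p). pf f) \<and>
       (\<forall>e z. last p e \<noteq> 0 \<longrightarrow> poly (pp p e) z = 0 \<longrightarrow> sgn (poly (pp (f p) e) z) = sgn (poly (pp q e) z))"
      unfolding choice_iff by blast
    define V where "V = (\<lambda>(p, j). f (take j p)) ` (SIGMA p:U. {1..length p})"
    have Vf: "length r \<le> d \<and> (\<forall>f\<in>set r. pf f)" if rV: "r \<in> V" for r
    proof -
      obtain p j where pj: "p \<in> U" "1 \<le> j" "j \<le> length p" "r = f (take j p)" using rV unfolding V_def by auto
      have "\<forall>f\<in>set (take j p). pf f" using pj pfU by (meson in_set_takeD)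
      moreover have "take j p \<noteq> []" using pj by auto
      ultimately have "length r < length (take j p)" "\<forall>f\<in>set r. pf f"
        unfolding pj(4) using f[of "take j p"] by blast+
      moreover have "length p \<le> Suc d" using pj lenU by blast
      ultimately show ?thesis using pj by simp
    qed
    have finV: "finite V" unfolding V_def using finU by (intro finite_imageI finite_SigmaI) auto
    have "p \<in> U \<union> V \<and> length p = Suc d \<longleftrightarrow> (p \<in> S \<and> length p = Suc d) \<and> p \<noteq> q" for p
      unfolding U_def R_def using Vf[of p] lenD by auto
    then have "{p\<in>U \<union> V. length p = Suc d} = {p\<in>S. length p = Suc d} - {q}" by blast
    then have "n = card {p\<in>U \<union> V. length p = Suc d}"
      using Suc.hyps(2) q Suc.prems(1) by simp
    then have "\<exists>Q. finite Q \<and> (\<forall>f\<in>Q. pf f) \<and>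
        (\<forall>x y. same_signs Q x y \<longrightarrow> (\<exists>E. corr (pairs x y (U \<union> V)) E))"
    proof (rule Suc.hyps(1))
      show "finite (U \<union> V)" using finU finV by simp
      show "\<forall>p\<in>U \<union> V. \<forall>f\<in>set p. pf f" using pfU Vf by blast
      show "\<forall>p\<in>U \<union> V. length p \<le> Suc d" using lenU Vf le_SucI by blast
    qed
    then obtain Q' where Q': "finite Q'" "\<forall>f\<in>Q'. pf f"
      "\<And>x y. same_signs Q' x y \<Longrightarrow> \<exists>E. corr (pairs x y (U \<union> V)) E"
      by blast
    \<comment> \<open>With the coefficients in \<open>Q\<close>, the polynomials at \<open>x\<close>
      and at \<open>y\<close> have equal degrees, so the same truncation serves at both
      points.\<close>
    define Q where "Q = Q' \<union> (\<Union>p\<in>insert q U. set p)"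
    have "\<exists>E. corr (pairs x y S) E" if ag: "same_signs Q x y" for x y
    proof -
      obtain E where E: "corr (pairs x y (U \<union> V)) E"
        using Q'(3) same_signs_mono[OF ag, of Q'] unfolding Q_def by auto
      have EU: "corr (pairs x y U) E" by (rule corr_mono[OF E]) (rule image_mono, rule Un_upper1)
      have agp: "same_signs (set p) x y" if "p \<in> insert q U" for p
        by (rule same_signs_mono[OF ag]) (use that in \<open>auto simp: Q_def\<close>)
      have sub: "pairs x y S \<subseteq> insert (pp q x, pp q y) (pairs x y U)" unfolding U_def R_def by auto
      have degq: "degree (pp q x) = degree (pp q y)" by (rule degree_eq_if_same_signs(1)[OF agp]) simp
      have "\<exists>E'. corr (insert (pp q x, pp q y) (pairs x y U)) E'"
      proof (cases "degree (pp q x) = 0")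
        case True
        have "sgn (coeff (pp q x) 0) = sgn (coeff (pp q y) 0)"
          using agp[of q] q unfolding coeff_pp same_signs_def by simp
        then show ?thesis using corr_insert_const[OF EU True] True degq by auto
      next
        case False
        show ?thesis
        proof (rule corr_insert[OF _ EU])
          fix a b assume "(a, b) \<in> pairs x y U"
          then obtain p where p: "p \<in> U" "a = pp p x" "b = pp p y" by auto
          show "a = 0 \<longleftrightarrow> b = 0" unfolding p(2,3) by (rule degree_eq_if_same_signs(2)[OF agp]) (use p in simp)
        next
          show "(pderiv (pp q x), pderiv (pp q y)) \<in> pairs x y U"
            unfolding U_def by (auto simp: pp_pderiv_list)
        next
          fix a b z w
          assume ab: "(a, b) \<in> pairs x y U" "a \<noteq> 0" and zw: "(z, w) \<in> E" and z0: "poly a z = 0"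
          from ab obtain p where p: "p \<in> U" "a = pp p x" "b = pp p y" by auto
          define j where "j = Suc (degree (pp p x))"
          have same: "degree (pp p x) = degree (pp p y)" "b \<noteq> 0"
            using degree_eq_if_same_signs[OF agp, of p] p ab by auto
          note tx = pp_take[of p x j] and ty = pp_take[of p y j]
          have tp: "pp (take j p) x = a" "pp (take j p) y = b" "last (take j p) x \<noteq> 0" "last (take j p) y \<noteq> 0"
              "take j p \<noteq> []" "j \<le> length p"
            using tx ty ab(2) same p by (auto simp: j_def)
          have fV: "f (take j p) \<in> V" unfolding V_def using p tp(6) by (auto simp: j_def intro!: image_eqI[of _ _ "(p, j)"])
          have "poly b w = 0" using corr_sgn[OF EU ab(1) zw] z0 by (metis sgn_0_0)
          moreover have pfp: "\<forall>f\<in>set (take j p). pf f" using p pfU by (auto dest: in_set_takeD)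
          ultimately have "sgn (poly (pp q x) z) = sgn (poly (pp (f (take j p)) x) z)"
            "sgn (poly (pp q y) w) = sgn (poly (pp (f (take j p)) y) w)"
            using f[OF pfp tp(5)] tp z0 by simp_all
          moreover have "sgn (poly (pp (f (take j p)) x) z) = sgn (poly (pp (f (take j p)) y) w)"
            by (rule corr_sgn[OF E _ zw]) (use fV in blast)
          ultimately show "sgn (poly (pp q x) z) = sgn (poly (pp q y) w)" by simp
        qed (use finU False degq in auto)
      qed
      then show ?thesis using corr_mono[OF _ sub] by blast
    qed
    moreover have "finite Q" "\<forall>f\<in>Q. pf f"
      unfolding Q_def using Q' finU pfU pfq by auto
    ultimately show ?case by blast
  qed
qed

lemma pf_coeff_pp: "\<forall>c\<in>set cs. pf c \<Longrightarrow> pf (\<lambda>e. coeff (pp cs e) i)"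
  by (cases "i < length cs") (auto simp: coeff_pp intro: pf_zero)

lemma pf_as_poly:
  assumes "pf f"
  shows "\<exists>cs. (\<forall>c\<in>set cs. pf c) \<and> (\<forall>e t. f (e(v := t)) = poly (pp cs e) t)"
  using assms
proof induction
  case pf_one
  then show ?case by (intro exI[of _ "[\<lambda>e. 1]"]) (auto simp: pp_def intro: pf_intros)
next
  case (pf_minus f)
  then obtain cs where "\<forall>c\<in>set cs. pf c" "\<forall>e t. f (e(v := t)) = poly (pp cs e) t" by blast
  moreover have "pp (map (\<lambda>c e. - c e) cs) e = - pp cs e" for e
    by (rule poly_eqI) (simp add: coeff_pp)
  ultimately show ?case by (intro exI[of _ "map (\<lambda>c e. - c e) cs"]) (auto intro: pf.pf_minus simp del: fun_upd_apply)
next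
  case (pf_add f g)
  then obtain a b where a: "\<forall>c\<in>set a. pf c" "\<forall>e t. f (e(v := t)) = poly (pp a e) t"
    and b: "\<forall>c\<in>set b. pf c" "\<forall>e t. g (e(v := t)) = poly (pp b e) t" by blast
  define cs where "cs = map (\<lambda>k e. coeff (pp a e) k + coeff (pp b e) k) [0..<length a + length b]"
  have "pp cs e = pp a e + pp b e" for e
    unfolding cs_def by (rule poly_eqI) (simp add: coeff_pp)
  moreover have "\<forall>c\<in>set cs. pf c"
    unfolding cs_def using a b by (auto intro!: pf.pf_add pf_coeff_pp)
  ultimately show ?case using a b by (intro exI[of _ cs]) (simp del: fun_upd_apply)
next
  case (pf_mult f g)
  then obtain a b where a: "\<forall>c\<in>set a. pf c" "\<forall>e t. f (e(v := t)) = poly (pp a e) t"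
    and b: "\<forall>c\<in>set b. pf c" "\<forall>e t. g (e(v := t)) = poly (pp b e) t" by blast
  \<comment> \<open>The length exceeds the degree of the product, so no coefficient is lost.\<close>
  define cs where "cs = map (\<lambda>k e. \<Sum>i\<le>k. coeff (pp a e) i * coeff (pp b e) (k - i)) [0..<length a + length b]"
  have "pp cs e = pp a e * pp b e" for e
  proof (rule poly_eqI)
    fix k
    show "coeff (pp cs e) k = coeff (pp a e * pp b e) k"
    proof (cases "k < length a + length b")
      case True
      then show ?thesis unfolding coeff_mult coeff_pp[of cs] by (simp add: cs_def)
    next
      case False
      then have "coeff (pp a e) i * coeff (pp b e) (k - i) = 0" if "i \<le> k" for i
        using that by (auto simp: coeff_pp)
      then have "(\<Sum>i\<le>k. coeff (pp a e) i * coeff (pp b e) (k - i)) = 0" by (intro sum.neutral) simp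
      then show ?thesis using False unfolding coeff_mult coeff_pp[of cs] by (simp add: cs_def)
    qed
  qed
  moreover have "\<forall>c\<in>set cs. pf c"
    unfolding cs_def using a b by (auto intro!: pf.pf_mult pf_sum pf_coeff_pp)
  ultimately show ?case using a b by (intro exI[of _ cs]) (simp del: fun_upd_apply)
next
  case (pf_var k)
  show ?case
  proof (cases "k = v")
    case True
    then show ?thesis
      by (intro exI[of _ "[\<lambda>e. 0, \<lambda>e. 1]"]) (auto simp: pp_def intro: pf_intros)
  next
    case False
    then show ?thesis
      by (intro exI[of _ "[\<lambda>e. e k]"]) (auto simp: pp_def intro: pf_intros)
  qed
qed

text \<open>Semialgebraic over the integers, expressed semantically: the predicate is a union of
  sign classes of a finite family.\<close>

definition sa :: "((nat \<Rightarrow> real) \<Rightarrow> bool) \<Rightarrow> bool" where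
  "sa P \<longleftrightarrow> (\<exists>F. finite F \<and> (\<forall>f\<in>F. pf f) \<and> (\<forall>x y. same_signs F x y \<longrightarrow> P x = P y))"

text \<open>The projection step of Tarski-Seidenberg. Read the polynomials of \<open>F\<close> as
  polynomials in variable \<open>v\<close>; a witness \<open>t\<close> at \<open>x\<close> is
  replaced at \<open>y\<close> by any partner of \<open>t\<close> under the correspondence, which
  has the same signs for all of \<open>F\<close>.\<close>

lemma sa_ex:
  assumes "sa P"
  shows "sa (\<lambda>e. \<exists>t. P (e(v := t)))"
proof -
  obtain F where F: "finite F" "\<forall>f\<in>F. pf f" "\<And>x y. same_signs F x y \<Longrightarrow> P x = P y"
    using assms unfolding sa_def by blast
  have "\<exists>cs. (\<forall>c\<in>set cs. pf c) \<and> (\<forall>e t. f (e(v := t)) = poly (pp cs e) t)" if "f \<in> F" for f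
    by (rule pf_as_poly) (use F(2) that in blast)
  then have "\<forall>f\<in>F. \<exists>cs. (\<forall>c\<in>set cs. pf c) \<and> (\<forall>e t. f (e(v := t)) = poly (pp cs e) t)" by (rule ballI)
  from bchoice[OF this] obtain cs where
    cs': "\<forall>f\<in>F. (\<forall>c\<in>set (cs f). pf c) \<and> (\<forall>e t. f (e(v := t)) = poly (pp (cs f) e) t)" ..
  have cs: "\<forall>c\<in>set (cs f). pf c" "f (e(v := t)) = poly (pp (cs f) e) t" if "f \<in> F" for f e t
    by (rule conjunct1[OF bspec[OF cs' that]], rule conjunct2[OF bspec[OF cs' that], THEN spec, THEN spec])
  define d where "d = Max (length ` cs ` F)"
  have len: "\<forall>p\<in>cs ` F. length p \<le> d" unfolding d_def using F(1) by auto
  have finpf: "finite (cs ` F)" "\<forall>p\<in>cs ` F. \<forall>f\<in>set p. pf f" using F(1) cs(1) by auto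
  obtain Q where Q: "finite Q" "\<forall>f\<in>Q. pf f"
    "\<And>x y. same_signs Q x y \<Longrightarrow> \<exists>E. corr (pairs x y (cs ` F)) E"
    using corr_of_same_signs[OF finpf len] by auto
  have imp: "\<exists>t. P (y(v := t))" if xy: "same_signs Q x y" and t: "P (x(v := t))" for x y t
  proof -
    obtain E where E: "corr (pairs x y (cs ` F)) E" using Q(3)[OF xy] by blast
    obtain t' where t': "(t, t') \<in> E" using corr_left[OF E] by blast
    have "same_signs F (x(v := t)) (y(v := t'))"
      unfolding same_signs_def
    proof
      fix f assume "f \<in> F"
      then show "sgn (f (x(v := t))) = sgn (f (y(v := t')))"
        using corr_sgn[OF E _ t', of "pp (cs f) x" "pp (cs f) y"] by (simp add: cs(2) del: fun_upd_apply)
    qed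
    then show ?thesis using F(3) t by blast
  qed
  have "(\<exists>t. P (x(v := t))) = (\<exists>t. P (y(v := t)))" if "same_signs Q x y" for x y
    using imp[OF that] imp[of y x] that unfolding same_signs_def by metis
  then show ?thesis unfolding sa_def using Q by blast
qed


section \<open>Semialgebraic predicates and functions with sign tests\<close>

lemma sa_const: "sa (\<lambda>e. b)"
  unfolding sa_def by (intro exI[of _ "{}"]) simp

lemma sa_not: "sa P \<Longrightarrow> sa (\<lambda>e. \<not> P e)"
  unfolding sa_def by metis

lemma sa_conj:
  assumes "sa P" "sa Q"
  shows "sa (\<lambda>e. P e \<and> Q e)"
proof -
  obtain F where F: "finite F" "\<forall>f\<in>F. pf f" "\<And>x y. same_signs F x y \<Longrightarrow> P x = P y"
    using assms(1) unfolding sa_def by blast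
  obtain G where G: "finite G" "\<forall>f\<in>G. pf f" "\<And>x y. same_signs G x y \<Longrightarrow> Q x = Q y"
    using assms(2) unfolding sa_def by blast
  have "(P x \<and> Q x) = (P y \<and> Q y)" if "same_signs (F \<union> G) x y" for x y
    using F(3)[OF same_signs_mono[OF that]] G(3)[OF same_signs_mono[OF that]] by simp
  then show ?thesis unfolding sa_def using F G by (intro exI[of _ "F \<union> G"]) auto
qed

lemma sa_ball: "finite I \<Longrightarrow> (\<And>i. i \<in> I \<Longrightarrow> sa (P i)) \<Longrightarrow> sa (\<lambda>e. \<forall>i\<in>I. P i e)"
  by (induction I rule: finite_induct) (simp_all add: sa_const sa_conj)

lemma sa_all_finite: "(\<And>i :: 'i :: finite. sa (P i)) \<Longrightarrow> sa (\<lambda>e. \<forall>i. P i e)"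
  using sa_ball[of "UNIV :: 'i set" P] by simp

lemma
  assumes "pf f"
  shows sa_pos: "sa (\<lambda>e. f e > 0)" and sa_eq_0: "sa (\<lambda>e. f e = 0)"
proof -
  have "(f x > 0) = (f y > 0)" "(f x = 0) = (f y = 0)" if "same_signs {f} x y" for x y
    using that unfolding same_signs_def by (auto simp: sgn_if split: if_splits)
  then show "sa (\<lambda>e. f e > 0)" "sa (\<lambda>e. f e = 0)"
    unfolding sa_def by (intro exI[of _ "{f}"]; simp add: assms)+
qed

lemma sa_ex_finite:
  assumes "sa P" "finite V"
  shows "sa (\<lambda>e. \<exists>y. P (\<lambda>k. if k \<in> V then y k else e k))"
  using assms(2)
proof (induction V rule: finite_induct)
  case empty
  then show ?case using assms(1) by simp
next
  case (insert v V)
  have "(\<exists>t y. P (\<lambda>k. if k \<in> V then y k else (e(v := t)) k)) \<longleftrightarrow>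
      (\<exists>y. P (\<lambda>k. if k \<in> insert v V then y k else e k))" (is "?L \<longleftrightarrow> ?R") for e
  proof
    assume ?L
    then obtain t y where ty: "P (\<lambda>k. if k \<in> V then y k else (e(v := t)) k)" by blast
    have "(\<lambda>k. if k \<in> V then y k else (e(v := t)) k) =
        (\<lambda>k. if k \<in> insert v V then (y(v := t)) k else e k)"
      using insert by auto
    with ty have "P (\<lambda>k. if k \<in> insert v V then (y(v := t)) k else e k)" by metis
    then show ?R by blast
  next
    assume ?R
    then obtain y where y: "P (\<lambda>k. if k \<in> insert v V then y k else e k)" by blast
    have "(\<lambda>k. if k \<in> insert v V then y k else e k) = (\<lambda>k. if k \<in> V then y k else (e(v := y v)) k)"
      using insert by auto
    with y have "P (\<lambda>k. if k \<in> V then y k else (e(v := y v)) k)" by metis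
    then show ?L by blast
  qed
  then show ?case using sa_ex[OF insert.IH, of v] by simp
qed

text \<open>The functions that a straight-line word of primitive operations computes. The step
  function turns a sign test into a number, so case distinctions become arithmetic and the words
  need no jumps.\<close>

inductive ef :: "((nat \<Rightarrow> real) \<Rightarrow> real) \<Rightarrow> bool" where
  ef_one: "ef (\<lambda>e. 1)"
| ef_minus: "ef f \<Longrightarrow> ef (\<lambda>e. - f e)"
| ef_add: "ef f \<Longrightarrow> ef g \<Longrightarrow> ef (\<lambda>e. f e + g e)"
| ef_mult: "ef f \<Longrightarrow> ef g \<Longrightarrow> ef (\<lambda>e. f e * g e)"
| ef_var: "ef (\<lambda>e. e k)"
| ef_step: "ef f \<Longrightarrow> ef (\<lambda>e. if f e \<ge> 0 then 1 else 0)"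

lemma ef_diff: "ef f \<Longrightarrow> ef g \<Longrightarrow> ef (\<lambda>e. f e - g e)"
  using ef_add[OF _ ef_minus, of f g] by simp

lemma ef_zero: "ef (\<lambda>e. 0)"
  using ef_diff[OF ef_one ef_one] by simp

lemma ef_sum: "(\<And>i. i \<in> I \<Longrightarrow> ef (f i)) \<Longrightarrow> ef (\<lambda>e. \<Sum>i\<in>I. f i e)"
  by (induction I rule: infinite_finite_induct) (auto intro: ef_zero ef_add)

lemma ef_of_nat: "ef (\<lambda>e. real n)"
  using ef_sum[of "{..<n}" "\<lambda>i e. 1"] ef_one by simp

lemma ef_of_int: "ef (\<lambda>e. real_of_int z)"
  using ef_diff[OF ef_of_nat[of "nat z"] ef_of_nat[of "nat (- z)"]]
  by (cases "z \<ge> 0") simp_all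

lemma ef_pf: "pf f \<Longrightarrow> ef f"
  by (induction rule: pf.induct) (auto intro: ef.intros)

lemma ef_subst:
  assumes "ef f" "\<And>k. ef (\<sigma> k)"
  shows "ef (\<lambda>e. f (\<lambda>k. \<sigma> k e))"
  using assms(1) by induction (auto intro: ef.intros assms(2))

definition dec :: "((nat \<Rightarrow> real) \<Rightarrow> bool) \<Rightarrow> bool" where
  "dec P \<longleftrightarrow> ef (\<lambda>e. of_bool (P e))"

lemma dec_const: "dec (\<lambda>e. b)"
  unfolding dec_def by (cases b) (auto intro: ef_one ef_zero)

lemma dec_not: "dec P \<Longrightarrow> dec (\<lambda>e. \<not> P e)"
  unfolding dec_def using ef_diff[OF ef_one] by (simp add: of_bool_not_iff)

lemma dec_conj: "dec P \<Longrightarrow> dec Q \<Longrightarrow> dec (\<lambda>e. P e \<and> Q e)"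
  unfolding dec_def of_bool_conj by (rule ef_mult)

lemma dec_disj: "dec P \<Longrightarrow> dec Q \<Longrightarrow> dec (\<lambda>e. P e \<or> Q e)"
  using dec_not[OF dec_conj[OF dec_not dec_not, of P Q]] by simp

lemma dec_imp: "dec P \<Longrightarrow> dec Q \<Longrightarrow> dec (\<lambda>e. P e \<longrightarrow> Q e)"
  unfolding imp_conv_disj by (intro dec_disj dec_not)

lemma dec_ball: "finite I \<Longrightarrow> (\<And>i. i \<in> I \<Longrightarrow> dec (P i)) \<Longrightarrow> dec (\<lambda>e. \<forall>i\<in>I. P i e)"
  by (induction I rule: finite_induct) (simp_all add: dec_const dec_conj)

lemma dec_bex: "finite I \<Longrightarrow> (\<And>i. i \<in> I \<Longrightarrow> dec (P i)) \<Longrightarrow> dec (\<lambda>e. \<exists>i\<in>I. P i e)"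
  by (induction I rule: finite_induct) (simp_all add: dec_const dec_disj)

lemma dec_nonneg: "ef f \<Longrightarrow> dec (\<lambda>e. f e \<ge> 0)"
  unfolding dec_def using ef_step[of f] by (simp add: of_bool_def)

lemma dec_pos: "ef f \<Longrightarrow> dec (\<lambda>e. f e > 0)"
  using dec_not[OF dec_nonneg[OF ef_minus, of f]] by (simp add: not_le)

lemma dec_eq_0: "ef f \<Longrightarrow> dec (\<lambda>e. f e = 0)"
  using dec_conj[OF dec_nonneg dec_nonneg[OF ef_minus], of f f] by (simp add: eq_iff conj_commute)

lemma dec_subst: "dec P \<Longrightarrow> (\<And>k. ef (\<sigma> k)) \<Longrightarrow> dec (\<lambda>e. P (\<lambda>k. \<sigma> k e))"
  unfolding dec_def by (rule ef_subst)

text \<open>A finite table of sign conditions is a Boolean combination of sign tests. Splitting on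
  the sign of \<open>f\<close> leaves one predicate \<open>R c\<close> for each sign
  \<open>c\<close>; the quantifier over \<open>y\<close> in its definition makes it depend on the
  signs of the smaller family alone.\<close>

lemma dec_if_same_signs:
  assumes "finite F" "\<forall>f\<in>F. pf f" "\<And>x y. same_signs F x y \<Longrightarrow> P x = P y"
  shows "dec P"
  using assms
proof (induction F arbitrary: P rule: finite_induct)
  case empty
  then have "P = (\<lambda>x. P undefined)" by (auto simp: same_signs_def)
  then show ?case using dec_const[of "P undefined"] by simp
next
  case (insert f F)
  define R where "R c x \<longleftrightarrow> (\<exists>y. same_signs F x y \<and> sgn (f y) = c \<and> P y)" for c x
  have "dec (R c)" for c
  proof (rule insert.IH)
    fix x y assume xy: "same_signs F x y"
    have "same_signs F x z \<longleftrightarrow> same_signs F y z" for z using xy by (auto simp: same_signs_def)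
    then show "R c x = R c y" by (simp add: R_def)
  qed (use insert in auto)
  moreover have ef: "ef f" using insert ef_pf by simp
  ultimately have "dec (\<lambda>x. (f x > 0 \<and> R 1 x) \<or> (f x = 0 \<and> R 0 x) \<or> (- f x > 0 \<and> R (- 1) x))"
    by (intro dec_disj dec_conj dec_pos dec_eq_0 ef_minus)
  moreover have "R (sgn (f x)) x \<longleftrightarrow> P x" for x
  proof
    assume "R (sgn (f x)) x"
    then obtain y where "same_signs F x y" "sgn (f y) = sgn (f x)" "P y" unfolding R_def by blast
    then show "P x" using insert.prems(2)[of x y] by (simp add: same_signs_def)
  next
    assume "P x"
    then show "R (sgn (f x)) x" unfolding R_def by (intro exI[of _ x]) (simp add: same_signs_def)
  qed
  then have "(f x > 0 \<and> R 1 x) \<or> (f x = 0 \<and> R 0 x) \<or> (- f x > 0 \<and> R (- 1) x) \<longleftrightarrow> P x" for x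
    by (cases "f x" "0 :: real" rule: linorder_cases) (metis sgn_neg sgn_pos sgn_0 less_irrefl less_asym neg_less_0_iff_less neg_0_less_iff_less)+
  ultimately show ?case by simp
qed

lemma dec_sa: "sa P \<Longrightarrow> dec P"
  unfolding sa_def using dec_if_same_signs by blast


section \<open>A machine that interprets the digits of a real constant\<close>

text \<open>Cell 6 of the machine holds the not yet executed part of an infinite word over the operations
  0 to 10, written as a real number in base 16; cells 2 and 4 are accumulators.\<close>

definition block :: "nat \<Rightarrow> bss_node \<Rightarrow> bss_node list" where
  "block d nd = [Branch (RSub (RVar 6) (RConst 1)) (4 * d + 5) (4 * d + 3), nd, Branch (RConst 0) 1 1,
     Compute 6 (RSub (RVar 6) (RConst 1))]"

text \<open>Node 1 shifts the next digit into the integer part of cell 6. Block \<open>d\<close>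
  occupies the nodes \<open>4 * d + 2\<close> to \<open>4 * d + 5\<close>: if cell 6 is at least 1,
  it subtracts 1 and passes on to the next block; otherwise the digit was \<open>d\<close>, and the
  operation is performed before the return to node 1. The nodes from 46 on hold the halt and the two
  outcomes of operation 9.\<close>

definition interp :: "real \<Rightarrow> bss_machine" where
  "interp \<kappa> =
     [Compute 6 (RConst \<kappa>), Compute 6 (RMul (RConst 16) (RVar 6))]
     @ block 0 ResetI @ block 1 IncrI @ block 2 ResetJ @ block 3 IncrJ @ block 4 Copy
     @ block 5 (Compute 2 (RConst 1))
     @ block 6 (Compute 2 (RAdd (RVar 2) (RVar 4)))
     @ block 7 (Compute 2 (RMul (RVar 2) (RVar 4)))
     @ block 8 (Compute 2 (RSub (RConst 0) (RVar 2)))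
     @ block 9 (Branch (RVar 2) 47 49)
     @ block 10 (Branch (RSub (RVar 2) (RConst 1)) 46 1)
     @ [Halt, Compute 2 (RConst 1), Branch (RConst 0) 1 1, Compute 2 (RConst 0), Branch (RConst 0) 1 1]"

lemma length_interp: "length (interp \<kappa>) = 51"
  by (simp add: interp_def block_def)

lemma less_11_cases: "(d::nat) < 11 \<Longrightarrow> d \<in> {0, 1, 2, 3, 4, 5, 6, 7, 8, 9, 10}"
  unfolding insert_iff empty_iff by presburger

lemma interp_block:
  assumes "d < 11"
  shows "interp \<kappa> ! (4 * d + 2) = Branch (RSub (RVar 6) (RConst 1)) (4 * d + 5) (4 * d + 3)"
    "interp \<kappa> ! (4 * d + 4) = Branch (RConst 0) 1 1"
    "interp \<kappa> ! (4 * d + 5) = Compute 6 (RSub (RVar 6) (RConst 1))"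
  using less_11_cases[OF assms] by (elim insertE emptyE; simp add: interp_def block_def)+

section \<open>Semantics of the operations and its simulation by the machine\<close>

type_synonym iconf = "nat \<times> nat \<times> (nat \<Rightarrow> real)"

fun op_exec :: "nat \<Rightarrow> iconf \<Rightarrow> iconf" where
  "op_exec d (i, j, x) =
    (if d = 0 then (0, j, x) else if d = 1 then (Suc i, j, x)
     else if d = 2 then (i, 0, x) else if d = 3 then (i, Suc j, x)
     else if d = 4 then (i, j, x(i := x j))
     else if d = 5 then (i, j, x(2 := 1))
     else if d = 6 then (i, j, x(2 := x 2 + x 4))
     else if d = 7 then (i, j, x(2 := x 2 * x 4))
     else if d = 8 then (i, j, x(2 := - x 2))
     else if d = 9 then (i, j, x(2 := if x 2 \<ge> 0 then 1 else 0))
     else (i, j, x))"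

text \<open>Operation 10 halts the machine if cell 2 is at least 1; this is the only way to halt.\<close>

fun op_ok :: "nat \<Rightarrow> iconf \<Rightarrow> bool" where
  "op_ok d (i, j, x) \<longleftrightarrow> d < 11 \<and> (d = 4 \<longrightarrow> i \<noteq> 6 \<and> j \<noteq> 6) \<and> (d = 10 \<longrightarrow> x 2 < 1)"

fun orun :: "nat list \<Rightarrow> iconf \<Rightarrow> iconf \<Rightarrow> bool" where
  "orun [] c c' \<longleftrightarrow> c' = c"
| "orun (d # w) c c' \<longleftrightarrow> op_ok d c \<and> orun w (op_exec d c) c'"

lemma orun_append: "orun (w @ w') c c' \<longleftrightarrow> (\<exists>c''. orun w c c'' \<and> orun w' c'' c')"
  by (induction w arbitrary: c) auto

text \<open>The words are executed on a store whose cell 6 is meaningless; in the machine this cell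
  holds the rest \<open>y\<close> of the word.\<close>

fun conf_of :: "nat \<Rightarrow> real \<Rightarrow> iconf \<Rightarrow> bss_config" where
  "conf_of q y (i, j, x) = (q, i, j, x(6 := y))"

abbreviation steps :: "real \<Rightarrow> bss_config \<Rightarrow> bss_config \<Rightarrow> bool" where
  "steps \<kappa> \<equiv> (bss_step (interp \<kappa>))\<^sup>*\<^sup>*"

lemma step_compute:
  "q < length M \<Longrightarrow> M ! q = Compute r f \<Longrightarrow> rat_defined f x \<Longrightarrow> x' = x(r := rat_eval f x) \<Longrightarrow> q' = Suc q \<Longrightarrow>
    bss_step M (q, i, j, x) (q', i, j, x')"
  using bss_step.intros(1) by simp

lemma step_branch:
  "q < length M \<Longrightarrow> M ! q = Branch f p p' \<Longrightarrow> rat_defined f x \<Longrightarrow> q' = (if rat_eval f x \<ge> 0 then p else p') \<Longrightarrow>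
    bss_step M (q, i, j, x) (q', i, j, x)"
  using bss_step.intros(2) by simp

text \<open>On arrival at block \<open>e\<close> there remain \<open>d - e\<close> units in front of
  the fraction \<open>y\<close>, so the test against 1 succeeds until block \<open>d\<close> is
  reached, where only \<open>y\<close> is left.\<close>

lemma dispatch:
  assumes "d < 11" "e \<le> d" "0 \<le> y" "y < 1"
  shows "steps \<kappa> (conf_of (4 * e + 2) (real (d - e) + y) c) (conf_of (4 * d + 3) y c)"
  using assms(2)
proof (induction "d - e" arbitrary: e)
  case 0
  obtain i j x where c: "c = (i, j, x)" by (cases c)
  have "bss_step (interp \<kappa>) (4 * d + 2, i, j, x(6 := y)) (4 * d + 3, i, j, x(6 := y))"
    by (rule step_branch[OF _ interp_block(1)]) (use assms in \<open>simp_all add: length_interp\<close>)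
  then show ?case using 0 c by simp
next
  case (Suc n)
  obtain i j x where c: "c = (i, j, x)" by (cases c)
  let ?y = "real (d - e) + y"
  have e: "e < 11" "e < d" using Suc assms by auto
  have "bss_step (interp \<kappa>) (4 * e + 2, i, j, x(6 := ?y)) (4 * e + 5, i, j, x(6 := ?y))"
    by (rule step_branch[OF _ interp_block(1)]) (use e assms(3) in \<open>auto simp: length_interp\<close>)
  moreover have "bss_step (interp \<kappa>) (4 * e + 5, i, j, x(6 := ?y)) (4 * Suc e + 2, i, j, x(6 := real (d - Suc e) + y))"
    by (rule step_compute[OF _ interp_block(3)]) (use e in \<open>auto simp: length_interp of_nat_diff\<close>)
  moreover have "steps \<kappa> (4 * Suc e + 2, i, j, x(6 := real (d - Suc e) + y)) (conf_of (4 * d + 3) y c)"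
    using Suc.hyps(1)[of "Suc e"] Suc.hyps(2) e unfolding c by simp
  ultimately show ?case unfolding c conf_of.simps by (meson converse_rtranclp_into_rtranclp)
qed

lemma goto_loop:
  assumes "interp \<kappa> ! q = Branch (RConst 0) 1 1" "q < 51"
  shows "bss_step (interp \<kappa>) (conf_of q y c) (conf_of 1 y c)"
  by (cases c) (simp, rule step_branch[OF _ assms(1)], use assms(2) in \<open>simp_all add: length_interp\<close>)

lemma interp_body:
  "interp \<kappa> ! 3 = ResetI" "interp \<kappa> ! 7 = IncrI" "interp \<kappa> ! 11 = ResetJ" "interp \<kappa> ! 15 = IncrJ"
  "interp \<kappa> ! 19 = Copy" "interp \<kappa> ! 23 = Compute 2 (RConst 1)"
  "interp \<kappa> ! 27 = Compute 2 (RAdd (RVar 2) (RVar 4))" "interp \<kappa> ! 31 = Compute 2 (RMul (RVar 2) (RVar 4))"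
  "interp \<kappa> ! 35 = Compute 2 (RSub (RConst 0) (RVar 2))" "interp \<kappa> ! 39 = Branch (RVar 2) 47 49"
  "interp \<kappa> ! 43 = Branch (RSub (RVar 2) (RConst 1)) 46 1" "interp \<kappa> ! 46 = Halt"
  "interp \<kappa> ! 47 = Compute 2 (RConst 1)" "interp \<kappa> ! 48 = Branch (RConst 0) 1 1"
  "interp \<kappa> ! 49 = Compute 2 (RConst 0)" "interp \<kappa> ! 50 = Branch (RConst 0) 1 1"
  "interp \<kappa> ! 0 = Compute 6 (RConst \<kappa>)" "interp \<kappa> ! 1 = Compute 6 (RMul (RConst 16) (RVar 6))"
  by (simp_all add: interp_def block_def)

lemma exec_body:
  assumes "op_ok d c"
  shows "steps \<kappa> (conf_of (4 * d + 3) y c) (conf_of 1 y (op_exec d c))"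
proof -
  obtain i j x where c: "c = (i, j, x)" by (cases c)
  let ?M = "interp \<kappa>" and ?x = "x(6 := y)"
  have ok: "d < 11" "d = 4 \<Longrightarrow> i \<noteq> 6 \<and> j \<noteq> 6" "d = 10 \<Longrightarrow> x 2 < 1" using assms c by auto
  consider "d < 9" | "d = 9" | "d = 10" using ok(1) by linarith
  then show ?thesis
  proof cases
    case 1
    have "bss_step ?M (conf_of (4 * d + 3) y c) (conf_of (4 * d + 4) y (op_exec d c))"
    proof -
      have "d \<in> {0, 1, 2, 3, 4, 5, 6, 7, 8}" using 1 unfolding insert_iff empty_iff by presburger
      then show ?thesis
      proof (elim insertE emptyE)
        assume d: "d = 0"
        show ?thesis using bss_step.intros(3)[of 3 ?M i j ?x] by (simp add: c d interp_body length_interp)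
      next
        assume d: "d = 1"
        show ?thesis using bss_step.intros(4)[of 7 ?M i j ?x] by (simp add: c d interp_body length_interp)
      next
        assume d: "d = 2"
        show ?thesis using bss_step.intros(5)[of 11 ?M i j ?x] by (simp add: c d interp_body length_interp)
      next
        assume d: "d = 3"
        show ?thesis using bss_step.intros(6)[of 15 ?M i j ?x] by (simp add: c d interp_body length_interp)
      next
        assume d: "d = 4"
        have "(?x(i := ?x j)) = (x(i := x j))(6 := y)" using ok(2)[OF d] by auto
        then show ?thesis using bss_step.intros(7)[of 19 ?M i j ?x] by (simp add: c d interp_body length_interp)
      next
        assume d: "d = 5"
        have "bss_step ?M (23, i, j, ?x) (24, i, j, x(2 := 1, 6 := y))"
          by (rule step_compute[OF _ interp_body(6)]) (auto simp: length_interp)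
        then show ?thesis by (simp add: c d)
      next
        assume d: "d = 6"
        have "bss_step ?M (27, i, j, ?x) (28, i, j, x(2 := x 2 + x 4, 6 := y))"
          by (rule step_compute[OF _ interp_body(7)]) (auto simp: length_interp)
        then show ?thesis by (simp add: c d)
      next
        assume d: "d = 7"
        have "bss_step ?M (31, i, j, ?x) (32, i, j, x(2 := x 2 * x 4, 6 := y))"
          by (rule step_compute[OF _ interp_body(8)]) (auto simp: length_interp)
        then show ?thesis by (simp add: c d)
      next
        assume d: "d = 8"
        have "bss_step ?M (35, i, j, ?x) (36, i, j, x(2 := - x 2, 6 := y))"
          by (rule step_compute[OF _ interp_body(9)]) (auto simp: length_interp)
        then show ?thesis by (simp add: c d)
      qed
    qed
    moreover have "bss_step ?M (conf_of (4 * d + 4) y (op_exec d c)) (conf_of 1 y (op_exec d c))"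
      by (rule goto_loop) (use interp_block(2)[OF ok(1)] 1 in auto)
    ultimately show ?thesis by (meson converse_rtranclp_into_rtranclp r_into_rtranclp)
  next
    case 2
    show ?thesis
    proof (cases "x 2 \<ge> 0")
      case True
      have "bss_step ?M (39, i, j, ?x) (47, i, j, ?x)"
        by (rule step_branch[OF _ interp_body(10)]) (use True in \<open>auto simp: length_interp\<close>)
      moreover have "bss_step ?M (47, i, j, ?x) (48, i, j, x(2 := 1, 6 := y))"
        by (rule step_compute[OF _ interp_body(13)]) (auto simp: length_interp)
      moreover have "bss_step ?M (48, i, j, x(2 := 1, 6 := y)) (1, i, j, x(2 := 1, 6 := y))"
        using goto_loop[OF interp_body(14), where y = y and c = "(i, j, x(2 := 1))"] by simp
      ultimately show ?thesis using True
        by (simp add: c 2 del: fun_upd_apply)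
    next
      case False
      have "bss_step ?M (39, i, j, ?x) (49, i, j, ?x)"
        by (rule step_branch[OF _ interp_body(10)]) (use False in \<open>auto simp: length_interp\<close>)
      moreover have "bss_step ?M (49, i, j, ?x) (50, i, j, x(2 := 0, 6 := y))"
        by (rule step_compute[OF _ interp_body(15)]) (auto simp: length_interp)
      moreover have "bss_step ?M (50, i, j, x(2 := 0, 6 := y)) (1, i, j, x(2 := 0, 6 := y))"
        using goto_loop[OF interp_body(16), where y = y and c = "(i, j, x(2 := 0))"] by simp
      ultimately show ?thesis using False
        by (simp add: c 2 del: fun_upd_apply)
    qed
  next
    case 3
    have "bss_step ?M (43, i, j, ?x) (1, i, j, ?x)"
      by (rule step_branch[OF _ interp_body(11)]) (use ok(3)[OF 3] in \<open>auto simp: length_interp\<close>)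
    then show ?thesis by (simp add: c 3 r_into_rtranclp)
  qed
qed

definition tail :: "(nat \<Rightarrow> nat) \<Rightarrow> nat \<Rightarrow> real" where
  "tail D n = (\<Sum>i. real (D (n + i)) * (1 / 16) ^ Suc i)"

text \<open>Digits are at most 10, so the geometric series bounds a tail by 10/15. Multiplication by
  16 therefore separates the first digit from the rest without a carry.\<close>

lemma
  assumes "\<And>i. D i < 11"
  shows tail_Suc: "16 * tail D n = real (D n) + tail D (Suc n)"
    and tail_bounds: "0 \<le> tail D n" "tail D n < 1"
proof -
  have geo: "summable (\<lambda>i. 10 * (1 / 16 :: real) ^ Suc i)"
    by (intro summable_mult summable_Suc_iff[THEN iffD2]) (simp add: summable_geometric)
  have le: "real (D (n + i)) * (1 / 16) ^ Suc i \<le> 10 * (1 / 16) ^ Suc i" for n i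
    using assms[of "n + i"] by (intro mult_right_mono) auto
  have sm: "summable (\<lambda>i. real (D (n + i)) * (1 / 16) ^ Suc i)" for n
    by (rule summable_comparison_test'[OF geo, of 0]) (use le in simp)
  have "tail D n = real (D n) * (1 / 16) + (\<Sum>i. real (D (n + Suc i)) * (1 / 16) ^ Suc (Suc i))"
    unfolding tail_def using suminf_split_head[OF sm[of n]] by simp
  also have "(\<Sum>i. real (D (n + Suc i)) * (1 / 16) ^ Suc (Suc i)) = (1 / 16) * tail D (Suc n)"
    unfolding tail_def using suminf_mult[OF sm[of "Suc n"], of "1 / 16"] by (simp add: mult_ac)
  finally show "16 * tail D n = real (D n) + tail D (Suc n)" by simp
  show "0 \<le> tail D n" unfolding tail_def by (rule suminf_nonneg[OF sm]) simp
  have "tail D n \<le> (\<Sum>i. 10 * (1 / 16 :: real) ^ Suc i)"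
    unfolding tail_def by (rule suminf_le[OF le sm geo])
  also have "\<dots> = 10 * (1 / 16) * (\<Sum>i. (1 / 16 :: real) ^ i)"
    using suminf_mult[of "\<lambda>i. (1 / 16 :: real) ^ i" "10 / 16"] by (simp add: summable_geometric mult_ac)
  also have "\<dots> < 1" by (simp add: suminf_geometric)
  finally show "tail D n < 1" .
qed

lemma fetch:
  assumes "\<And>i. D i < 11"
  shows "steps \<kappa> (conf_of 1 (tail D n) c) (conf_of (4 * D n + 3) (tail D (Suc n)) c)"
proof -
  obtain i j x where c: "c = (i, j, x)" by (cases c)
  have "bss_step (interp \<kappa>) (1, i, j, x(6 := tail D n)) (2, i, j, x(6 := real (D n) + tail D (Suc n)))"
    by (rule step_compute[OF _ interp_body(18)]) (use tail_Suc[of D n, OF assms] in \<open>auto simp: length_interp mult.commute\<close>)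
  moreover have "steps \<kappa> (2, i, j, x(6 := real (D n) + tail D (Suc n))) (conf_of (4 * D n + 3) (tail D (Suc n)) c)"
    using dispatch[OF assms[of n], of 0 "tail D (Suc n)" \<kappa> c] tail_bounds[of D "Suc n", OF assms] by (simp add: c numeral_2_eq_2)
  ultimately show ?thesis unfolding c by (simp add: converse_rtranclp_into_rtranclp)
qed

lemma steps_orun:
  assumes "\<And>i. D i < 11" "orun w c c'" "\<And>i. i < length w \<Longrightarrow> D (n + i) = w ! i"
  shows "steps \<kappa> (conf_of 1 (tail D n) c) (conf_of 1 (tail D (n + length w)) c')"
  using assms(2,3)
proof (induction w arbitrary: c n)
  case (Cons d w)
  have d: "D n = d" using Cons.prems(2)[of 0] by simp
  have "steps \<kappa> (conf_of 1 (tail D n) c) (conf_of 1 (tail D (Suc n)) (op_exec d c))"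
    using fetch[of D \<kappa> n c, OF assms(1)] exec_body[of d c \<kappa> "tail D (Suc n)"] Cons.prems(1) d by simp
  moreover have "steps \<kappa> (conf_of 1 (tail D (Suc n)) (op_exec d c)) (conf_of 1 (tail D (Suc n + length w)) c')"
  proof (rule Cons.IH)
    show "orun w (op_exec d c) c'" using Cons.prems(1) by simp
    show "D (Suc n + i) = w ! i" if "i < length w" for i
      using Cons.prems(2)[of "Suc i"] that by simp
  qed
  ultimately show ?case by simp
qed simp

lemma steps_halt:
  assumes "\<And>i. D i < 11" "D n = 10" "x 2 \<ge> 1"
  shows "steps \<kappa> (conf_of 1 (tail D n) (i, j, x)) (46, i, j, x(6 := tail D (Suc n)))"
proof -
  have "bss_step (interp \<kappa>) (43, i, j, x(6 := tail D (Suc n))) (46, i, j, x(6 := tail D (Suc n)))"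
    by (rule step_branch[OF _ interp_body(11)]) (use assms(3) in \<open>auto simp: length_interp\<close>)
  then show ?thesis using fetch[of D \<kappa> n "(i, j, x)", OF assms(1)] assms(2) by simp
qed

text \<open>Address of the \<open>k\<close>-th input variable: variable 0 is the length, variable \<open>Suc k\<close> the
  \<open>k\<close>-th entry. The even addresses from 8 on serve as a stack.\<close>

definition adr :: "nat \<Rightarrow> nat" where
  "adr k = (if k = 0 then 0 else 2 * k - 1)"

abbreviation stk :: "nat \<Rightarrow> nat" where
  "stk l \<equiv> 8 + 2 * l"

lemma adr_neq_even: "l > 0 \<Longrightarrow> adr k \<noteq> 2 * l" "l > 0 \<Longrightarrow> 2 * l \<noteq> adr k"
  unfolding adr_def by (cases k; simp; presburger)+

lemma adr_neq [simp]: "adr k \<noteq> 2" "adr k \<noteq> 4" "adr k \<noteq> 6" "adr k \<noteq> stk l"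
    "2 \<noteq> adr k" "4 \<noteq> adr k" "6 \<noteq> adr k" "stk l \<noteq> adr k"
  using adr_neq_even[of 1 k] adr_neq_even[of 2 k] adr_neq_even[of 3 k] adr_neq_even[of "4 + l" k] by simp_all

lemma adr_inj [simp]: "adr k = adr l \<longleftrightarrow> k = l"
  unfolding adr_def by (cases k; cases l) auto

section \<open>Compilation of functions into words\<close>

definition cpw :: "nat \<Rightarrow> nat \<Rightarrow> nat list" where
  "cpw a b = [0] @ replicate a 1 @ [2] @ replicate b 3 @ [4]"

lemma orun_incr:
  "orun (replicate n (Suc 0)) (i, j, x) c' \<longleftrightarrow> c' = (i + n, j, x)"
  "orun (replicate n 3) (i, j, x) c' \<longleftrightarrow> c' = (i, j + n, x)"
  by (induction n arbitrary: i j) auto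

lemma orun_cpw: "a \<noteq> 6 \<Longrightarrow> b \<noteq> 6 \<Longrightarrow> orun (cpw a b) (i, j, x) (a, b, x(a := x b))"
  unfolding cpw_def by (simp add: orun_append orun_incr)

text \<open>The index registers can be ignored between words, because each copying word resets both
  before it uses them.\<close>

definition runs :: "nat list \<Rightarrow> (nat \<Rightarrow> real) \<Rightarrow> (nat \<Rightarrow> real) \<Rightarrow> bool" where
  "runs w x x' \<longleftrightarrow> (\<forall>i j. \<exists>i' j'. orun w (i, j, x) (i', j', x'))"

lemma runs_append: "runs w x x' \<Longrightarrow> runs w' x' x'' \<Longrightarrow> runs (w @ w') x x''"
  unfolding runs_def orun_append by meson

lemma runs_Nil: "runs [] x x"
  unfolding runs_def by simp

lemma runs_cpw: "a \<noteq> 6 \<Longrightarrow> b \<noteq> 6 \<Longrightarrow> runs (cpw a b) x (x(a := x b))"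
  unfolding runs_def using orun_cpw by blast

lemma runs_op:
  "runs [5] x (x(2 := 1))" "runs [6] x (x(2 := x 2 + x 4))" "runs [7] x (x(2 := x 2 * x 4))"
  "runs [8] x (x(2 := - x 2))" "runs [9] x (x(2 := if x 2 \<ge> 0 then 1 else 0))" "x 2 < 1 \<Longrightarrow> runs [10] x x"
  unfolding runs_def by simp_all

definition holds_env :: "(nat \<Rightarrow> real) \<Rightarrow> (nat \<Rightarrow> real) \<Rightarrow> bool" where
  "holds_env x e \<longleftrightarrow> (\<forall>k. x (adr k) = e k)"

text \<open>The stack cells below height \<open>m\<close> hold intermediate results of the enclosing
  computation; the word may overwrite the cells above, but neither these nor the input
  variables.\<close>

definition compiles :: "nat list \<Rightarrow> nat \<Rightarrow> ((nat \<Rightarrow> real) \<Rightarrow> real) \<Rightarrow> bool" where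
  "compiles w m f \<longleftrightarrow> set w \<subseteq> {..<11} \<and> (\<forall>e x. holds_env x e \<longrightarrow>
    (\<exists>x'. runs w x x' \<and> x' 2 = f e \<and> holds_env x' e \<and> (\<forall>l<m. x' (stk l) = x (stk l))))"

lemma compilesD:
  assumes "compiles w m f" "holds_env x e"
  obtains x' where "runs w x x'" "x' 2 = f e" "holds_env x' e" "\<And>l. l < m \<Longrightarrow> x' (stk l) = x (stk l)"
  using assms unfolding compiles_def by meson

lemma compilesI:
  assumes "set w \<subseteq> {..<11}"
    "\<And>e x. holds_env x e \<Longrightarrow>
      \<exists>x'. runs w x x' \<and> x' 2 = f e \<and> holds_env x' e \<and> (\<forall>l<m. x' (stk l) = x (stk l))"
  shows "compiles w m f"
  using assms unfolding compiles_def by blast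

lemma set_cpw: "set (cpw a b) \<subseteq> {..<11}"
  by (auto simp: cpw_def)

lemma holds_env_upd: "holds_env x e \<Longrightarrow> (\<And>k. adr k \<noteq> a) \<Longrightarrow> holds_env (x(a := y)) e"
  unfolding holds_env_def by simp

lemma compiles_unary:
  assumes f: "compiles w m f" and d: "d < 11" "\<And>x. runs [d] x (x(2 := h (x 2)))"
  shows "compiles (w @ [d]) m (\<lambda>e. h (f e))"
proof (rule compilesI)
  show "set (w @ [d]) \<subseteq> {..<11}" using f d(1) unfolding compiles_def by auto
  fix e x assume "holds_env x e"
  with f obtain x' where x': "runs w x x'" "x' 2 = f e" "holds_env x' e" "\<And>l. l < m \<Longrightarrow> x' (stk l) = x (stk l)"
    by (rule compilesD) blast
  have "runs (w @ [d]) x (x'(2 := h (x' 2)))" by (rule runs_append[OF x'(1) d(2)])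
  then show "\<exists>x'. runs (w @ [d]) x x' \<and> x' 2 = h (f e) \<and> holds_env x' e \<and> (\<forall>l<m. x' (stk l) = x (stk l))"
    using x' by (intro exI[of _ "x'(2 := h (x' 2))"]) (simp add: holds_env_upd)
qed

text \<open>The value of \<open>f\<close> is pushed at height \<open>m\<close>, so that the word for
  \<open>g\<close>, compiled for height \<open>Suc m\<close>, preserves it; then the value of
  \<open>g\<close> goes to accumulator 4 and that of \<open>f\<close> is reloaded into accumulator
  2.\<close>

lemma compiles_binary:
  assumes f: "compiles v m f" and g: "compiles w (Suc m) g" and d: "d < 11" "\<And>x. runs [d] x (x(2 := h (x 2) (x 4)))"
  shows "compiles (v @ cpw (stk m) 2 @ w @ cpw 4 2 @ cpw 2 (stk m) @ [d]) m (\<lambda>e. h (f e) (g e))" (is "compiles ?w _ _")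
proof (rule compilesI)
  show "set ?w \<subseteq> {..<11}"
    using f g d(1) set_cpw[of "stk m" 2] set_cpw[of 4 2] set_cpw[of 2 "stk m"] unfolding compiles_def by auto
  fix e x assume "holds_env x e"
  with f obtain y where y: "runs v x y" "y 2 = f e" "holds_env y e" "\<And>l. l < m \<Longrightarrow> y (stk l) = x (stk l)"
    by (rule compilesD) blast
  let ?y = "y(stk m := y 2)"
  have "holds_env ?y e" using y(3) by (simp add: holds_env_upd)
  with g obtain z where z: "runs w ?y z" "z 2 = g e" "holds_env z e" "\<And>l. l < Suc m \<Longrightarrow> z (stk l) = ?y (stk l)"
    by (rule compilesD) blast
  let ?z = "z(4 := z 2)" let ?u = "?z(2 := ?z (stk m))" let ?v = "?u(2 := h (?u 2) (?u 4))"
  have 1: "runs (cpw (stk m) 2) y ?y" "runs (cpw 4 2) z ?z" "runs (cpw 2 (stk m)) ?z ?u"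
    by (rule runs_cpw; simp; fail)+
  have "runs ?w x ?v" by (intro runs_append[OF y(1)] runs_append[OF 1(1)] runs_append[OF z(1)] runs_append[OF 1(2)] runs_append[OF 1(3)] d(2))
  moreover have "?v 2 = h (f e) (g e)" using y(2) z(2) z(4)[of m] by simp
  moreover have "holds_env ?v e" using z(3) by (simp add: holds_env_upd)
  moreover have "?v (stk l) = x (stk l)" if "l < m" for l using that z(4)[of l] y(4)[of l] by simp
  ultimately show "\<exists>x'. runs ?w x x' \<and> x' 2 = h (f e) (g e) \<and> holds_env x' e \<and> (\<forall>l<m. x' (stk l) = x (stk l))"
    by blast
qed

lemma ef_compiles:
  assumes "ef f"
  shows "\<exists>w. compiles w m f"
  using assms
proof (induction arbitrary: m)
  case ef_one
  have "compiles [5] m (\<lambda>e. 1)"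
  proof (rule compilesI)
    fix e x assume "holds_env x e"
    then show "\<exists>x'. runs [5] x x' \<and> x' 2 = 1 \<and> holds_env x' e \<and> (\<forall>l<m. x' (stk l) = x (stk l))"
      by (intro exI[of _ "x(2 := 1)"]) (simp add: runs_op holds_env_upd)
  qed simp
  then show ?case by blast
next
  case (ef_minus f)
  then show ?case using compiles_unary[where h = uminus and d = 8, OF _ _ runs_op(4)] by (simp, blast)
next
  case (ef_step f)
  then show ?case
    using compiles_unary[where h = "\<lambda>a. if a \<ge> 0 then 1 else 0" and d = 9, OF _ _ runs_op(5)] by (simp, blast)
next
  case (ef_var k)
  have "compiles (cpw 2 (adr k)) m (\<lambda>e. e k)"
  proof (rule compilesI)
    fix e x assume "holds_env x e"
    then show "\<exists>x'. runs (cpw 2 (adr k)) x x' \<and> x' 2 = e k \<and> holds_env x' e \<and> (\<forall>l<m. x' (stk l) = x (stk l))"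
      by (intro exI[of _ "x(2 := x (adr k))"]) (simp add: runs_cpw holds_env_upd, simp add: holds_env_def)
  qed (rule set_cpw)
  then show ?case by blast
next
  case (ef_add f g)
  obtain v w where "compiles v m f" "compiles w (Suc m) g" using ef_add.IH by blast
  from compiles_binary[where h = "(+)" and d = 6, OF this _ runs_op(2)] show ?case by (simp, blast)
next
  case (ef_mult f g)
  obtain v w where "compiles v m f" "compiles w (Suc m) g" using ef_mult.IH by blast
  from compiles_binary[where h = "(*)" and d = 7, OF this _ runs_op(3)] show ?case by (simp, blast)
qed

text \<open>All values are collected on the stack before any is delivered, since delivery overwrites
  the input variables that the other functions still read.\<close>

lemma ef_list_compiles:
  assumes "\<forall>f\<in>set fs. ef f"
  shows "\<exists>w. set w \<subseteq> {..<11} \<and> (\<forall>e x. holds_env x e \<longrightarrow>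
    (\<exists>x'. runs w x x' \<and> holds_env x' e \<and> (\<forall>l<length fs. x' (stk l) = (fs ! l) e)))"
  using assms
proof (induction fs rule: rev_induct)
  case Nil
  show ?case by (intro exI[of _ "[]"]) (auto intro: runs_Nil)
next
  case (snoc f fs)
  then obtain w where w: "set w \<subseteq> {..<11}" "\<And>e x. holds_env x e \<Longrightarrow>
      \<exists>x'. runs w x x' \<and> holds_env x' e \<and> (\<forall>l<length fs. x' (stk l) = (fs ! l) e)" by auto
  let ?n = "length fs"
  obtain v where v: "compiles v ?n f" using ef_compiles[of f ?n] snoc.prems by auto
  let ?w = "w @ v @ cpw (stk ?n) 2"
  have "\<exists>x'. runs ?w x x' \<and> holds_env x' e \<and> (\<forall>l<length (fs @ [f]). x' (stk l) = ((fs @ [f]) ! l) e)"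
    if e: "holds_env x e" for e x
  proof -
    obtain y where y: "runs w x y" "holds_env y e" "\<forall>l<?n. y (stk l) = (fs ! l) e" using w(2)[OF e] by blast
    obtain z where z: "runs v y z" "z 2 = f e" "holds_env z e" "\<And>l. l < ?n \<Longrightarrow> z (stk l) = y (stk l)"
      using v y(2) by (rule compilesD) blast
    let ?z = "z(stk ?n := z 2)"
    have "runs (cpw (stk ?n) 2) z ?z" by (rule runs_cpw) simp_all
    then have "runs ?w x ?z" using y(1) z(1) by (blast intro: runs_append)
    moreover have "holds_env ?z e" using z(3) by (simp add: holds_env_upd)
    moreover have "\<forall>l<length (fs @ [f]). ?z (stk l) = ((fs @ [f]) ! l) e"
      using z(2,4) y(3) by (auto simp: nth_append less_Suc_eq)
    ultimately show ?thesis by blast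
  qed
  moreover have "set ?w \<subseteq> {..<11}" using w(1) v set_cpw[of "stk ?n" 2] by (auto simp: compiles_def)
  ultimately show ?case by blast
qed

fun copy_out :: "nat \<Rightarrow> nat list" where
  "copy_out 0 = []"
| "copy_out (Suc k) = copy_out k @ cpw (adr k) (stk k)"

lemma runs_copy_out:
  "runs (copy_out n) x (\<lambda>a. if \<exists>k<n. a = adr k then x (stk (THE k. a = adr k)) else x a)" (is "runs _ _ (?x n)")
proof (induction n)
  case 0
  then show ?case by (simp add: runs_Nil)
next
  case (Suc n)
  have "runs (cpw (adr n) (stk n)) (?x n) ((?x n)(adr n := ?x n (stk n)))" by (rule runs_cpw) simp_all
  moreover have "(?x n)(adr n := ?x n (stk n)) = ?x (Suc n)"
    by (rule ext) (auto simp: less_Suc_eq)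
  ultimately show ?case using runs_append[OF Suc] by simp
qed

text \<open>Cell 2 reports the guard to the operation 10 that will follow. A failed stage has to
  restore the input for its successors, but may leave anything on the stack.\<close>

definition is_stage :: "nat list \<Rightarrow> ((nat \<Rightarrow> real) \<Rightarrow> bool) \<Rightarrow> ((nat \<Rightarrow> real) \<Rightarrow> real) list \<Rightarrow> bool" where
  "is_stage w G outs \<longleftrightarrow> set w \<subseteq> {..<11} \<and> (\<forall>e x. holds_env x e \<longrightarrow> (\<exists>x'. runs w x x' \<and> x' 2 = of_bool (G e) \<and>
     (if G e then x' 0 = real (length outs) \<and> (\<forall>a<length outs. x' (2 * a + 1) = (outs ! a) e)
      else holds_env x' e)))"

text \<open>A stage replaces each cell \<open>x\<close> by \<open>g * out + (1 - g) * x\<close>, so that it leaves the input intact unless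
  its guard \<open>g\<close> is 1.\<close>

lemma stage_exists:
  assumes "dec G" "\<forall>f\<in>set outs. ef f"
  shows "\<exists>w. is_stage w G outs"
proof -
  define g where "g = (\<lambda>e. of_bool (G e) :: real)"
  have g: "ef g" using assms(1) unfolding dec_def g_def .
  \<comment> \<open>The length comes first because variable 0 is the length cell.\<close>
  define tgt where "tgt = (\<lambda>e. real (length outs)) # outs"
  let ?n = "length tgt"
  define hs where "hs = map (\<lambda>k e. g e * (tgt ! k) e + (1 - g e) * e k) [0..<?n] @ [g]"
  have tgt: "\<forall>f\<in>set tgt. ef f" using assms(2) by (auto simp: tgt_def ef_of_nat)
  have "ef (\<lambda>e. g e * (tgt ! k) e + (1 - g e) * e k)" if "k < ?n" for k
    using that tgt g by (intro ef_add ef_mult ef_diff ef_one ef_var) auto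
  then have "\<forall>f\<in>set hs. ef f" unfolding hs_def using g by auto
  from ef_list_compiles[OF this] obtain w where w: "set w \<subseteq> {..<11}" "\<And>e x. holds_env x e \<Longrightarrow>
      \<exists>x'. runs w x x' \<and> holds_env x' e \<and> (\<forall>l<length hs. x' (stk l) = (hs ! l) e)" by blast
  let ?w = "w @ copy_out ?n @ cpw 2 (stk ?n)"
  have "\<exists>x'. runs ?w x x' \<and> x' 2 = of_bool (G e) \<and>
     (if G e then x' 0 = real (length outs) \<and> (\<forall>a<length outs. x' (2 * a + 1) = (outs ! a) e)
      else holds_env x' e)" if e: "holds_env x e" for e x
  proof -
    obtain y where y: "runs w x y" "holds_env y e" "\<And>l. l < length hs \<Longrightarrow> y (stk l) = (hs ! l) e"
      using w(2)[OF e] by blast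
    define z where "z = (\<lambda>a. if \<exists>k<?n. a = adr k then y (stk (THE k. a = adr k)) else y a)"
    have z: "runs (copy_out ?n) y z" unfolding z_def by (rule runs_copy_out)
    have zstk: "z (stk l) = y (stk l)" for l unfolding z_def by simp
    have zadr: "z (adr k) = (if k < ?n then y (stk k) else y (adr k))" for k unfolding z_def by auto
    have yk: "y (stk k) = g e * (tgt ! k) e + (1 - g e) * e k" if "k < ?n" for k
      using y(3)[of k] that by (simp add: hs_def nth_append)
    let ?z = "z(2 := z (stk ?n))"
    have "runs (cpw 2 (stk ?n)) z ?z" by (rule runs_cpw) simp_all
    then have "runs ?w x ?z" using y(1) z by (blast intro: runs_append)
    moreover have "?z 2 = of_bool (G e)" using y(3)[of ?n] by (simp add: zstk hs_def nth_append g_def)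
    moreover have "?z 0 = real (length outs) \<and> (\<forall>a<length outs. ?z (2 * a + 1) = (outs ! a) e)" if "G e"
    proof -
      have "z (adr k) = (tgt ! k) e" if "k < ?n" for k
        using that yk[OF that] \<open>G e\<close> by (simp add: zadr g_def)
      from this[of 0] this[of "Suc _"] show ?thesis by (auto simp: adr_def tgt_def)
    qed
    moreover have "holds_env ?z e" if "\<not> G e"
    proof -
      have "z (adr k) = e k" for k
        using yk[of k] y(2) that by (simp add: zadr g_def holds_env_def)
      then show ?thesis by (simp add: holds_env_def)
    qed
    ultimately show ?thesis by (intro exI[of _ ?z]) auto
  qed
  moreover have "set (copy_out n) \<subseteq> {..<11}" for n
    using set_cpw by (induction n) auto
  then have "set ?w \<subseteq> {..<11}" using w(1) set_cpw[of 2 "stk ?n"] by auto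
  ultimately show ?thesis unfolding is_stage_def by blast
qed

section \<open>One machine for a sequence of stages\<close>

definition input_env :: "real list \<Rightarrow> nat \<Rightarrow> real" where
  "input_env xs k = (if k = 0 then real (length xs) else if k \<le> length xs then xs ! (k - 1) else 0)"

text \<open>The infinite concatenation of the words: \<open>P h\<close> is the position at which
  word \<open>h\<close> starts. As no word is empty, the first \<open>Suc n\<close> words already
  contain digit \<open>n\<close>.\<close>

lemma concat_words:
  fixes W :: "nat \<Rightarrow> nat list"
  assumes "\<And>h. W h \<noteq> []"
  obtains D P :: "nat \<Rightarrow> nat" where
    "P 0 = 0" "\<And>h. P (Suc h) = P h + length (W h)"
    "\<And>h i. i < length (W h) \<Longrightarrow> D (P h + i) = W h ! i" "\<And>n. \<exists>h. D n \<in> set (W h)"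
proof
  let ?C = "\<lambda>h. concat (map W [0..<h])"
  define P where "P h = length (?C h)" for h
  define D where "D n = ?C (Suc n) ! n" for n
  show "P 0 = 0" "\<And>h. P (Suc h) = P h + length (W h)" by (simp_all add: P_def)
  have ge: "h \<le> P h" for h
  proof (induction h)
    case (Suc h)
    have "Suc 0 \<le> length (W h)" using assms[of h] by (cases "W h") auto
    then show ?case using Suc by (simp add: P_def)
  qed simp
  have stable: "?C (h + d) ! n = ?C h ! n" if "n < P h" for h d n
  proof (induction d)
    case (Suc d)
    have "P h \<le> P (h + d)" by (induction d) (simp_all add: P_def)
    then show ?case using Suc that by (simp add: P_def nth_append)
  qed simp
  have Dn: "D n = ?C h ! n" if "n < P h" for n h
  proof (cases "h \<le> Suc n")
    case True
    then show ?thesis unfolding D_def using stable[OF that, of "Suc n - h"] by simp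
  next
    case False
    have "n < P (Suc n)" using ge[of "Suc n"] by simp
    from stable[OF this, of "h - Suc n"] False show ?thesis unfolding D_def by simp
  qed
  show "D (P h + i) = W h ! i" if "i < length (W h)" for h i
    using Dn[of "P h + i" "Suc h"] that by (simp add: P_def nth_append)
  show "\<exists>h. D n \<in> set (W h)" for n
  proof -
    have "n < P (Suc n)" using ge[of "Suc n"] by simp
    then have "D n \<in> set (?C (Suc n))" unfolding P_def D_def by (rule nth_mem)
    then show ?thesis by auto
  qed
qed

text \<open>Each stage is followed by operation 10. If the guard fails, cell 2 is 0, so operation 10
  does nothing and the next stage starts with the input intact; the first stage with a true guard
  sets cell 2 to 1 after delivering its output, and operation 10 halts.\<close>

theorem search_machine:
  fixes G :: "nat \<Rightarrow> (nat \<Rightarrow> real) \<Rightarrow> bool" and outs :: "nat \<Rightarrow> ((nat \<Rightarrow> real) \<Rightarrow> real) list"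
  assumes G: "\<And>h. dec (G h)" and outs: "\<And>h f. f \<in> set (outs h) \<Longrightarrow> ef f"
  shows "\<exists>M. \<forall>xs. (\<exists>h. G h (input_env xs)) \<longrightarrow>
    (\<exists>h. G h (input_env xs) \<and> bss_computes M xs (map (\<lambda>f. f (input_env xs)) (outs h)))"
proof -
  have "\<forall>h. \<exists>w. is_stage w (G h) (outs h)" using stage_exists[OF G] outs by blast
  then obtain V where V': "\<And>h. is_stage (V h) (G h) (outs h)" by metis
  note V = V'[unfolded is_stage_def, THEN conjunct1] V'[unfolded is_stage_def, THEN conjunct2, rule_format]
  define W where "W h = V h @ [10]" for h
  have Wne: "W h \<noteq> []" for h unfolding W_def by simp
  obtain D P :: "nat \<Rightarrow> nat" where DP: "P 0 = 0" "\<And>h. P (Suc h) = P h + length (W h)"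
    "\<And>h i. i < length (W h) \<Longrightarrow> D (P h + i) = W h ! i" "\<And>n. \<exists>h. D n \<in> set (W h)"
    by (rule concat_words[of W, OF Wne]) (rule that; assumption)
  have D11: "D n < 11" for n
  proof -
    obtain h where "D n \<in> set (W h)" using DP(4) by blast
    then show ?thesis using V(1)[of h] unfolding W_def by auto
  qed
  define \<kappa> where "\<kappa> = tail D 0"
  have "\<exists>h. G h (input_env xs) \<and> bss_computes (interp \<kappa>) xs (map (\<lambda>f. f (input_env xs)) (outs h))"
    if ex: "\<exists>h. G h (input_env xs)" for xs
  proof -
    let ?e = "input_env xs"
    define h where "h = (LEAST h. G h ?e)"
    have h: "G h ?e" unfolding h_def using ex by (rule LeastI_ex)
    have less: "\<not> G l ?e" if "l < h" for l using that not_less_Least unfolding h_def by blast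
    define x0 :: "nat \<Rightarrow> real" where "x0 = (\<lambda>a. if a = 0 then real (length xs)
                             else if odd a \<and> a div 2 < length xs then xs ! (a div 2) else 0)"
    have init: "bss_init xs = (0, 0, 0, x0)" by (simp add: bss_init_def x0_def)
    have env0: "holds_env x0 ?e"
      unfolding holds_env_def
    proof
      fix k show "x0 (adr k) = ?e k"
        by (cases k) (auto simp: x0_def adr_def input_env_def)
    qed
    have "bss_step (interp \<kappa>) (bss_init xs) (1, 0, 0, x0(6 := \<kappa>))"
      unfolding init by (rule step_compute[OF _ interp_body(17)]) (auto simp: length_interp)
    then have start: "steps \<kappa> (bss_init xs) (conf_of 1 (tail D (P 0)) (0, 0, x0))"
      by (simp add: \<kappa>_def DP(1) r_into_rtranclp)
    have reach: "\<exists>i j x. steps \<kappa> (bss_init xs) (conf_of 1 (tail D (P l)) (i, j, x)) \<and> holds_env x ?e" if "l \<le> h" for l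
      using that
    proof (induction l)
      case 0
      then show ?case using start env0 by blast
    next
      case (Suc l)
      then obtain i j x where x: "steps \<kappa> (bss_init xs) (conf_of 1 (tail D (P l)) (i, j, x))" "holds_env x ?e" by auto
      have "\<not> G l ?e" using less Suc by simp
      with V(2)[OF x(2), of l] obtain x' where x': "runs (V l) x x'" "x' 2 = 0" "holds_env x' ?e" by auto
      have "runs [10] x' x'" using x'(2) by (intro runs_op(6)) simp
      from runs_append[OF x'(1) this] have "runs (W l) x x'" unfolding W_def .
      then obtain i' j' where "orun (W l) (i, j, x) (i', j', x')" unfolding runs_def by blast
      from steps_orun[of D, OF D11 this DP(3)]
      have "steps \<kappa> (conf_of 1 (tail D (P l)) (i, j, x)) (conf_of 1 (tail D (P (Suc l))) (i', j', x'))"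
        unfolding DP(2) .
      then show ?case using x(1) x'(3) by (meson rtranclp_trans)
    qed
    obtain i j x where x: "steps \<kappa> (bss_init xs) (conf_of 1 (tail D (P h)) (i, j, x))" "holds_env x ?e"
      using reach[of h] by blast
    obtain x' where x': "runs (V h) x x'" "x' 2 = 1" "x' 0 = real (length (outs h))"
      "\<forall>a<length (outs h). x' (2 * a + 1) = (outs h ! a) ?e"
      using V(2)[OF x(2), of h] h by auto
    obtain i' j' where o: "orun (V h) (i, j, x) (i', j', x')" using x'(1) unfolding runs_def by blast
    have "steps \<kappa> (conf_of 1 (tail D (P h)) (i, j, x)) (conf_of 1 (tail D (P h + length (V h))) (i', j', x'))"
      by (rule steps_orun[of D, OF D11 o]) (use DP(3)[of _ h] in \<open>simp add: W_def nth_append\<close>)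
    moreover have "D (P h + length (V h)) = 10" using DP(3)[of "length (V h)" h] by (simp add: W_def)
    from steps_halt[of D, OF D11 this, of x']
    have "steps \<kappa> (conf_of 1 (tail D (P h + length (V h))) (i', j', x')) (46, i', j', x'(6 := tail D (Suc (P h + length (V h)))))"
      using x'(2) by simp
    ultimately have "steps \<kappa> (bss_init xs) (46, i', j', x'(6 := tail D (Suc (P h + length (V h)))))"
      using x(1) by (meson rtranclp_trans)
    moreover have "46 < length (interp \<kappa>)" by (simp add: length_interp)
    moreover have "(x'(6 := y)) 0 = real (length (map (\<lambda>f. f ?e) (outs h)))" for y using x'(3) by simp
    moreover have "(x'(6 := y)) (2 * a + 1) = map (\<lambda>f. f ?e) (outs h) ! a"
      if "a < length (map (\<lambda>f. f ?e) (outs h))" for a y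
    proof -
      have "2 * a + 1 \<noteq> 6" by presburger
      then show ?thesis using x'(4) that by simp
    qed
    ultimately have "bss_computes (interp \<kappa>) xs (map (\<lambda>f. f ?e) (outs h))"
      unfolding bss_computes_def using interp_body(12)[of \<kappa>] by blast
    then show ?thesis using h by blast
  qed
  then show ?thesis by blast
qed


section \<open>Faces of polyhedra and sign vectors\<close>

lemma subspace_Sym: "subspace (Sym :: (real ^ 'n ^ 'n) set)"
  unfolding subspace_def Sym_def by (simp add: transpose_def vec_eq_iff)

lemma trace_mult_Sym:
  fixes A Y :: "real ^ 'n ^ 'n"
  assumes "Y \<in> Sym"
  shows "trace (A ** Y) = A \<bullet> Y"
proof -
  have "Y $ k $ i = Y $ i $ k" for i k
    using assms unfolding Sym_def by (simp add: transpose_def vec_eq_iff)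
  then show ?thesis
    by (simp add: trace_def matrix_matrix_mult_def inner_vec_def)
qed

section \<open>The cone of positive definite matrices and its normalization\<close>

definition PDS :: "(real ^ 'n ^ 'n) set" where
  "PDS = {W \<in> Sym. positive_definite W}"

lemma PDS_add: "V \<in> PDS \<Longrightarrow> W \<in> PDS \<Longrightarrow> V + W \<in> PDS"
  unfolding PDS_def positive_definite_def using subspace_add[OF subspace_Sym]
  by (auto simp: matrix_vector_mult_add_rdistrib inner_add_right add_pos_pos)

lemma PDS_scale: "W \<in> PDS \<Longrightarrow> c > 0 \<Longrightarrow> c *\<^sub>R W \<in> PDS"
  unfolding PDS_def positive_definite_def using subspace_scale[OF subspace_Sym]
  by (auto simp: scaleR_matrix_vector_assoc[symmetric])

lemma PDS_Sym: "W \<in> PDS \<Longrightarrow> W \<in> Sym"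
  by (simp add: PDS_def)

lemma PDS_nonzero: "W \<in> PDS \<Longrightarrow> W \<noteq> 0"
  unfolding PDS_def positive_definite_def by (auto dest: spec[of _ "axis undefined 1"])

lemma convex_PDS: "convex PDS"
  unfolding convex_def
proof (intro ballI allI impI)
  fix x y :: "real ^ 'n ^ 'n" and u v :: real
  assume "x \<in> PDS" "y \<in> PDS" "0 \<le> u" "0 \<le> v" "u + v = 1"
  then show "u *\<^sub>R x + v *\<^sub>R y \<in> PDS"
    by (cases "u = 0"; cases "v = 0") (auto intro!: PDS_add PDS_scale simp: less_le)
qed

lemma norm_matrix_vector_le:
  fixes A :: "real ^ 'n ^ 'n"
  shows "norm (A *v x) \<le> real CARD('n) * norm A * norm x"
proof -
  have "norm (A *v x) \<le> (\<Sum>i\<in>UNIV. \<bar>(A *v x) $ i\<bar>)" by (rule norm_le_l1_cart)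
  also have "\<dots> \<le> (\<Sum>i\<in>(UNIV :: 'n set). norm A * norm x)"
  proof (rule sum_mono)
    fix i
    have "\<bar>(A *v x) $ i\<bar> = \<bar>A $ i \<bullet> x\<bar>" by (simp add: matrix_vector_mul_component)
    also have "\<dots> \<le> norm (A $ i) * norm x" by (rule Cauchy_Schwarz_ineq2)
    also have "\<dots> \<le> norm A * norm x" by (intro mult_right_mono Finite_Cartesian_Product.norm_nth_le) simp
    finally show "\<bar>(A *v x) $ i\<bar> \<le> norm A * norm x" .
  qed
  finally show ?thesis by simp
qed

text \<open>On the compact unit sphere the quadratic form of \<open>Y\<close> attains a positive
  minimum \<open>m\<close>; a perturbation of norm below \<open>m / CARD('n)\<close> changes the
  form by less than that.\<close>

lemma PDS_open:
  fixes Y :: "real ^ 'n ^ 'n"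
  assumes "Y \<in> PDS"
  shows "\<exists>e>0. \<forall>X\<in>Sym. norm (X - Y) < e \<longrightarrow> X \<in> PDS"
proof -
  let ?S = "sphere (0 :: real ^ 'n) 1"
  have "\<exists>v\<in>?S. \<forall>w\<in>?S. v \<bullet> (Y *v v) \<le> w \<bullet> (Y *v w)"
    by (intro continuous_attains_inf continuous_intros matrix_vector_mult_linear_continuous_on)
       (auto simp: ex_in_conv[symmetric] intro!: exI[of _ "axis undefined 1"])
  then obtain v where v: "v \<in> ?S" "\<And>w. w \<in> ?S \<Longrightarrow> v \<bullet> (Y *v v) \<le> w \<bullet> (Y *v w)" by blast
  define m where "m = v \<bullet> (Y *v v)"
  have "v \<noteq> 0" using v(1) by auto
  then have m: "m > 0" using assms unfolding m_def PDS_def positive_definite_def by blast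
  have low: "m * (norm w)\<^sup>2 \<le> w \<bullet> (Y *v w)" for w
  proof (cases "w = 0")
    case False
    define u where "u = (1 / norm w) *\<^sub>R w"
    have w: "w = norm w *\<^sub>R u" and u: "u \<in> ?S" using False by (simp_all add: u_def)
    have "w \<bullet> (Y *v w) = (norm w)\<^sup>2 * (u \<bullet> (Y *v u))"
      by (subst (1 2) w) (simp add: matrix_vector_mult_scaleR power2_eq_square)
    then show ?thesis using v(2)[OF u] unfolding m_def by (simp add: mult.commute mult_right_mono)
  qed simp
  define e where "e = m / real CARD('n)"
  show ?thesis
  proof (intro exI[of _ e] conjI ballI impI)
    show "e > 0" using m by (simp add: e_def)
    fix X :: "real ^ 'n ^ 'n" assume X: "X \<in> Sym" "norm (X - Y) < e"
    have "w \<bullet> (X *v w) > 0" if "w \<noteq> 0" for w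
    proof -
      have "\<bar>w \<bullet> ((X - Y) *v w)\<bar> \<le> norm w * norm ((X - Y) *v w)" by (rule Cauchy_Schwarz_ineq2)
      also have "\<dots> \<le> norm w * (real CARD('n) * norm (X - Y) * norm w)"
        by (intro mult_left_mono norm_matrix_vector_le) simp
      also have "\<dots> = (real CARD('n) * norm (X - Y)) * (norm w)\<^sup>2" by (simp add: power2_eq_square)
      also have "\<dots> < m * (norm w)\<^sup>2"
        using X(2) that by (intro mult_strict_right_mono) (simp_all add: e_def field_simps)
      finally have "\<bar>w \<bullet> ((X - Y) *v w)\<bar> < w \<bullet> (Y *v w)" using low[of w] by linarith
      moreover have "w \<bullet> (X *v w) = w \<bullet> (Y *v w) + w \<bullet> ((X - Y) *v w)"
        by (simp add: matrix_vector_mult_diff_rdistrib inner_diff_right)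
      ultimately show ?thesis by linarith
    qed
    then show "X \<in> PDS" using X(1) by (simp add: PDS_def positive_definite_def)
  qed
qed

lemma PDS_perturb:
  assumes "Y \<in> PDS" "B \<in> Sym"
  shows "\<exists>e>0. \<forall>d. \<bar>d\<bar> \<le> e \<longrightarrow> Y + d *\<^sub>R B \<in> PDS"
proof -
  obtain e where e: "e > 0" "\<And>X. X \<in> Sym \<Longrightarrow> norm (X - Y) < e \<Longrightarrow> X \<in> PDS" using PDS_open[OF assms(1)] by blast
  have n: "norm B + 1 > 0" by (simp add: add_nonneg_pos)
  have "Y + d *\<^sub>R B \<in> PDS" if "\<bar>d\<bar> \<le> e / (norm B + 1)" for d
  proof (rule e(2))
    show "Y + d *\<^sub>R B \<in> Sym"
      using assms PDS_Sym by (blast intro: subspace_add[OF subspace_Sym] subspace_scale[OF subspace_Sym])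
    have "norm (d *\<^sub>R B) \<le> e / (norm B + 1) * norm B" using mult_right_mono[OF that, of "norm B"] by simp
    also have "\<dots> < e" using n e(1) by (simp add: field_simps)
    finally show "norm (Y + d *\<^sub>R B - Y) < e" by simp
  qed
  then show ?thesis using e(1) n by (intro exI[of _ "e / (norm B + 1)"]) simp
qed

lemma continuous_on_det: "continuous_on S (\<lambda>W. det (W :: real ^ 'n ^ 'n))"
  unfolding det_def by (intro continuous_intros)

lemma PDS_det_nonzero:
  assumes "W \<in> PDS"
  shows "det W \<noteq> 0"
proof
  assume "det W = 0"
  then obtain x where "x \<noteq> 0" "W *v x = 0"
    using invertible_det_nz[of W] unfolding invertible_left_inverse matrix_left_invertible_ker by blast
  then show False using assms unfolding PDS_def positive_definite_def by fastforce
qed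

lemma mat_1_PDS: "mat 1 \<in> PDS"
  by (auto simp: PDS_def positive_definite_def Sym_def)

text \<open>The determinant does not vanish on the convex, hence connected, cone and equals 1 at the
  identity.\<close>

lemma PDS_det_pos:
  assumes "W \<in> (PDS :: (real ^ 'n ^ 'n) set)"
  shows "det W > 0"
proof (rule ccontr)
  assume "\<not> det W > 0"
  have "connected (det ` (PDS :: (real ^ 'n ^ 'n) set))"
    by (intro connected_continuous_image continuous_on_det convex_connected convex_PDS)
  moreover have "det W \<in> det ` (PDS :: (real ^ 'n ^ 'n) set)" using assms by (rule imageI)
  moreover have "(1 :: real) \<in> det ` (PDS :: (real ^ 'n ^ 'n) set)"
    using imageI[OF mat_1_PDS, of det] by (simp add: det_I)
  ultimately have "0 \<in> det ` (PDS :: (real ^ 'n ^ 'n) set)"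
    by (rule connectedD_interval) (use \<open>\<not> det W > 0\<close> in simp_all)
  then show False using PDS_det_nonzero by force
qed

text \<open>The radial projection of the cone \<open>PDS\<close> to its section
  \<open>Pspace\<close>. Convexity and linear combinations are available only in the cone; their
  consequences are carried to \<open>Pspace\<close> by this map, which preserves the sign of every
  linear functional.\<close>

definition nrm :: "real ^ 'n ^ 'n \<Rightarrow> real ^ 'n ^ 'n" where
  "nrm W = (det W powr (- 1 / real CARD('n))) *\<^sub>R W"

lemma nrm_scale:
  assumes "W \<in> PDS"
  obtains c where "c > 0" "nrm W = c *\<^sub>R W"
  using PDS_det_pos[OF assms] that[of "det W powr (- 1 / real CARD('a))"] unfolding nrm_def by simp

lemma Pspace_PDS: "Y \<in> Pspace \<Longrightarrow> Y \<in> PDS"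
  by (simp add: Pspace_def PDS_def)

lemma det_scaleR: "det (c *\<^sub>R (W :: real ^ 'n ^ 'n)) = c ^ CARD('n) * det W"
proof -
  have "c *\<^sub>R W = (\<chi> i. c *s (W $ i))" by (simp add: vec_eq_iff)
  then show ?thesis using det_rows_mul[of "\<lambda>i. c" "\<lambda>i. W $ i"] by simp
qed

lemma nrm_Pspace:
  fixes W :: "real ^ 'n ^ 'n"
  assumes "W \<in> PDS"
  shows "nrm W \<in> Pspace"
proof -
  let ?c = "det W powr (- 1 / real CARD('n))"
  have pos: "det W > 0" by (rule PDS_det_pos[OF assms])
  have "?c ^ CARD('n) = ?c powr real CARD('n)" using pos by (simp add: powr_realpow)
  also have "\<dots> = det W powr (- 1)" by (simp add: powr_powr)
  finally have "det (nrm W) = 1" unfolding nrm_def det_scaleR using pos by (simp add: powr_minus)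
  moreover have "nrm W \<in> PDS" unfolding nrm_def using pos by (intro PDS_scale[OF assms]) simp
  ultimately show ?thesis by (simp add: Pspace_def PDS_def)
qed

lemma nrm_id: "Y \<in> Pspace \<Longrightarrow> nrm Y = Y"
  by (simp add: nrm_def Pspace_def)

lemma continuous_on_nrm: "continuous_on PDS nrm"
  unfolding nrm_def using PDS_det_nonzero by (intro continuous_intros continuous_on_det) auto

lemma nrm_inner:
  assumes "W \<in> PDS"
  shows "A \<bullet> nrm W > 0 \<longleftrightarrow> A \<bullet> W > 0" "A \<bullet> nrm W = 0 \<longleftrightarrow> A \<bullet> W = 0"
    "A \<bullet> nrm W \<ge> 0 \<longleftrightarrow> A \<bullet> W \<ge> 0" "A \<bullet> nrm W < 0 \<longleftrightarrow> A \<bullet> W < 0"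
proof -
  obtain c where "c > 0" "nrm W = c *\<^sub>R W" using nrm_scale[OF assms] .
  then show "A \<bullet> nrm W > 0 \<longleftrightarrow> A \<bullet> W > 0" "A \<bullet> nrm W = 0 \<longleftrightarrow> A \<bullet> W = 0"
    "A \<bullet> nrm W \<ge> 0 \<longleftrightarrow> A \<bullet> W \<ge> 0" "A \<bullet> nrm W < 0 \<longleftrightarrow> A \<bullet> W < 0"
    by (auto simp: zero_less_mult_iff zero_le_mult_iff mult_less_0_iff)
qed

lemma represents_nrm:
  assumes "W \<in> PDS"
  shows "represents W (nrm W)"
proof -
  obtain c where "c > 0" "nrm W = c *\<^sub>R W" using nrm_scale[OF assms] .
  then have "W = (1 / c) *\<^sub>R nrm W" "1 / c > 0" by simp_all
  then show ?thesis unfolding represents_def using nrm_Pspace[OF assms] by blast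
qed

text \<open>A straight perturbation of \<open>Y\<close> leaves the determinant-1 surface, but its
  normalization returns to it, and tends to \<open>Y\<close> by continuity. This is how limit points
  in \<open>Pspace\<close> are produced from linear directions.\<close>

lemma in_closure_if_perturbed:
  fixes Y :: "real ^ 'n ^ 'n"
  assumes "Y \<in> Pspace" "B \<in> Sym" "\<And>d. d > 0 \<Longrightarrow> Y + d *\<^sub>R B \<in> PDS \<Longrightarrow> nrm (Y + d *\<^sub>R B) \<in> T"
  shows "Y \<in> closure T"
proof -
  obtain e where e: "e > 0" "\<And>d. \<bar>d\<bar> \<le> e \<Longrightarrow> Y + d *\<^sub>R B \<in> PDS"
    using PDS_perturb[OF Pspace_PDS assms(2)] assms(1) by blast
  define f where "f n = Y + (e / real (Suc n)) *\<^sub>R B" for n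
  have le: "\<bar>e / real (Suc n)\<bar> \<le> e" for n using e(1) by (simp add: field_simps)
  then have f: "f n \<in> PDS" for n unfolding f_def using e(2) by blast
  have "(\<lambda>n. e / real (Suc n)) \<longlonglongrightarrow> 0"
    using LIMSEQ_Suc[OF lim_const_over_n[of e]] by simp
  then have "f \<longlonglongrightarrow> Y + 0 *\<^sub>R B" unfolding f_def by (intro tendsto_intros)
  then have "(\<lambda>n. nrm (f n)) \<longlonglongrightarrow> nrm Y"
    using continuous_on_tendsto_compose[OF continuous_on_nrm, of f Y sequentially] f Pspace_PDS[OF assms(1)] by simp
  moreover have "nrm (f n) \<in> T" for n
    using assms(3)[of "e / real (Suc n)"] f[of n] e(1) unfolding f_def by simp
  ultimately show ?thesis using nrm_id[OF assms(1)] unfolding closure_sequential by metis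
qed

section \<open>Hyperplanes and half-spaces described by normal vectors\<close>

lemma perp_inner: "A \<in> Sym \<Longrightarrow> perp A = {Y \<in> Pspace. A \<bullet> Y = 0}"
  unfolding perp_def using trace_mult_Sym[of A] by (auto simp: inner_commute)

lemma
  fixes A :: "real ^ 'n ^ 'n"
  assumes "A \<in> Sym" "A \<noteq> 0"
  shows dim_orthogonal_Sym: "dim {y \<in> Sym. A \<bullet> y = 0} + 1 = dim (Sym :: (real ^ 'n ^ 'n) set)"
    and subspace_orthogonal_Sym: "subspace {y \<in> Sym. A \<bullet> y = 0}"
proof -
  have "dim {y \<in> Sym. \<forall>x\<in>span {A}. orthogonal x y} + dim (span {A}) = dim (Sym :: (real ^ 'n ^ 'n) set)"
    by (rule dim_subspace_orthogonal_to_vectors[OF subspace_span subspace_Sym])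
       (use assms in \<open>simp add: span_minimal[OF _ subspace_Sym]\<close>)
  moreover have "{y \<in> Sym. \<forall>x\<in>span {A}. orthogonal x y} = {y \<in> Sym. A \<bullet> y = 0}"
    by (auto simp: orthogonal_def span_singleton)
  ultimately show "dim {y \<in> Sym. A \<bullet> y = 0} + 1 = dim (Sym :: (real ^ 'n ^ 'n) set)" using assms(2) by simp
  show "subspace {y \<in> Sym. A \<bullet> y = 0}"
    using subspace_Sym by (auto simp: subspace_def inner_add_right)
qed

lemma is_hyperplane_iff:
  fixes S :: "(real ^ 'n ^ 'n) set"
  shows "is_hyperplane S \<longleftrightarrow> (\<exists>A\<in>Sym. A \<noteq> 0 \<and> perp A \<noteq> {} \<and> S = perp A)"
proof
  assume "is_hyperplane S"
  then obtain d L where L: "S \<noteq> {}" "subspace L" "L \<subseteq> Sym" "dim L = d + 1" "S = Pspace \<inter> L"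
    "d + 2 = dim (Sym :: (real ^ 'n ^ 'n) set)"
    unfolding is_hyperplane_def is_plane_def by blast
  let ?O = "{y \<in> Sym. \<forall>x\<in>L. orthogonal x y}"
  have "dim ?O + dim L = dim (Sym :: (real ^ 'n ^ 'n) set)"
    by (rule dim_subspace_orthogonal_to_vectors[OF L(2) subspace_Sym L(3)])
  then have "dim ?O = 1" using L by simp
  then have "\<not> ?O \<subseteq> {0}" using dim_eq_0[of ?O] by simp
  then obtain A where A: "A \<in> Sym" "A \<noteq> 0" "\<forall>x\<in>L. orthogonal x A" by blast
  let ?K = "{y \<in> Sym. A \<bullet> y = 0}"
  have "dim ?K = dim L" using dim_orthogonal_Sym[OF A(1,2)] L by simp
  moreover have "subspace ?K" by (rule subspace_orthogonal_Sym[OF A(1,2)])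
  moreover have "L \<subseteq> ?K" using L A by (auto simp: orthogonal_def inner_commute)
  ultimately have "L = ?K" using L(2) by (intro subspace_dim_equal) auto
  then have "S = perp A" unfolding perp_inner[OF A(1)] using L(5) Pspace_PDS PDS_Sym by blast
  then show "\<exists>A\<in>Sym. A \<noteq> 0 \<and> perp A \<noteq> {} \<and> S = perp A" using A L(1) by blast
next
  assume "\<exists>A\<in>Sym. A \<noteq> 0 \<and> perp A \<noteq> {} \<and> S = perp A"
  then obtain A where A: "A \<in> Sym" "A \<noteq> 0" "S \<noteq> {}" "S = perp A" by blast
  let ?K = "{y \<in> Sym. A \<bullet> y = 0}"
  have dim: "dim ?K + 1 = dim (Sym :: (real ^ 'n ^ 'n) set)" by (rule dim_orthogonal_Sym[OF A(1,2)])
  have S: "S = Pspace \<inter> ?K" unfolding A(4) perp_inner[OF A(1)] using Pspace_PDS PDS_Sym by blast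
  \<comment> \<open>A point of \<open>S\<close> is a nonzero matrix, so the dimension is positive
    and the subtraction of 1 below is not truncated.\<close>
  then obtain y where "y \<in> ?K" "y \<noteq> 0" using A(3) Pspace_PDS PDS_nonzero by blast
  then have "dim ?K \<noteq> 0" unfolding dim_eq_0 by blast
  moreover have "subspace ?K" by (rule subspace_orthogonal_Sym[OF A(1,2)])
  moreover have "dim ?K = dim ?K - 1 + 1" using \<open>dim ?K \<noteq> 0\<close> by (simp del: dim_eq_0)
  ultimately have "is_plane (dim ?K - 1) S" unfolding is_plane_def using A(3) S by blast
  moreover have "dim ?K - 1 + 2 = dim (Sym :: (real ^ 'n ^ 'n) set)" using dim \<open>dim ?K \<noteq> 0\<close> by linarith
  ultimately show "is_hyperplane S" unfolding is_hyperplane_def by blast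
qed

definition pos_side :: "real ^ 'n ^ 'n \<Rightarrow> (real ^ 'n ^ 'n) set" where
  "pos_side A = {Y \<in> Pspace. A \<bullet> Y > 0}"

definition half_space :: "real ^ 'n ^ 'n \<Rightarrow> (real ^ 'n ^ 'n) set" where
  "half_space A = {Y \<in> Pspace. A \<bullet> Y \<ge> 0}"

lemma connected_pos_side: "connected (pos_side A)"
proof -
  let ?C = "PDS \<inter> {W. A \<bullet> W > 0}"
  have "pos_side A = nrm ` ?C"
  proof
    show "pos_side A \<subseteq> nrm ` ?C"
    proof
      fix Y assume "Y \<in> pos_side A"
      then show "Y \<in> nrm ` ?C"
        by (intro image_eqI[of _ _ Y]) (auto simp: pos_side_def Pspace_PDS nrm_id)
    qed
    show "nrm ` ?C \<subseteq> pos_side A"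
      unfolding pos_side_def by (auto simp: nrm_Pspace nrm_inner)
  qed
  moreover have "connected ?C"
    by (intro convex_connected convex_Int convex_PDS convex_halfspace_gt)
  moreover have "continuous_on ?C nrm" using continuous_on_nrm continuous_on_subset by blast
  ultimately show ?thesis by (simp add: connected_continuous_image)
qed

lemma connected_Pspace: "connected (Pspace :: (real ^ 'n ^ 'n) set)"
proof -
  have "Pspace = nrm ` (PDS :: (real ^ 'n ^ 'n) set)"
    using Pspace_PDS nrm_id nrm_Pspace by force
  moreover have "connected (nrm ` (PDS :: (real ^ 'n ^ 'n) set))"
    by (rule connected_continuous_image[OF continuous_on_nrm convex_connected[OF convex_PDS]])
  ultimately show ?thesis by (rule ssubst)
qed

lemma closure_of_pos_side:
  assumes "A \<in> Sym" "A \<noteq> 0"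
  shows "top_of_set Pspace closure_of pos_side A = half_space A"
proof -
  have "top_of_set Pspace closure_of pos_side A = Pspace \<inter> closure (pos_side A)"
  proof -
    have "Pspace \<inter> pos_side A = pos_side A" by (auto simp: pos_side_def)
    then show ?thesis unfolding closure_of_subtopology euclidean_closure_of by (rule arg_cong)
  qed
  also have "\<dots> = half_space A"
  proof
    have "closure (pos_side A) \<subseteq> {Y. A \<bullet> Y \<ge> 0}"
      by (rule closure_minimal) (auto simp: pos_side_def closed_halfspace_ge)
    then show "Pspace \<inter> closure (pos_side A) \<subseteq> half_space A" unfolding half_space_def by blast
    show "half_space A \<subseteq> Pspace \<inter> closure (pos_side A)"
    proof
      fix Y assume "Y \<in> half_space A"
      then have Y: "Y \<in> Pspace" "A \<bullet> Y \<ge> 0" by (auto simp: half_space_def)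
      have "Y \<in> closure (pos_side A)"
      proof (rule in_closure_if_perturbed[OF Y(1) assms(1)])
        fix d :: real assume d: "d > 0" "Y + d *\<^sub>R A \<in> PDS"
        have "A \<bullet> (Y + d *\<^sub>R A) > 0" using Y(2) d(1) assms(2) by (simp add: inner_add_right add_nonneg_pos)
        then show "nrm (Y + d *\<^sub>R A) \<in> pos_side A" unfolding pos_side_def using d(2) by (simp add: nrm_inner nrm_Pspace)
      qed
      then show "Y \<in> Pspace \<inter> closure (pos_side A)" using Y by simp
    qed
  qed
  finally show ?thesis .
qed

lemma component_pos_side:
  assumes "x \<in> pos_side A"
  shows "connected_component_set (Pspace - {Y. A \<bullet> Y = 0}) x = pos_side A" (is "?C = _")
proof
  show "pos_side A \<subseteq> ?C"
    by (rule connected_component_maximal) (use assms connected_pos_side in \<open>auto simp: pos_side_def\<close>)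
  show "?C \<subseteq> pos_side A"
  proof
    fix y assume y: "y \<in> ?C"
    have sub: "?C \<subseteq> Pspace - {Y. A \<bullet> Y = 0}" by (rule connected_component_subset)
    have "x \<in> ?C" using assms by (auto simp: pos_side_def connected_component_refl_eq)
    have "A \<bullet> y > 0"
    proof (rule ccontr)
      assume "\<not> A \<bullet> y > 0"
      then have "\<exists>z\<in>?C. A \<bullet> z = 0"
        using connected_ivt_hyperplane[OF connected_connected_component y \<open>x \<in> ?C\<close>, of A 0] assms
        by (auto simp: pos_side_def)
      then show False using sub by blast
    qed
    then show "y \<in> pos_side A" using y sub by (auto simp: pos_side_def)
  qed
qed

text \<open>The components of the complement of \<open>perp A\<close> are the positive sides of
  \<open>A\<close> and of \<open>- A\<close>: each is the image of a convex set, and no connected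
  set passes from one to the other without meeting the hyperplane.\<close>

lemma closed_half_space_iff:
  fixes H :: "(real ^ 'n ^ 'n) set"
  shows "closed_half_space H \<longleftrightarrow> (\<exists>A\<in>Sym. A \<noteq> 0 \<and> perp A \<noteq> {} \<and> H = half_space A)"
proof
  assume "closed_half_space H"
  then obtain A U where A: "A \<in> Sym" "A \<noteq> 0" "perp A \<noteq> {}" "U \<in> components (Pspace - perp A)"
    "H = top_of_set Pspace closure_of U"
    unfolding closed_half_space_def open_half_space_def is_hyperplane_iff by blast
  have P: "Pspace - perp A = Pspace - {Y. A \<bullet> Y = 0}" unfolding perp_inner[OF A(1)] by blast
  obtain x where x: "x \<in> Pspace" "A \<bullet> x \<noteq> 0" "U = connected_component_set (Pspace - {Y. A \<bullet> Y = 0}) x"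
    using A(4) unfolding P components_def by blast
  show "\<exists>A\<in>Sym. A \<noteq> 0 \<and> perp A \<noteq> {} \<and> H = half_space A"
  proof (cases "A \<bullet> x > 0")
    case True
    then have "U = pos_side A" using x component_pos_side[of x A] by (simp add: pos_side_def)
    then show ?thesis using A closure_of_pos_side[OF A(1,2)] by auto
  next
    case False
    then have "x \<in> pos_side (- A)" using x by (simp add: pos_side_def)
    then have "U = pos_side (- A)" using x component_pos_side[of x "- A"] by simp
    moreover have nA: "- A \<in> Sym" "- A \<noteq> 0" using A subspace_neg[OF subspace_Sym] by auto
    moreover have "perp (- A) = perp A" unfolding perp_inner[OF A(1)] perp_inner[OF nA(1)] by simp
    ultimately show ?thesis using A closure_of_pos_side[OF nA] by (intro bexI[of _ "- A"]) auto
  qed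
next
  assume "\<exists>A\<in>Sym. A \<noteq> 0 \<and> perp A \<noteq> {} \<and> H = half_space A"
  then obtain A where A: "A \<in> Sym" "A \<noteq> 0" "perp A \<noteq> {}" "H = half_space A" by blast
  obtain Y where Y: "Y \<in> Pspace" "A \<bullet> Y = 0" using A(3) unfolding perp_inner[OF A(1)] by blast
  then have "Y \<in> half_space A" by (simp add: half_space_def)
  \<comment> \<open>A set with nonempty closure is nonempty; \<open>Y\<close> on the hyperplane
    supplies the point of the closure.\<close>
  then have "pos_side A \<noteq> {}" unfolding closure_of_pos_side[OF A(1,2), symmetric] by auto
  then obtain x where x: "x \<in> pos_side A" by blast
  have "pos_side A \<in> components (Pspace - perp A)"
  proof -
    have P: "Pspace - perp A = Pspace - {Y. A \<bullet> Y = 0}" unfolding perp_inner[OF A(1)] by blast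
    have "x \<in> Pspace - {Y. A \<bullet> Y = 0}" using x by (auto simp: pos_side_def)
    then show ?thesis unfolding components_def P component_pos_side[OF x, symmetric] by (rule imageI)
  qed
  then show "closed_half_space H"
    unfolding closed_half_space_def open_half_space_def is_hyperplane_iff A(4)
      closure_of_pos_side[OF A(1,2), symmetric] using A(1-3) by blast
qed


section \<open>Polyhedra given by linear inequalities, and their spans\<close>

lemma convex_polyhedron_inner:
  fixes G :: "(real ^ 'n ^ 'n) set"
  assumes "convex_polyhedron G"
  shows "G \<noteq> {}" "\<exists>\<A>\<subseteq>Sym. G = {Y \<in> Pspace. \<forall>A\<in>\<A>. A \<bullet> Y \<ge> 0}"
proof -
  show "G \<noteq> {}" using assms unfolding convex_polyhedron_def by blast
  obtain \<H> where H: "\<forall>H\<in>\<H>. closed_half_space H" "G = Pspace \<inter> \<Inter>\<H>"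
    using assms unfolding convex_polyhedron_def by blast
  have "\<forall>H\<in>\<H>. \<exists>A\<in>Sym. H = half_space A" using H(1) closed_half_space_iff by blast
  then obtain f where f: "\<forall>H\<in>\<H>. f H \<in> Sym \<and> H = half_space (f H)" by metis
  then have "G = {Y \<in> Pspace. \<forall>A\<in>f ` \<H>. A \<bullet> Y \<ge> 0}"
    unfolding H(2) half_space_def by blast
  then show "\<exists>\<A>\<subseteq>Sym. G = {Y \<in> Pspace. \<forall>A\<in>\<A>. A \<bullet> Y \<ge> 0}"
    using f by (intro exI[of _ "f ` \<H>"]) blast
qed

text \<open>A matrix that is 0 or whose \<open>perp\<close> is empty bounds no half-space in the
  sense of the definitions, but its inequality may be dropped: on the connected
  \<open>Pspace\<close> its functional vanishes identically or never, and it is nonnegative at some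
  point of the nonempty polyhedron.\<close>

lemma convex_polyhedronI:
  fixes C :: "(real ^ 'n ^ 'n) set"
  assumes "finite C" "C \<subseteq> Sym" "{Y \<in> Pspace. \<forall>A\<in>C. A \<bullet> Y \<ge> 0} \<noteq> {}" (is "?G \<noteq> {}")
  shows "convex_polyhedron {Y \<in> Pspace. \<forall>A\<in>C. A \<bullet> Y \<ge> 0}"
proof -
  define \<H> where "\<H> = half_space ` {A\<in>C. A \<noteq> 0 \<and> perp A \<noteq> {}}"
  have "\<forall>H\<in>\<H>. closed_half_space H"
    unfolding \<H>_def closed_half_space_iff using assms(2) by blast
  moreover have "locally_finite_in (top_of_set Pspace) ((\<lambda>H. top_of_set Pspace frontier_of H) ` \<H>)"
    by (rule finite_imp_locally_finite_in)
       (use assms(1) in \<open>auto simp: \<H>_def frontier_of_def closure_of_subtopology\<close>)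
  moreover have "?G = Pspace \<inter> \<Inter>\<H>"
  proof
    show "?G \<subseteq> Pspace \<inter> \<Inter>\<H>" unfolding \<H>_def half_space_def by blast
    show "Pspace \<inter> \<Inter>\<H> \<subseteq> ?G"
    proof
      fix Y assume Y: "Y \<in> Pspace \<inter> \<Inter>\<H>"
      have "A \<bullet> Y \<ge> 0" if A: "A \<in> C" for A
      proof (cases "A \<noteq> 0 \<and> perp A \<noteq> {}")
        case True
        then have "half_space A \<in> \<H>" unfolding \<H>_def using A by blast
        then show ?thesis using Y unfolding half_space_def by blast
      next
        case False
        then consider "A = 0" | "perp A = {}" by blast
        then show ?thesis
        proof cases
          case 2
          obtain W where W: "W \<in> Pspace" "A \<bullet> W \<ge> 0" using assms(3) A by blast
          show ?thesis
          proof (rule ccontr)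
            assume "\<not> A \<bullet> Y \<ge> 0"
            then have "\<exists>Z\<in>Pspace. A \<bullet> Z = 0"
              using connected_ivt_hyperplane[OF connected_Pspace, of Y W A 0] Y W by auto
            then show False using 2 perp_inner[of A] assms(2) A by blast
          qed
        qed simp
      qed
      then show "Y \<in> ?G" using Y by blast
    qed
  qed
  ultimately show ?thesis unfolding convex_polyhedron_def using assms(3) by blast
qed

text \<open>Adding witnesses: in a sum of points of \<open>G\<close> a functional is positive as
  soon as it is positive at one of them, since all values are nonnegative. It provides points in the
  relative interior.\<close>

lemma ex_strictly_positive:
  fixes \<A> :: "(real ^ 'n ^ 'n) set"
  assumes "finite J" and G: "G = {Y \<in> Pspace. \<forall>A\<in>\<A>. A \<bullet> Y \<ge> 0}" and "G \<noteq> {}"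
    and "\<forall>A\<in>J. \<forall>Y\<in>G. A \<bullet> Y \<ge> 0" and "\<forall>A\<in>J. \<exists>Y\<in>G. A \<bullet> Y \<noteq> 0"
  shows "\<exists>Y\<in>G. \<forall>A\<in>J. A \<bullet> Y > 0"
  using assms(1,4,5)
proof (induction J rule: finite_induct)
  case empty
  then show ?case using assms(3) by blast
next
  case (insert B J)
  then obtain Y where Y: "Y \<in> G" "\<forall>A\<in>J. A \<bullet> Y > 0" by auto
  obtain Z where Z: "Z \<in> G" "B \<bullet> Z > 0" using insert.prems by (metis insertI1 less_le)
  have PDS: "Y + Z \<in> PDS" using Y Z by (intro PDS_add Pspace_PDS) (auto simp: G)
  have "nrm (Y + Z) \<in> G"
    using Y(1) Z(1) unfolding G by (auto simp: nrm_inner(3)[OF PDS] nrm_Pspace[OF PDS] inner_add_right)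
  moreover have "A \<bullet> nrm (Y + Z) > 0" if "A \<in> insert B J" for A
  proof -
    have "A \<bullet> Y \<ge> 0" "A \<bullet> Z \<ge> 0" "A \<bullet> Y > 0 \<or> A \<bullet> Z > 0" using that insert.prems(1) Y Z by auto
    then show ?thesis unfolding nrm_inner(1)[OF PDS] inner_add_right by linarith
  qed
  ultimately show ?case by blast
qed

lemma plane_span_eq:
  fixes P :: "(real ^ 'n ^ 'n) set"
  assumes "P \<subseteq> Pspace" "P \<noteq> {}"
  shows "plane_span P = Pspace \<inter> span P"
  unfolding plane_span_def
proof (rule Least_equality)
  obtain Y where Y: "Y \<in> P" using assms(2) by blast
  then have "Y \<in> span P" by (rule span_base)
  moreover have "Y \<noteq> 0" using Y assms(1) PDS_nonzero Pspace_PDS by blast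
  ultimately have "\<not> span P \<subseteq> {0}" by blast
  then have "dim (span P) \<noteq> 0" using dim_eq_0[of "span P"] by blast
  then have d: "dim (span P) = (dim (span P) - 1) + 1" by linarith
  have "span P \<subseteq> Sym" by (rule span_minimal[OF _ subspace_Sym]) (use assms(1) PDS_Sym Pspace_PDS in blast)
  moreover have sub: "P \<subseteq> Pspace \<inter> span P" using assms(1) span_base by blast
  ultimately have "is_plane (dim (span P) - 1) (Pspace \<inter> span P)"
    unfolding is_plane_def using d assms(2) subspace_span by blast
  then show "(\<exists>d. is_plane d (Pspace \<inter> span P)) \<and> P \<subseteq> Pspace \<inter> span P" using sub by blast
next
  fix S assume "(\<exists>d. is_plane d S) \<and> P \<subseteq> S"
  then obtain L where L: "subspace L" "S = Pspace \<inter> L" "P \<subseteq> S" unfolding is_plane_def by blast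
  then have "span P \<subseteq> L" by (intro span_minimal) auto
  then show "Pspace \<inter> span P \<subseteq> S" using L by blast
qed

lemma inner_span_0: "(\<And>Y. Y \<in> Q \<Longrightarrow> A \<bullet> Y = 0) \<Longrightarrow> Z \<in> span Q \<Longrightarrow> A \<bullet> Z = 0"
  using span_induct[of Z Q "\<lambda>Y. A \<bullet> Y = 0"] by (auto simp: subspace_def inner_add_right)

section \<open>Faces as sets of tight inequalities\<close>

definition face :: "(real ^ 'n ^ 'n) set \<Rightarrow> (real ^ 'n ^ 'n) set \<Rightarrow> (real ^ 'n ^ 'n) set" where
  "face C I = {Y \<in> Pspace. (\<forall>A\<in>C. A \<bullet> Y \<ge> 0) \<and> (\<forall>A\<in>I. A \<bullet> Y = 0)}"

lemma face_inner: "face C I = {Y \<in> Pspace. \<forall>A\<in>C \<union> I \<union> uminus ` I. A \<bullet> Y \<ge> 0}"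
proof -
  have "(\<forall>A\<in>I. A \<bullet> Y = 0) \<longleftrightarrow> (\<forall>A\<in>I. A \<bullet> Y \<ge> 0) \<and> (\<forall>A\<in>uminus ` I. A \<bullet> Y \<ge> 0)" for Y
    unfolding ball_simps inner_minus_left by (auto intro: order.antisym)
  then show ?thesis unfolding face_def ball_Un by simp
qed

definition vanishing :: "(real ^ 'n ^ 'n) set \<Rightarrow> (real ^ 'n ^ 'n) set \<Rightarrow> (real ^ 'n ^ 'n) set" where
  "vanishing C Q = {A \<in> C. \<forall>Y\<in>Q. A \<bullet> Y = 0}"

locale cone_system =
  fixes C :: "(real ^ 'n ^ 'n) set"
  assumes finite_C: "finite C" and C_Sym: "C \<subseteq> Sym"
begin

lemma face_polyhedron:
  assumes "I \<subseteq> C" "face C I \<noteq> {}"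
  shows "convex_polyhedron (face C I)"
  unfolding face_inner
proof (rule convex_polyhedronI)
  show "finite (C \<union> I \<union> uminus ` I)" using finite_C assms(1) finite_subset by blast
  show "C \<union> I \<union> uminus ` I \<subseteq> Sym" using C_Sym assms(1) subspace_neg[OF subspace_Sym] by blast
  show "{Y \<in> Pspace. \<forall>A\<in>C \<union> I \<union> uminus ` I. A \<bullet> Y \<ge> 0} \<noteq> {}" using assms(2) unfolding face_inner .
qed

lemma face_Int_perp: "A \<in> C \<Longrightarrow> face C I \<inter> perp A = face C (insert A I)"
  using C_Sym by (auto simp: face_def perp_inner)

text \<open>Relatively interior points are those at which every functional that does not vanish on
  the whole face is positive. Indeed, if such an \<open>A\<close> is 0 at \<open>Y\<close> and
  positive at a point \<open>W\<close> of the face, then a step from \<open>Y\<close> in the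
  direction opposite to \<open>W\<close> stays in the span and makes \<open>A\<close>
  negative.\<close>

lemma boundary_face:
  assumes I: "I \<subseteq> C" and ne: "face C I \<noteq> {}"
  shows "poly_boundary (face C I) = (\<Union>A\<in>C - vanishing C (face C I). face C I \<inter> perp A)"
proof -
  define Q where "Q = face C I"
  define S where "S = Pspace \<inter> span Q"
  define N where "N = C - vanishing C Q"
  have Q_P: "Q \<subseteq> Pspace" unfolding Q_def face_def by blast
  have span: "plane_span Q = S" unfolding S_def using plane_span_eq[OF Q_P] ne by (simp add: Q_def)
  have QS: "Q \<subseteq> S" unfolding S_def using Q_P span_base by blast
  have finN: "finite N" unfolding N_def using finite_C by blast
  have vanish_span: "A \<bullet> Z = 0" if "A \<in> C - N \<or> A \<in> I" "Z \<in> S" for A Z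
  proof (rule inner_span_0)
    show "Z \<in> span Q" using that(2) S_def by blast
    show "A \<bullet> Y = 0" if "Y \<in> Q" for Y
      using that \<open>A \<in> C - N \<or> A \<in> I\<close> unfolding N_def vanishing_def Q_def face_def by blast
  qed
  have char: "Z \<in> Q \<longleftrightarrow> (\<forall>A\<in>N. A \<bullet> Z \<ge> 0)" if "Z \<in> S" for Z
  proof
    assume "Z \<in> Q" then show "\<forall>A\<in>N. A \<bullet> Z \<ge> 0" unfolding Q_def face_def N_def by blast
  next
    assume n: "\<forall>A\<in>N. A \<bullet> Z \<ge> 0"
    have "A \<bullet> Z \<ge> 0" if "A \<in> C" for A using n vanish_span[OF _ \<open>Z \<in> S\<close>, of A] that by force
    then show "Z \<in> Q" using vanish_span[OF _ \<open>Z \<in> S\<close>] \<open>Z \<in> S\<close> unfolding Q_def face_def S_def by blast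
  qed
  have "closedin (top_of_set S) (S \<inter> (\<Inter>A\<in>N. {Z. A \<bullet> Z \<ge> 0}))"
    by (intro closedin_closed_Int closed_INT ballI closed_halfspace_ge)
  moreover have "S \<inter> (\<Inter>A\<in>N. {Z. A \<bullet> Z \<ge> 0}) = Q" using char QS by blast
  ultimately have closed: "top_of_set S closure_of Q = Q" by (simp add: closure_of_closedin)
  have int: "Y \<in> top_of_set S interior_of Q \<longleftrightarrow> (\<forall>A\<in>N. A \<bullet> Y > 0)" if Y: "Y \<in> Q" for Y
  proof
    assume n: "\<forall>A\<in>N. A \<bullet> Y > 0"
    have "openin (top_of_set S) (S \<inter> (\<Inter>A\<in>N. {Z. A \<bullet> Z > 0}))"
      by (intro openin_open_Int open_INT ballI finN open_halfspace_gt)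
    moreover have "S \<inter> (\<Inter>A\<in>N. {Z. A \<bullet> Z > 0}) \<subseteq> Q" using char by (force intro: less_imp_le)
    ultimately show "Y \<in> top_of_set S interior_of Q"
      unfolding interior_of_def using n Y QS by blast
  next
    assume "Y \<in> top_of_set S interior_of Q"
    then obtain U where U: "open U" "Y \<in> U" "S \<inter> U \<subseteq> Q"
      unfolding interior_of_def openin_open by blast
    show "\<forall>A\<in>N. A \<bullet> Y > 0"
    proof (rule ccontr)
      assume "\<not> (\<forall>A\<in>N. A \<bullet> Y > 0)"
      then obtain A where A: "A \<in> N" "A \<bullet> Y \<le> 0" by force
      then obtain W where W: "W \<in> Q" "A \<bullet> W \<noteq> 0" unfolding N_def vanishing_def by blast
      have "A \<bullet> W \<ge> 0" using W(1) A(1) unfolding Q_def face_def N_def by blast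
      with W have AW: "A \<bullet> W > 0" by simp
      define T where "T = {Z \<in> S. A \<bullet> Z < 0}"
      have "Y \<in> closure T"
      proof (rule in_closure_if_perturbed)
        show "Y \<in> Pspace" using Y Q_P by blast
        have "W \<in> Sym" using W(1) Q_P PDS_Sym Pspace_PDS by blast
        then show "- W \<in> Sym" using subspace_neg[OF subspace_Sym] by blast
        fix d :: real assume d: "d > 0" "Y + d *\<^sub>R - W \<in> PDS"
        obtain c where c: "c > 0" "nrm (Y + d *\<^sub>R - W) = c *\<^sub>R (Y + d *\<^sub>R - W)" using nrm_scale[OF d(2)] .
        have "Y + d *\<^sub>R - W \<in> span Q"
          using Y W(1) by (intro span_add span_scale span_neg span_base)
        then have "nrm (Y + d *\<^sub>R - W) \<in> S" unfolding S_def using nrm_Pspace[OF d(2)] c by (simp add: span_scale)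
        moreover have "A \<bullet> (Y + d *\<^sub>R - W) < 0"
          using A(2) mult_pos_pos[OF d(1) AW] by (simp add: inner_diff_right)
        then have "A \<bullet> nrm (Y + d *\<^sub>R - W) < 0" unfolding nrm_inner(4)[OF d(2)] .
        ultimately show "nrm (Y + d *\<^sub>R - W) \<in> T" unfolding T_def by blast
      qed
      then obtain Z where "Z \<in> T" "Z \<in> U" using open_Int_closure_eq_empty[OF U(1), of T] U(2) by blast
      then have "Z \<in> Q" "A \<bullet> Z < 0" using U(3) unfolding T_def by auto
      then show False using A(1) unfolding Q_def face_def N_def by force
    qed
  qed
  have "poly_boundary Q = Q - top_of_set S interior_of Q"
    unfolding poly_boundary_def span frontier_of_def closed ..
  also have "\<dots> = (\<Union>A\<in>N. Q \<inter> perp A)"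
  proof -
    have "A \<in> Sym" if "A \<in> N" for A using that C_Sym N_def by blast
    moreover have "A \<bullet> Y \<ge> 0" if "Y \<in> Q" "A \<in> N" for A Y using that unfolding Q_def face_def N_def by blast
    ultimately show ?thesis using int Q_P by (force simp: perp_inner not_less)
  qed
  finally show ?thesis unfolding N_def Q_def .
qed

text \<open>If every nonvanishing functional were nonzero somewhere on \<open>G\<close>, then
  \<open>ex_strictly_positive\<close> would give a point of \<open>G\<close> at which all of them
  are positive, that is, a point off the boundary.\<close>

lemma polyhedron_in_boundary:
  assumes I: "I \<subseteq> C" "face C I \<noteq> {}" and G: "convex_polyhedron G" "G \<subseteq> poly_boundary (face C I)"
  shows "\<exists>A\<in>C - vanishing C (face C I). G \<subseteq> face C I \<inter> perp A"
proof (rule ccontr)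
  let ?N = "C - vanishing C (face C I)"
  assume no: "\<not> (\<exists>A\<in>?N. G \<subseteq> face C I \<inter> perp A)"
  obtain \<A> where A: "G = {Y \<in> Pspace. \<forall>A\<in>\<A>. A \<bullet> Y \<ge> 0}" using convex_polyhedron_inner(2)[OF G(1)] by blast
  have GQ: "G \<subseteq> face C I" using G(2) unfolding boundary_face[OF I] by blast
  have "\<exists>Y\<in>G. \<forall>A\<in>?N. A \<bullet> Y > 0"
  proof (rule ex_strictly_positive[OF _ A convex_polyhedron_inner(1)[OF G(1)]])
    show "finite ?N" using finite_C by blast
    show "\<forall>A\<in>?N. \<forall>Y\<in>G. A \<bullet> Y \<ge> 0" using GQ unfolding face_def by blast
    show "\<forall>A\<in>?N. \<exists>Y\<in>G. A \<bullet> Y \<noteq> 0"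
    proof
      fix A assume AN: "A \<in> ?N"
      then obtain Y where "Y \<in> G" "Y \<notin> perp A" using no GQ by blast
      moreover have "A \<in> Sym" "Y \<in> Pspace" using AN C_Sym \<open>Y \<in> G\<close> A by auto
      ultimately show "\<exists>Y\<in>G. A \<bullet> Y \<noteq> 0" by (auto simp: perp_inner)
    qed
  qed
  then obtain Y where Y: "Y \<in> G" "\<forall>A\<in>?N. A \<bullet> Y > 0" by blast
  then obtain B where "B \<in> ?N" "Y \<in> perp B" using G(2) unfolding boundary_face[OF I] by blast
  then show False using Y(2) C_Sym by (force simp: perp_inner)
qed

lemma facet_is_face:
  assumes I: "I \<subseteq> C" "face C I \<noteq> {}" and G: "is_facet G (face C I)"
  shows "\<exists>J\<subseteq>C. G = face C J"
proof -
  have G': "convex_polyhedron G" "G \<subseteq> poly_boundary (face C I)"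
    "\<And>H. convex_polyhedron H \<Longrightarrow> H \<subseteq> poly_boundary (face C I) \<Longrightarrow> G \<subseteq> H \<Longrightarrow> H = G"
    using G unfolding is_facet_def by blast+
  obtain A where A: "A \<in> C - vanishing C (face C I)" "G \<subseteq> face C I \<inter> perp A"
    using polyhedron_in_boundary[OF I G'(1,2)] by blast
  have eq: "face C I \<inter> perp A = face C (insert A I)" using face_Int_perp A(1) by blast
  have "face C (insert A I) = G"
  proof (rule G'(3))
    show "convex_polyhedron (face C (insert A I))"
      by (rule face_polyhedron) (use A I eq convex_polyhedron_inner(1)[OF G'(1)] in auto)
    show "face C (insert A I) \<subseteq> poly_boundary (face C I)"
      unfolding boundary_face[OF I] eq[symmetric] using A(1) by blast
    show "G \<subseteq> face C (insert A I)" using A(2) eq by simp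
  qed
  then show ?thesis using A I by (intro exI[of _ "insert A I"]) auto
qed

text \<open>Among the finitely many sections of the face by the hyperplanes, take a maximal one
  above the given section. A polyhedron in the boundary that contains it lies in some section, which
  by maximality is the same one.\<close>

lemma ex_facet_above:
  assumes I: "I \<subseteq> C" "face C I \<noteq> {}" and A: "A \<in> C - vanishing C (face C I)" "face C I \<inter> perp A \<noteq> {}"
  shows "\<exists>B\<in>C - vanishing C (face C I). face C I \<inter> perp A \<subseteq> face C (insert B I) \<and>
    is_facet (face C (insert B I)) (face C I)"
proof -
  let ?N = "C - vanishing C (face C I)" and ?F = "(\<lambda>B. face C I \<inter> perp B)"
  have fin: "finite (?F ` ?N)" using finite_C by blast
  obtain M where M: "M \<in> ?F ` ?N" "?F A \<subseteq> M" "\<forall>K\<in>?F ` ?N. M \<subseteq> K \<longrightarrow> M = K"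
    using finite_has_maximal2[OF fin, of "?F A"] A(1) by blast
  then obtain B where B: "B \<in> ?N" "M = ?F B" by blast
  have eq: "?F B = face C (insert B I)" using face_Int_perp B(1) by blast
  have "is_facet M (face C I)"
    unfolding is_facet_def
  proof (intro conjI allI impI)
    show "convex_polyhedron M"
    proof -
      have "M \<noteq> {}" using M(2) A(2) by blast
      moreover have "insert B I \<subseteq> C" using B(1) I(1) by blast
      ultimately show ?thesis using face_polyhedron unfolding B(2) eq by blast
    qed
    show "M \<subseteq> poly_boundary (face C I)" unfolding boundary_face[OF I] B(2) using B(1) by blast
    fix G assume G: "convex_polyhedron G \<and> G \<subseteq> poly_boundary (face C I) \<and> M \<subseteq> G"
    then obtain D where D: "D \<in> ?N" "G \<subseteq> ?F D" using polyhedron_in_boundary[OF I] by blast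
    then have "M = ?F D" using M(3) G by blast
    then show "G = M" using D(2) G by blast
  qed
  then show ?thesis using B M(2) eq by auto
qed

lemma faces_subset:
  assumes "F \<in> faces (face C {})"
  shows "\<exists>I\<subseteq>C. F = face C I \<and> face C I \<noteq> {}"
  using assms
proof induction
  case self
  then show ?case by blast
next
  case (facet F G)
  then obtain I where I: "I \<subseteq> C" "F = face C I" "face C I \<noteq> {}" by blast
  then obtain J where "J \<subseteq> C" "G = face C J" using facet_is_face facet.hyps(2) by blast
  moreover have "G \<noteq> {}" using facet.hyps(2) convex_polyhedron_inner(1) unfolding is_facet_def by blast
  ultimately show ?case by blast
qed

text \<open>Descend from \<open>face C J\<close> through facets that still contain
  \<open>face C I\<close>. Each facet makes one more functional vanish, so the number of
  nonvanishing ones decreases until the two faces coincide.\<close>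

lemma face_in_faces:
  assumes I: "I \<subseteq> C" "face C I \<noteq> {}" and J: "J \<subseteq> C" "face C J \<in> faces (face C {})" "face C I \<subseteq> face C J"
  shows "face C I \<in> faces (face C {})"
  using J
proof (induction "card (C - vanishing C (face C J))" arbitrary: J rule: less_induct)
  case less
  show ?case
  proof (cases "face C J \<subseteq> face C I")
    case True
    then show ?thesis using less.prems by auto
  next
    case False
    have ne: "face C J \<noteq> {}" using I(2) less.prems(3) by blast
    obtain A where A: "A \<in> I" "A \<in> C - vanishing C (face C J)"
      using False I(1) unfolding face_def vanishing_def by blast
    have sub: "face C I \<subseteq> face C J \<inter> perp A"
      using less.prems(3) A(1) I(1) C_Sym by (auto simp: face_def perp_inner)
    then obtain B where B: "B \<in> C - vanishing C (face C J)" "face C J \<inter> perp A \<subseteq> face C (insert B J)"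
      "is_facet (face C (insert B J)) (face C J)"
      using ex_facet_above[OF less.prems(1) ne A(2)] I(2) by blast
    let ?K = "insert B J"
    have KJ: "face C ?K \<subseteq> face C J" unfolding face_def by blast
    have "B \<in> vanishing C (face C ?K)" using B(1) unfolding vanishing_def face_def by blast
    then have "C - vanishing C (face C ?K) \<subset> C - vanishing C (face C J)"
      using B(1) KJ unfolding vanishing_def by blast
    then have "card (C - vanishing C (face C ?K)) < card (C - vanishing C (face C J))"
      using finite_C by (intro psubset_card_mono) auto
    then show ?thesis
    proof (rule less.hyps)
      show "?K \<subseteq> C" using B(1) less.prems(1) by blast
      show "face C ?K \<in> faces (face C {})" using faces.facet[OF less.prems(2) B(3)] .
      show "face C I \<subseteq> face C ?K" using sub B(2) by blast
    qed
  qed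
qed

text \<open>\<open>Y\<close> realizes the sign vector in {0,+} whose exact zero set is
  \<open>J\<close>.\<close>

definition feas :: "(real ^ 'n ^ 'n) set \<Rightarrow> real ^ 'n ^ 'n \<Rightarrow> bool" where
  "feas J Y \<longleftrightarrow> Y \<in> PDS \<and> (\<forall>A\<in>J. A \<bullet> Y = 0) \<and> (\<forall>A\<in>C - J. A \<bullet> Y > 0)"

lemma feas_face: "feas J Y \<Longrightarrow> nrm Y \<in> face C J" "feas J Y \<Longrightarrow> A \<in> C - J \<Longrightarrow> A \<bullet> nrm Y > 0"
proof -
  assume f: "feas J Y"
  then have P: "Y \<in> PDS" by (simp add: feas_def)
  show "A \<in> C - J \<Longrightarrow> A \<bullet> nrm Y > 0" using f by (simp add: feas_def nrm_inner(1)[OF P])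
  have "A \<bullet> Y \<ge> 0" if "A \<in> C" for A using f that unfolding feas_def by (cases "A \<in> J") (auto intro: less_imp_le)
  then show "nrm Y \<in> face C J"
    using f unfolding face_def feas_def by (simp add: nrm_inner[OF P] nrm_Pspace[OF P])
qed

text \<open>Different index sets may cut out the same face. Enlarging \<open>I\<close> to all
  functionals that vanish on the face does not change it, and then a relatively interior point
  realizes exactly this zero set.\<close>

lemma faces_eq: "faces (face C {}) = {face C J | J. J \<subseteq> C \<and> (\<exists>Y. feas J Y)}"
proof (intro equalityI subsetI)
  fix F assume "F \<in> faces (face C {})"
  then obtain I where I: "I \<subseteq> C" "F = face C I" "face C I \<noteq> {}" using faces_subset by blast
  let ?J = "vanishing C (face C I)"
  have JF: "face C ?J = face C I"
    using I(1) by (auto simp: face_def vanishing_def)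
  obtain Y where Y: "Y \<in> face C I" "\<forall>A\<in>C - ?J. A \<bullet> Y > 0"
  proof -
    have "\<exists>Y\<in>face C I. \<forall>A\<in>C - ?J. A \<bullet> Y > 0"
      by (rule ex_strictly_positive[OF _ face_inner I(3)]) (use finite_C in \<open>auto simp: vanishing_def face_def\<close>)
    then show ?thesis using that by blast
  qed
  have "feas ?J Y" using Y Pspace_PDS unfolding feas_def vanishing_def by (auto simp: face_def)
  then show "F \<in> {face C J | J. J \<subseteq> C \<and> (\<exists>Y. feas J Y)}"
    using JF I(2) unfolding vanishing_def by blast
next
  fix F assume "F \<in> {face C J | J. J \<subseteq> C \<and> (\<exists>Y. feas J Y)}"
  then obtain J Y where J: "F = face C J" "J \<subseteq> C" "feas J Y" by blast
  then have ne: "face C J \<noteq> {}" using feas_face(1) by blast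
  have sub: "face C J \<subseteq> face C {}" unfolding face_def by blast
  then have "face C {} \<in> faces (face C {})" using ne by (intro faces.self) blast
  then show "F \<in> faces (face C {})" unfolding J(1) using face_in_faces[OF J(2) ne _ _ sub] by blast
qed

text \<open>A point with exact zero set \<open>J\<close> lies in \<open>face C K\<close> only if
  \<open>K\<close> is contained in \<open>J\<close>. So inclusion of faces is reversed inclusion of
  feasible zero sets, and equal faces have equal zero sets.\<close>

lemma face_subset_iff:
  assumes "J \<subseteq> C" "K \<subseteq> C" "feas J Y"
  shows "face C J \<subseteq> face C K \<longleftrightarrow> K \<subseteq> J"
proof
  assume "face C J \<subseteq> face C K"
  then have "nrm Y \<in> face C K" using feas_face(1)[OF assms(3)] by blast
  then have "A \<bullet> nrm Y = 0" if "A \<in> K" for A using that unfolding face_def by blast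
  then show "K \<subseteq> J" using feas_face(2)[OF assms(3)] assms(2) by force
qed (auto simp: face_def)

text \<open>From a relatively interior point one can move a little towards any \<open>X\<close> in
  the intersection of the hyperplanes and remain in the face. Hence \<open>X\<close> is a
  combination of two points of the face.\<close>

lemma plane_span_face:
  assumes J: "J \<subseteq> C" "feas J Y"
  shows "plane_span (face C J) = Pspace \<inter> (\<Inter>A\<in>J. perp A)"
proof -
  let ?F = "face C J" and ?Y = "nrm Y"
  have Y: "?Y \<in> ?F" "\<And>A. A \<in> C - J \<Longrightarrow> A \<bullet> ?Y > 0" using feas_face[OF J(2)] by auto
  have FP: "?F \<subseteq> Pspace" unfolding face_def by blast
  have span: "plane_span ?F = Pspace \<inter> span ?F" using plane_span_eq[OF FP] Y(1) by blast
  have perp: "X \<in> perp A \<longleftrightarrow> X \<in> Pspace \<and> A \<bullet> X = 0" if "A \<in> J" for A X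
    using that J(1) C_Sym by (auto simp: perp_inner)
  show ?thesis
  proof (intro equalityI subsetI)
    fix X assume "X \<in> plane_span ?F"
    then have X: "X \<in> Pspace" "X \<in> span ?F" unfolding span by auto
    have "A \<bullet> X = 0" if "A \<in> J" for A
      by (rule inner_span_0[OF _ X(2)]) (use that in \<open>auto simp: face_def\<close>)
    then show "X \<in> Pspace \<inter> (\<Inter>A\<in>J. perp A)" using X perp by auto
  next
    fix X assume "X \<in> Pspace \<inter> (\<Inter>A\<in>J. perp A)"
    then have X: "X \<in> Pspace" "\<And>A. A \<in> J \<Longrightarrow> A \<bullet> X = 0" using perp by auto
    \<comment> \<open>Small enough that no positive functional becomes negative; the
      \<open>+ 1\<close> avoids a division by zero, and the inserted 1 covers an empty
      \<open>C - J\<close>.\<close>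
    define e where "e = Min (insert 1 ((\<lambda>A. (A \<bullet> ?Y) / (\<bar>A \<bullet> X\<bar> + 1)) ` (C - J)))"
    have fin: "finite (insert 1 ((\<lambda>A. (A \<bullet> ?Y) / (\<bar>A \<bullet> X\<bar> + 1)) ` (C - J)))" using finite_C by blast
    have e: "e > 0" unfolding e_def using fin Y(2) by (subst Min_gr_iff) (auto intro!: divide_pos_pos)
    define W where "W = ?Y + e *\<^sub>R X"
    have W: "W \<in> PDS" unfolding W_def using Y(1) X(1) FP e by (intro PDS_add PDS_scale Pspace_PDS) auto
    have "A \<bullet> W \<ge> 0" if "A \<in> C - J" for A
    proof -
      have "e \<le> (A \<bullet> ?Y) / (\<bar>A \<bullet> X\<bar> + 1)" unfolding e_def by (rule Min_le[OF fin]) (use that in blast)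
      then have "e * (\<bar>A \<bullet> X\<bar> + 1) \<le> A \<bullet> ?Y" by (simp add: pos_le_divide_eq add_nonneg_pos)
      moreover have "- (e * \<bar>A \<bullet> X\<bar>) \<le> e * (A \<bullet> X)" using mult_left_mono[of "- \<bar>A \<bullet> X\<bar>" "A \<bullet> X" e] e by auto
      ultimately show ?thesis unfolding W_def inner_add_right inner_scaleR_right using e by (simp add: algebra_simps)
    qed
    moreover have "A \<bullet> W = 0" if "A \<in> J" for A
      using X(2)[OF that] Y(1) that unfolding W_def inner_add_right by (simp add: face_def)
    ultimately have "nrm W \<in> ?F"
      unfolding face_def using J(1) nrm_inner[OF W] nrm_Pspace[OF W] by force
    then have "nrm W \<in> span ?F" "?Y \<in> span ?F" using Y(1) by (auto intro: span_base)
    obtain c where c: "c > 0" "nrm W = c *\<^sub>R W" using nrm_scale[OF W] .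
    have "X = (1 / e) *\<^sub>R ((1 / c) *\<^sub>R nrm W - ?Y)" using c e unfolding c(2) W_def by simp
    then have "X \<in> span ?F" using \<open>nrm W \<in> span ?F\<close> \<open>?Y \<in> span ?F\<close> by (metis span_diff span_scale)
    then show "X \<in> plane_span ?F" unfolding span using X(1) by blast
  qed
qed

end


section \<open>Sample points\<close>

text \<open>Up to a positive factor, \<open>pr As\<close> is the orthogonal projection to the orthogonal complement of \<open>As\<close>.\<close>

fun pr :: "'a :: real_inner list \<Rightarrow> 'a \<Rightarrow> 'a" where
  "pr [] Y = Y"
| "pr (A # As) Y = (if pr As A = 0 then pr As Y
     else (pr As A \<bullet> pr As A) *\<^sub>R pr As Y - (pr As Y \<bullet> pr As A) *\<^sub>R pr As A)"

lemma linear_pr: "linear (pr As)"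
proof (induction As)
  case Nil
  show ?case by (simp add: linear_iff)
next
  case (Cons A As)
  then show ?case
    by (simp add: linear_iff inner_add_left algebra_simps)
qed

text \<open>Modulo the span of the list, \<open>pr\<close> is multiplication by a positive number
  that does not depend on the argument. The properties below follow from this invariant.\<close>

lemma pr_span: "\<exists>c>0. \<forall>Y. pr As Y - c *\<^sub>R Y \<in> span (set As)"
proof (induction As)
  case Nil
  show ?case by (intro exI[of _ 1]) (simp add: span_zero)
next
  case (Cons A As)
  then obtain c where c: "c > 0" "\<And>Y. pr As Y - c *\<^sub>R Y \<in> span (set As)" by blast
  have mono: "X \<in> span (set (A # As))" if "X \<in> span (set As)" for X
    using that span_mono[of "set As" "set (A # As)"] by auto
  have prA: "pr As A \<in> span (set (A # As))"
  proof -
    have "(pr As A - c *\<^sub>R A) + c *\<^sub>R A \<in> span (set (A # As))"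
      by (intro span_add mono c(2) span_scale span_base) simp
    then show ?thesis by simp
  qed
  show ?case
  proof (cases "pr As A = 0")
    case True
    then show ?thesis using c mono by (intro exI[of _ c]) simp
  next
    case False
    let ?b = "pr As A \<bullet> pr As A"
    have "pr (A # As) Y - (?b * c) *\<^sub>R Y \<in> span (set (A # As))" for Y
    proof -
      have "pr (A # As) Y - (?b * c) *\<^sub>R Y = ?b *\<^sub>R (pr As Y - c *\<^sub>R Y) - (pr As Y \<bullet> pr As A) *\<^sub>R pr As A"
        using False by (simp add: algebra_simps)
      also have "\<dots> \<in> span (set (A # As))" by (intro span_diff span_scale mono c(2) prA)
      finally show ?thesis .
    qed
    moreover have "?b * c > 0" using False c by simp
    ultimately show ?thesis by blast
  qed
qed

lemma inner_span_zero: "(\<And>A. A \<in> S \<Longrightarrow> A \<bullet> Y = 0) \<Longrightarrow> X \<in> span S \<Longrightarrow> X \<bullet> Y = 0"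
  using inner_span_0[of S Y X] by (simp add: inner_commute)

text \<open>The step makes the result orthogonal to \<open>pr As B\<close>, which differs from a
  positive multiple of \<open>B\<close> by an element of the span of the older vectors, to which the
  result is orthogonal by induction.\<close>

lemma pr_orthogonal: "A \<in> set As \<Longrightarrow> A \<bullet> pr As Y = 0"
proof (induction As arbitrary: A Y)
  case (Cons B As)
  obtain c where c: "c > 0" "\<And>Y. pr As Y - c *\<^sub>R Y \<in> span (set As)" using pr_span by blast
  let ?Y = "pr (B # As) Y" and ?B = "pr As B"
  have old: "A \<bullet> ?Y = 0" if "A \<in> set As" for A
    using Cons.IH[OF that] by (simp add: inner_diff_right)
  have "?B \<bullet> ?Y = 0" by (simp add: inner_diff_right inner_commute)
  moreover have "(?B - c *\<^sub>R B) \<bullet> ?Y = 0" by (rule inner_span_zero[OF old c(2)])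
  ultimately have "B \<bullet> ?Y = 0" using c(1) by (simp add: inner_diff_left del: pr.simps)
  then show ?case using old Cons.prems by (auto simp del: pr.simps)
qed simp

text \<open>The difference of \<open>pr As Y\<close> and \<open>c *\<^sub>R Y\<close> lies in the
  span of the list and is orthogonal to it, hence is 0.\<close>

lemma pr_fixed:
  assumes "\<And>A. A \<in> set As \<Longrightarrow> A \<bullet> Y = 0"
  shows "\<exists>c>0. pr As Y = c *\<^sub>R Y"
proof -
  obtain c where c: "c > 0" "pr As Y - c *\<^sub>R Y \<in> span (set As)" using pr_span by blast
  have "(pr As Y - c *\<^sub>R Y) \<bullet> (pr As Y - c *\<^sub>R Y) = 0"
    by (rule inner_span_zero[OF _ c(2)]) (simp add: inner_diff_right pr_orthogonal assms)
  then show ?thesis using c(1) by auto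
qed

lemma pr_Sym:
  assumes "set As \<subseteq> Sym" "Y \<in> Sym"
  shows "pr As Y \<in> Sym"
proof -
  obtain c where c: "pr As Y - c *\<^sub>R Y \<in> span (set As)" using pr_span by blast
  then have "pr As Y - c *\<^sub>R Y \<in> Sym" using span_minimal[OF assms(1) subspace_Sym] by blast
  then have "(pr As Y - c *\<^sub>R Y) + c *\<^sub>R Y \<in> Sym"
    using assms(2) by (intro subspace_add[OF subspace_Sym] subspace_scale[OF subspace_Sym])
  then show ?thesis by simp
qed

definition symz :: "('n \<Rightarrow> 'n \<Rightarrow> int) \<Rightarrow> real ^ 'n ^ 'n" where
  "symz Z = (\<chi> r c. real_of_int (Z r c + Z c r))"

lemma symz_Sym: "symz Z \<in> Sym"
  by (simp add: Sym_def symz_def transpose_def vec_eq_iff add.commute)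

lemma floor_quotient_tendsto: "(\<lambda>m. real_of_int \<lfloor>real (Suc m) * y\<rfloor> / real (Suc m)) \<longlonglongrightarrow> y"
proof (rule tendsto_sandwich[OF _ _ _ tendsto_const])
  show "\<forall>\<^sub>F m in sequentially. y - 1 / real (Suc m) \<le> real_of_int \<lfloor>real (Suc m) * y\<rfloor> / real (Suc m)"
  proof (rule always_eventually, rule allI)
    fix m
    have "real (Suc m) * y - 1 \<le> real_of_int \<lfloor>real (Suc m) * y\<rfloor>" by linarith
    then have "(real (Suc m) * y - 1) / real (Suc m) \<le> real_of_int \<lfloor>real (Suc m) * y\<rfloor> / real (Suc m)"
      by (intro divide_right_mono) auto
    then show "y - 1 / real (Suc m) \<le> real_of_int \<lfloor>real (Suc m) * y\<rfloor> / real (Suc m)"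
      by (simp add: diff_divide_distrib)
  qed
  show "\<forall>\<^sub>F m in sequentially. real_of_int \<lfloor>real (Suc m) * y\<rfloor> / real (Suc m) \<le> y"
    by (intro always_eventually allI) (simp add: pos_divide_le_eq mult.commute[of y] del: of_nat_Suc)
  have "(\<lambda>m. y - 1 / real (Suc m)) \<longlonglongrightarrow> y - 0"
    by (intro tendsto_diff tendsto_const LIMSEQ_Suc[OF lim_const_over_n])
  then show "(\<lambda>m. y - 1 / real (Suc m)) \<longlonglongrightarrow> y" by simp
qed

text \<open>Rational symmetric matrices approximate \<open>Y\<close>, and their projections
  approximate the projection of \<open>Y\<close>, a positive multiple of \<open>Y\<close> itself.
  The equations hold exactly after projection, whereas positivity is an open condition and holds for
  a close approximation. Since \<open>pr\<close> is linear, the denominator can be cleared.\<close>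

lemma (in cone_system) ex_integer_sample:
  assumes J: "set Js \<subseteq> C" "feas (set Js) Y"
  shows "\<exists>Z. feas (set Js) (pr Js (symz Z))"
proof -
  define Zm where "Zm m = (\<lambda>r c. \<lfloor>real (Suc m) * (Y $ r $ c)\<rfloor>)" for m
  \<comment> \<open>The 2 compensates for \<open>symz\<close>, which adds the transpose.\<close>
  define X where "X m = (1 / (2 * real (Suc m))) *\<^sub>R symz (Zm m)" for m
  have Y: "Y \<in> PDS" "\<And>A. A \<in> set Js \<Longrightarrow> A \<bullet> Y = 0" "\<And>A. A \<in> C - set Js \<Longrightarrow> A \<bullet> Y > 0"
    using J(2) unfolding feas_def by auto
  have sym: "Y $ c $ r = Y $ r $ c" for r c
    using PDS_Sym[OF Y(1)] unfolding Sym_def by (simp add: transpose_def vec_eq_iff)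
  have "X \<longlonglongrightarrow> Y"
  proof (intro vec_tendstoI)
    fix r c
    have "(\<lambda>m. (real_of_int (Zm m r c) / real (Suc m) + real_of_int (Zm m c r) / real (Suc m)) / 2)
        \<longlonglongrightarrow> (Y $ r $ c + Y $ c $ r) / 2"
      unfolding Zm_def by (intro tendsto_intros floor_quotient_tendsto) simp
    then show "(\<lambda>m. X m $ r $ c) \<longlonglongrightarrow> Y $ r $ c"
      by (simp add: sym X_def symz_def field_simps del: of_nat_Suc)
  qed
  then have lim: "(\<lambda>m. pr Js (X m)) \<longlonglongrightarrow> pr Js Y"
    using linear_pr[of Js] by (simp add: linear_conv_bounded_linear bounded_linear.tendsto)
  obtain c where c: "c > 0" "pr Js Y = c *\<^sub>R Y" using pr_fixed[of Js Y] Y(2) by blast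
  have P: "pr Js Y \<in> PDS" unfolding c(2) by (rule PDS_scale[OF Y(1) c(1)])
  then obtain e where e: "e > 0" "\<And>X. X \<in> Sym \<Longrightarrow> norm (X - pr Js Y) < e \<Longrightarrow> X \<in> PDS" using PDS_open by blast
  have "\<forall>\<^sub>F m in sequentially. norm (pr Js (X m) - pr Js Y) < e"
    using tendstoD[OF lim e(1)] by (simp add: dist_norm)
  moreover have "\<forall>\<^sub>F m in sequentially. A \<bullet> pr Js (X m) > 0" if "A \<in> C - set Js" for A
  proof (rule order_tendstoD(1))
    show "(\<lambda>m. A \<bullet> pr Js (X m)) \<longlonglongrightarrow> A \<bullet> pr Js Y" by (intro tendsto_intros lim)
    show "A \<bullet> pr Js Y > 0" unfolding c(2) using c(1) Y(3)[OF that] by simp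
  qed
  then have "\<forall>\<^sub>F m in sequentially. \<forall>A\<in>C - set Js. A \<bullet> pr Js (X m) > 0"
    by (intro eventually_ball_finite) (use finite_C in auto)
  ultimately have "\<forall>\<^sub>F m in sequentially. norm (pr Js (X m) - pr Js Y) < e \<and> (\<forall>A\<in>C - set Js. A \<bullet> pr Js (X m) > 0)"
    by (rule eventually_conj)
  then obtain m where m: "norm (pr Js (X m) - pr Js Y) < e" "\<forall>A\<in>C - set Js. A \<bullet> pr Js (X m) > 0"
    using eventually_happens' by (metis (no_types, lifting) sequentially_bot)
  have "X m \<in> Sym" unfolding X_def by (rule subspace_scale[OF subspace_Sym symz_Sym])
  then have "pr Js (X m) \<in> PDS" using e(2)[OF pr_Sym m(1)] J(1) C_Sym by blast
  moreover have s: "pr Js (symz (Zm m)) = (2 * real (Suc m)) *\<^sub>R pr Js (X m)"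
    unfolding X_def linear_scale[OF linear_pr] by (simp del: of_nat_Suc)
  ultimately have "pr Js (symz (Zm m)) \<in> PDS" by (simp add: PDS_scale del: of_nat_Suc)
  moreover have "A \<bullet> pr Js (symz (Zm m)) > 0" if "A \<in> C - set Js" for A
    using m(2) that unfolding s by (simp del: of_nat_Suc)
  ultimately have "feas (set Js) (pr Js (symz (Zm m)))"
    unfolding feas_def using pr_orthogonal by blast
  then show ?thesis by blast
qed

section \<open>The output determined by the realized sign vectors\<close>

definition pos_list :: "nat list list \<Rightarrow> nat list list" where
  "pos_list Is = map (\<lambda>j. filter (\<lambda>l. set (Is ! (j - 1)) \<subset> set (Is ! (l - 1))) [1..<Suc (length Is)])
     [1..<Suc (length Is)]"

definition sign_ok :: "(real ^ 'n ^ 'n) list \<Rightarrow> nat set \<Rightarrow> real ^ 'n ^ 'n \<Rightarrow> bool" where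
  "sign_ok As I Y \<longleftrightarrow> Y \<in> PDS \<and>
     (\<forall>i\<in>{1..length As}. if i \<in> I then As ! (i - 1) \<bullet> Y = 0 else As ! (i - 1) \<bullet> Y > 0)"

definition members :: "'a list \<Rightarrow> nat set \<Rightarrow> 'a set" where
  "members As I = (\<lambda>i. As ! (i - 1)) ` I"

lemma inj_members_nth:
  assumes "distinct As"
  shows "inj_on (\<lambda>i. As ! (i - 1)) {1..length As}"
  using assms by (intro inj_onI) (auto simp: nth_eq_iff_index_eq)

lemma members_subset: "I \<subseteq> {1..length As} \<Longrightarrow> members As I \<subseteq> set As"
  unfolding members_def
proof (rule image_subsetI)
  fix i assume "I \<subseteq> {1..length As}" "i \<in> I"
  then have "1 \<le> i" "i \<le> length As" by auto
  then show "As ! (i - 1) \<in> set As" by (intro nth_mem) simp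
qed

lemma members_all: "members As {1..length As} = set As"
proof
  show "set As \<subseteq> members As {1..length As}"
  proof
    fix A assume "A \<in> set As"
    then obtain i where "i < length As" "A = As ! i" by (auto simp: in_set_conv_nth)
    then show "A \<in> members As {1..length As}" unfolding members_def by (intro image_eqI[of _ _ "Suc i"]) auto
  qed
qed (rule members_subset[OF subset_refl])

lemma nth_mem_members:
  assumes "distinct As" "I \<subseteq> {1..length As}" "i \<in> {1..length As}"
  shows "As ! (i - 1) \<in> members As I \<longleftrightarrow> i \<in> I"
  using inj_on_image_mem_iff[OF inj_members_nth[OF assms(1)] assms(3,2)] unfolding members_def by simp

lemma sign_ok_feas:
  assumes "cone_system (set As)" "distinct As" "I \<subseteq> {1..length As}"
  shows "sign_ok As I Y \<longleftrightarrow> cone_system.feas (set As) (members As I) Y"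
proof -
  interpret cone_system "set As" by fact
  have "(\<forall>i\<in>{1..length As}. if i \<in> I then As ! (i - 1) \<bullet> Y = 0 else As ! (i - 1) \<bullet> Y > 0) \<longleftrightarrow>
      (\<forall>A\<in>members As {1..length As}. if A \<in> members As I then A \<bullet> Y = 0 else A \<bullet> Y > 0)"
    unfolding members_def[of As "{1..length As}"] ball_simps using nth_mem_members[OF assms(2,3)] by simp
  also have "\<dots> \<longleftrightarrow> (\<forall>A\<in>members As I. A \<bullet> Y = 0) \<and> (\<forall>A\<in>set As - members As I. A \<bullet> Y > 0)"
    unfolding members_all using members_subset[OF assms(3)] by auto
  finally show ?thesis unfolding sign_ok_def feas_def by simp
qed

lemma polyhedron_of_face: "polyhedron_of As = face (set As) {}"
proof -
  have "trace (A ** Y) = A \<bullet> Y" if "Y \<in> Pspace" for A Y :: "real ^ 'a ^ 'a"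
    using that by (intro trace_mult_Sym PDS_Sym Pspace_PDS)
  then show ?thesis unfolding polyhedron_of_def face_def by (simp cong: conj_cong)
qed

text \<open>A duplicate-free list of exactly the realized zero sets enumerates the faces once each:
  the samples show that every listed set belongs to a face, \<open>compl\<close> shows that none is
  missing, and the feasible zero set is determined by the face.\<close>

lemma describes_facesI:
  assumes Sym: "set As' \<subseteq> Sym" and As: "distinct As" "set As = set As'"
    and Is: "distinct (map set Is)" "\<And>I. I \<in> set Is \<Longrightarrow> set I \<subseteq> {1..length As}"
    and samp: "length Ss = length Is" "\<And>j. j < length Is \<Longrightarrow> sign_ok As (set (Is ! j)) (Ss ! j)"
    and compl: "\<And>I Y. I \<subseteq> {1..length As} \<Longrightarrow> sign_ok As I Y \<Longrightarrow> I \<in> set (map set Is)"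
  shows "describes_faces As' As Is (pos_list Is) Ss"
proof -
  interpret cone_system "set As" using Sym As by unfold_locales auto
  have cs: "cone_system (set As)" by unfold_locales
  let ?m = "length Is"
  define J where "J j = members As (set (Is ! (j - 1)))" for j
  define F where "F j = face (set As) (J j)" for j
  have Ij: "set (Is ! (j - 1)) \<subseteq> {1..length As}" if "j \<in> {1..?m}" for j
    using that by (intro Is(2) nth_mem) auto
  have J: "J j \<subseteq> set As" if "j \<in> {1..?m}" for j
    unfolding J_def using members_subset[OF Ij[OF that]] .
  have feas: "feas (J j) (Ss ! (j - 1))" if "j \<in> {1..?m}" for j
  proof -
    have "j - 1 < ?m" using that by auto
    from samp(2)[OF this] show ?thesis unfolding J_def sign_ok_feas[OF cs As(1) Ij[OF that]] .
  qed
  have J_mono: "J l \<subseteq> J j \<longleftrightarrow> set (Is ! (l - 1)) \<subseteq> set (Is ! (j - 1))" if "l \<in> {1..?m}" "j \<in> {1..?m}" for l j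
    unfolding J_def members_def
    by (rule inj_on_image_subset_iff[OF inj_members_nth[OF As(1)]]) (use Ij that in blast)+
  have F_mono: "F l \<subseteq> F j \<longleftrightarrow> set (Is ! (j - 1)) \<subseteq> set (Is ! (l - 1))" if "l \<in> {1..?m}" "j \<in> {1..?m}" for l j
    unfolding F_def face_subset_iff[OF J[OF that(1)] J[OF that(2)] feas[OF that(1)]] J_mono[OF that(2,1)] ..
  have bij: "bij_betw F {1..?m} (faces (polyhedron_of As'))"
    unfolding bij_betw_def
  proof
    show "inj_on F {1..?m}"
    proof (rule inj_onI)
      fix l j assume lj: "l \<in> {1..?m}" "j \<in> {1..?m}" "F l = F j"
      then have "set (Is ! (l - 1)) = set (Is ! (j - 1))" using F_mono[of l j] F_mono[of j l] by auto
      moreover have "l - 1 < ?m" "j - 1 < ?m" using lj by auto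
      ultimately have "l - 1 = j - 1" using Is(1) nth_eq_iff_index_eq[of "map set Is" "l - 1" "j - 1"] by simp
      then show "l = j" using lj by auto
    qed
    have P: "faces (polyhedron_of As') = {face (set As) K | K. K \<subseteq> set As \<and> (\<exists>Y. feas K Y)}"
      unfolding polyhedron_of_face As(2)[symmetric] by (rule faces_eq)
    show "F ` {1..?m} = faces (polyhedron_of As')"
    proof
      show "F ` {1..?m} \<subseteq> faces (polyhedron_of As')" unfolding P F_def using J feas by blast
      show "faces (polyhedron_of As') \<subseteq> F ` {1..?m}"
      proof
        fix G assume "G \<in> faces (polyhedron_of As')"
        then obtain K Y where K: "G = face (set As) K" "K \<subseteq> set As" "feas K Y" unfolding P by blast
        define I where "I = {i \<in> {1..length As}. As ! (i - 1) \<in> K}"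
        have I: "I \<subseteq> {1..length As}" unfolding I_def by blast
        have IK: "members As I = K"
        proof -
          have "K \<subseteq> (\<lambda>i. As ! (i - 1)) ` {1..length As}"
            using K(2) unfolding members_all[of As, symmetric] members_def .
          then show ?thesis unfolding I_def members_def by blast
        qed
        have "sign_ok As I Y" using K(3) sign_ok_feas[OF cs As(1) I] IK by simp
        then have "I \<in> set (map set Is)" by (rule compl[OF I])
        then obtain j where j: "j < ?m" "set (Is ! j) = I" by (auto simp: in_set_conv_nth)
        then have "G = F (Suc j)" unfolding F_def J_def K(1) using IK by simp
        then show "G \<in> F ` {1..?m}" using j(1) by auto
      qed
    qed
  qed
  then have card: "card (faces (polyhedron_of As')) = ?m" "finite (faces (polyhedron_of As'))"
    using bij_betw_same_card[OF bij] bij_betw_finite[OF bij] by auto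
  have "set (Is ! (j - 1)) \<subseteq> {1..length As} \<and>
      plane_span (F j) = Pspace \<inter> (\<Inter>i\<in>set (Is ! (j - 1)). perp (As ! (i - 1))) \<and>
      set (pos_list Is ! (j - 1)) = {l \<in> {1..?m}. F l \<subset> F j} \<and>
      (\<exists>Y\<in>F j. represents (Ss ! (j - 1)) Y)" if j: "j \<in> {1..?m}" for j
  proof (intro conjI)
    show "set (Is ! (j - 1)) \<subseteq> {1..length As}" by (rule Ij[OF j])
    show "plane_span (F j) = Pspace \<inter> (\<Inter>i\<in>set (Is ! (j - 1)). perp (As ! (i - 1)))"
      unfolding F_def plane_span_face[OF J[OF j] feas[OF j]] by (simp add: J_def members_def)
    have "pos_list Is ! (j - 1) = filter (\<lambda>l. set (Is ! (j - 1)) \<subset> set (Is ! (l - 1))) [1..<Suc ?m]"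
    proof -
      have "j - 1 < length [1..<Suc ?m]" "[1..<Suc ?m] ! (j - 1) = j" using j by (auto simp: nth_append)
      then show ?thesis by (simp only: pos_list_def nth_map)
    qed
    then have "set (pos_list Is ! (j - 1)) = {l \<in> {1..?m}. set (Is ! (j - 1)) \<subset> set (Is ! (l - 1))}"
      by auto
    also have "\<dots> = {l \<in> {1..?m}. F l \<subset> F j}"
    proof -
      have "set (Is ! (j - 1)) \<subset> set (Is ! (l - 1)) \<longleftrightarrow> F l \<subset> F j" if "l \<in> {1..?m}" for l
        unfolding less_le_not_le F_mono[OF that j] F_mono[OF j that] ..
      then show ?thesis by blast
    qed
    finally show "set (pos_list Is ! (j - 1)) = {l \<in> {1..?m}. F l \<subset> F j}" .
    have "Ss ! (j - 1) \<in> PDS" using feas[OF j] by (simp add: feas_def)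
    then show "\<exists>Y\<in>F j. represents (Ss ! (j - 1)) Y"
      using feas_face(1)[OF feas[OF j]] represents_nrm unfolding F_def by blast
  qed
  then have "\<forall>j\<in>{1..?m}. set (Is ! (j - 1)) \<subseteq> {1..length As} \<and>
      plane_span (F j) = Pspace \<inter> (\<Inter>i\<in>set (Is ! (j - 1)). perp (As ! (i - 1))) \<and>
      set (pos_list Is ! (j - 1)) = {l \<in> {1..?m}. F l \<subset> F j} \<and>
      (\<exists>Y\<in>F j. represents (Ss ! (j - 1)) Y)" by (rule ballI)
  note main = conjI[OF bij this]
  show ?thesis
    unfolding describes_faces_def Let_def card(1)
  proof (intro conjI)
    show "distinct As" "set As \<subseteq> set As'" "finite (faces (polyhedron_of As'))" "length Is = ?m" "length Ss = ?m"
      using As card(2) samp(1) by simp_all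
    show "length (pos_list Is) = ?m" unfolding pos_list_def length_map length_upt by simp
  qed (rule exI[of _ F], rule main)
qed


section \<open>Guards and outputs of the stages\<close>

lemma ef_if:
  assumes "dec P" "ef f" "ef g"
  shows "ef (\<lambda>e. if P e then f e else g e)"
proof -
  have "ef (\<lambda>e. of_bool (P e) * f e + (1 - of_bool (P e)) * g e)"
    using assms unfolding dec_def by (intro ef_add ef_mult ef_diff ef_one)
  moreover have "of_bool (P e) * f e + (1 - of_bool (P e)) * g e = (if P e then f e else g e)" for e
    by simp
  ultimately show ?thesis by simp
qed

section \<open>Matrices and lists with computable entries\<close>

definition efM :: "((nat \<Rightarrow> real) \<Rightarrow> real ^ 'n ^ 'm) \<Rightarrow> bool" where
  "efM S \<longleftrightarrow> (\<forall>r c. ef (\<lambda>e. S e $ r $ c))"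

lemma ef_inner: "efM S \<Longrightarrow> efM T \<Longrightarrow> ef (\<lambda>e. S e \<bullet> T e)"
  unfolding efM_def inner_vec_def inner_real_def by (intro ef_sum ef_mult) auto

lemma dec_matrix_eq: "efM S \<Longrightarrow> efM T \<Longrightarrow> dec (\<lambda>e. S e = T e)"
proof -
  assume ST: "efM S" "efM T"
  have "dec (\<lambda>e. \<forall>r\<in>UNIV. \<forall>c\<in>UNIV. S e $ r $ c - T e $ r $ c = 0)"
    using ST unfolding efM_def by (intro dec_ball dec_eq_0 ef_diff finite) auto
  then show ?thesis by (simp add: vec_eq_iff)
qed

lemma efM_pr:
  fixes T :: "(nat \<Rightarrow> real) \<Rightarrow> real ^ 'n ^ 'n"
  assumes "\<And>S. S \<in> set Ss \<Longrightarrow> efM S" "efM T"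
  shows "efM (\<lambda>e. pr (map (\<lambda>S. S e) Ss) (T e))"
  using assms
proof (induction Ss arbitrary: T)
  case (Cons S Ss)
  let ?p = "\<lambda>T e. pr (map (\<lambda>S. S e) Ss) (T e)"
  have B: "efM (?p S)" and T: "efM (?p T)" using Cons by auto
  have z: "efM (\<lambda>e. 0 :: real ^ 'n ^ 'n)" by (simp add: efM_def ef_zero)
  have "ef (\<lambda>e. if ?p S e = 0 then ?p T e $ r $ c
      else (?p S e \<bullet> ?p S e) * (?p T e $ r $ c) - (?p T e \<bullet> ?p S e) * (?p S e $ r $ c))" for r c
    by (intro ef_if ef_diff ef_mult ef_inner dec_matrix_eq B T z)
       (use B T in \<open>auto simp: efM_def\<close>)
  moreover have "pr (map (\<lambda>S. S e) (S # Ss)) (T e) $ r $ c =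
     (if ?p S e = 0 then ?p T e $ r $ c
      else (?p S e \<bullet> ?p S e) * (?p T e $ r $ c) - (?p T e \<bullet> ?p S e) * (?p S e $ r $ c))" for e r c
    by simp
  ultimately show ?case unfolding efM_def by presburger
qed simp

text \<open>The list \<open>fs\<close> is chosen before \<open>e\<close>, so the length is the same
  for all inputs. This is why a stage fixes all combinatorial data of its output in advance.\<close>

definition efL :: "((nat \<Rightarrow> real) \<Rightarrow> real list) \<Rightarrow> bool" where
  "efL f \<longleftrightarrow> (\<exists>fs. (\<forall>g\<in>set fs. ef g) \<and> (\<forall>e. f e = map (\<lambda>g. g e) fs))"

lemma efL_append: "efL f \<Longrightarrow> efL g \<Longrightarrow> efL (\<lambda>e. f e @ g e)"
proof -
  assume "efL f" "efL g"
  then obtain fs gs where "\<forall>h\<in>set fs. ef h" "\<forall>e. f e = map (\<lambda>g. g e) fs"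
    "\<forall>h\<in>set gs. ef h" "\<forall>e. g e = map (\<lambda>g. g e) gs" unfolding efL_def by blast
  then show ?thesis unfolding efL_def by (intro exI[of _ "fs @ gs"]) auto
qed

lemma efL_single: "ef f \<Longrightarrow> efL (\<lambda>e. [f e])"
  unfolding efL_def by (intro exI[of _ "[f]"]) simp

lemma efL_Cons: "ef f \<Longrightarrow> efL g \<Longrightarrow> efL (\<lambda>e. f e # g e)"
  using efL_append[OF efL_single] by simp

lemma efL_Nil: "efL (\<lambda>e. [])"
  unfolding efL_def by (intro exI[of _ "[]"]) simp

lemma efL_map: "(\<And>i. i \<in> set is \<Longrightarrow> ef (f i)) \<Longrightarrow> efL (\<lambda>e. map (\<lambda>i. f i e) is)"
  by (induction "is") (simp_all add: efL_Nil efL_Cons)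

lemma efL_concat: "(\<And>i. i \<in> set is \<Longrightarrow> efL (f i)) \<Longrightarrow> efL (\<lambda>e. concat (map (\<lambda>i. f i e) is))"
  by (induction "is") (simp_all add: efL_Nil efL_append)

lemma efL_matrix: "efM S \<Longrightarrow> efL (\<lambda>e. enc_matrix ns (S e))"
  unfolding enc_matrix_def efM_def by (intro efL_concat efL_map) auto

lemma efL_matrices:
  assumes "\<And>i. i \<in> set is \<Longrightarrow> efM (S i)"
  shows "efL (\<lambda>e. enc_matrices ns (map (\<lambda>i. S i e) is))"
  unfolding enc_matrices_def map_map comp_def length_map
  by (intro efL_Cons efL_concat efL_matrix ef_of_nat assms)

lemma efL_array: "efL (\<lambda>e. enc_array L)"
  unfolding enc_array_def by (intro efL_Cons efL_concat efL_map ef_of_nat)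

section \<open>Decidability of positive definiteness and of feasibility\<close>

lemma ex_inj_nat: "\<exists>g :: 'i :: finite \<Rightarrow> nat. inj g"
  using finite_imp_inj_to_nat_seg[OF finite[of "UNIV :: 'i set"]] by blast

text \<open>The values of the quantified function are placed in fresh variables from
  \<open>m\<close> on, on which \<open>Q\<close> does not depend; then finitely many real variables
  are eliminated.\<close>

lemma sa_ex_fun:
  fixes Q :: "(nat \<Rightarrow> real) \<Rightarrow> ('i :: finite \<Rightarrow> real) \<Rightarrow> bool"
  assumes sa: "\<And>w :: 'i \<Rightarrow> nat. sa (\<lambda>e. Q e (\<lambda>i. e (w i)))"
    and dep: "\<And>e e' f. (\<And>k. k < m \<Longrightarrow> e k = e' k) \<Longrightarrow> Q e f = Q e' f"
  shows "sa (\<lambda>e. \<exists>f. Q e f)"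
proof -
  obtain g :: "'i \<Rightarrow> nat" where g: "inj g" using ex_inj_nat by blast
  define w where "w i = m + g i" for i
  have inj: "inj w" using g unfolding w_def inj_def by simp
  define V where "V = range w"
  have "sa (\<lambda>e. \<exists>y. (\<lambda>e. Q e (\<lambda>i. e (w i))) (\<lambda>k. if k \<in> V then y k else e k))"
    by (rule sa_ex_finite[OF sa]) (simp add: V_def)
  moreover have "(\<exists>y. Q (\<lambda>k. if k \<in> V then y k else e k) (\<lambda>i. if w i \<in> V then y (w i) else e (w i))) \<longleftrightarrow> (\<exists>f. Q e f)" for e
  proof -
    have Q: "Q (\<lambda>k. if k \<in> V then y k else e k) f = Q e f" for y f
      by (rule dep) (auto simp: V_def w_def)
    have f: "(\<lambda>i. (f \<circ> inv w) (w i)) = f" for f :: "'i \<Rightarrow> real" using inj by simp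
    have "(\<exists>y. Q e (\<lambda>i. y (w i))) \<longleftrightarrow> (\<exists>f. Q e f)" by (metis f)
    then show ?thesis unfolding Q by (simp add: V_def)
  qed
  ultimately show ?thesis by simp
qed

definition mat_at :: "('n \<Rightarrow> 'n \<Rightarrow> nat) \<Rightarrow> (nat \<Rightarrow> real) \<Rightarrow> real ^ 'n ^ 'n" where
  "mat_at y e = (\<chi> r c. e (y r c))"

lemma mat_at_nth [simp]: "mat_at y e $ r $ c = e (y r c)"
  by (simp add: mat_at_def)

lemma pf_inner_mat_at: "pf (\<lambda>e. mat_at y e \<bullet> mat_at z e)"
  unfolding inner_vec_def inner_real_def mat_at_nth by (intro pf_intros)

text \<open>Positive definiteness is treated as a quantified formula over the vectors, so no
  determinant criterion is involved; the search for a vector that violates it is eliminated.\<close>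

lemma sa_PDS: "sa (\<lambda>e. mat_at (y :: 'n :: finite \<Rightarrow> 'n \<Rightarrow> nat) e \<in> PDS)"
proof -
  have "mat_at y e \<in> PDS \<longleftrightarrow> (\<forall>r c. e (y c r) - e (y r c) = 0) \<and>
      \<not> (\<exists>f. \<not> (\<forall>i. f i = 0) \<and> \<not> (\<Sum>r\<in>UNIV. f r * (\<Sum>c\<in>UNIV. e (y r c) * f c)) > 0)" for e
  proof -
    have all: "(\<forall>v :: real ^ 'n. R (\<lambda>i. v $ i)) \<longleftrightarrow> (\<forall>f. R f)" for R
      by (metis vec_lambda_inverse UNIV_I)
    have "positive_definite (mat_at y e) \<longleftrightarrow>
        (\<forall>v :: real ^ 'n. \<not> (\<forall>i. v $ i = 0) \<longrightarrow> (\<Sum>r\<in>UNIV. v $ r * (\<Sum>c\<in>UNIV. e (y r c) * v $ c)) > 0)"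
      unfolding positive_definite_def by (simp add: inner_vec_def matrix_vector_mult_def vec_eq_iff)
    also have "\<dots> \<longleftrightarrow> (\<forall>f. \<not> (\<forall>i. f i = 0) \<longrightarrow> (\<Sum>r\<in>UNIV. f r * (\<Sum>c\<in>UNIV. e (y r c) * f c)) > 0)"
      by (rule all)
    finally show ?thesis by (auto simp: PDS_def Sym_def transpose_def vec_eq_iff)
  qed
  moreover have "sa (\<lambda>e. \<exists>f. \<not> (\<forall>i. f i = 0) \<and> \<not> (\<Sum>r\<in>UNIV. f r * (\<Sum>c\<in>UNIV. e (y r c) * f c)) > 0)"
  proof (rule sa_ex_fun[where m = "Suc (Max (range (\<lambda>(r, c). y r c)))"])
    fix w :: "'n \<Rightarrow> nat"
    show "sa (\<lambda>e. \<not> (\<forall>i. e (w i) = 0) \<and> \<not> (\<Sum>r\<in>UNIV. e (w r) * (\<Sum>c\<in>UNIV. e (y r c) * e (w c))) > 0)"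
      by (intro sa_conj sa_not sa_all_finite sa_eq_0 sa_pos pf_intros)
  next
    fix e e' :: "nat \<Rightarrow> real" and f :: "'n \<Rightarrow> real"
    assume "\<And>k. k < Suc (Max (range (\<lambda>(r, c). y r c))) \<Longrightarrow> e k = e' k"
    moreover have "y r c < Suc (Max (range (\<lambda>(r, c). y r c)))" for r c
    proof -
      have "y r c \<in> range (\<lambda>(r, c). y r c)" by (rule image_eqI[of _ _ "(r, c)"]) auto
      then show ?thesis by (simp add: less_Suc_eq_le)
    qed
    ultimately have "e (y r c) = e' (y r c)" for r c by blast
    then show "(\<not> (\<forall>i. f i = 0) \<and> \<not> (\<Sum>r\<in>UNIV. f r * (\<Sum>c\<in>UNIV. e (y r c) * f c)) > 0) =
        (\<not> (\<forall>i. f i = 0) \<and> \<not> (\<Sum>r\<in>UNIV. f r * (\<Sum>c\<in>UNIV. e' (y r c) * f c)) > 0)" by simp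
  qed
  ultimately show ?thesis by (simp only:) (intro sa_conj sa_not sa_all_finite sa_eq_0 pf_intros)
qed

text \<open>Quantifier elimination applies to matrices of variables; the computed entries of
  \<open>S\<close> are substituted for these variables afterwards, which \<open>ef\<close>
  permits.\<close>

lemma dec_PDS:
  fixes S :: "(nat \<Rightarrow> real) \<Rightarrow> real ^ 'n ^ 'n"
  assumes "efM S"
  shows "dec (\<lambda>e. S e \<in> PDS)"
proof -
  obtain g :: "'n \<times> 'n \<Rightarrow> nat" where g: "inj g" using ex_inj_nat by blast
  define \<sigma> where "\<sigma> k = (\<lambda>e. S e $ fst (inv g k) $ snd (inv g k))" for k
  have "dec (\<lambda>e. mat_at (\<lambda>r c. g (r, c)) (\<lambda>k. \<sigma> k e) \<in> PDS)"
    by (rule dec_subst[OF dec_sa[OF sa_PDS]]) (use assms in \<open>simp add: \<sigma>_def efM_def\<close>)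
  moreover have "mat_at (\<lambda>r c. g (r, c)) (\<lambda>k. \<sigma> k e) = S e" for e
    using g by (simp add: vec_eq_iff \<sigma>_def)
  ultimately show ?thesis by simp
qed

lemma dec_sign_ok:
  assumes "\<And>i. i \<in> set is \<Longrightarrow> efM (A i)" "efM S"
  shows "dec (\<lambda>e. sign_ok (map (\<lambda>i. A i e) is) I (S e))"
proof -
  have i: "is ! (i - 1) \<in> set is" if "i \<in> {1..length is}" for i using that by (intro nth_mem) auto
  have "dec (\<lambda>e. S e \<in> PDS \<and> (\<forall>i\<in>{1..length is}.
      if i \<in> I then A (is ! (i - 1)) e \<bullet> S e = 0 else A (is ! (i - 1)) e \<bullet> S e > 0))"
  proof (intro dec_conj dec_PDS dec_ball assms(2))
    fix j assume "j \<in> {1..length is}"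
    then have "ef (\<lambda>e. A (is ! (j - 1)) e \<bullet> S e)" using assms i by (intro ef_inner) auto
    then show "dec (\<lambda>e. if j \<in> I then A (is ! (j - 1)) e \<bullet> S e = 0 else A (is ! (j - 1)) e \<bullet> S e > 0)"
      by (cases "j \<in> I") (simp_all add: dec_eq_0 dec_pos)
  qed simp
  moreover have "sign_ok (map (\<lambda>i. A i e) is) I (S e) \<longleftrightarrow> S e \<in> PDS \<and> (\<forall>i\<in>{1..length is}.
      if i \<in> I then A (is ! (i - 1)) e \<bullet> S e = 0 else A (is ! (i - 1)) e \<bullet> S e > 0)" for e
    unfolding sign_ok_def length_map by (intro conj_cong ball_cong refl) (subst (1 2) nth_map, auto)
  ultimately show ?thesis by simp
qed

lemma dec_feasible:
  fixes a :: "nat \<Rightarrow> 'n :: finite \<Rightarrow> 'n \<Rightarrow> nat"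
  assumes "\<And>i r c. i \<in> set is \<Longrightarrow> a i r c < m"
  shows "dec (\<lambda>e. \<exists>Y. sign_ok (map (\<lambda>i. mat_at (a i) e) is) I Y)"
proof (rule dec_sa)
  let ?Y = "\<lambda>f. (\<chi> r c. f (r, c)) :: real ^ 'n ^ 'n"
  have i: "is ! (i - 1) \<in> set is" if "i \<in> {1..length is}" for i using that by (intro nth_mem) auto
  have eq: "sign_ok (map (\<lambda>i. mat_at (a i) e) is) I Y \<longleftrightarrow> Y \<in> PDS \<and> (\<forall>i\<in>{1..length is}.
      if i \<in> I then mat_at (a (is ! (i - 1))) e \<bullet> Y = 0 else mat_at (a (is ! (i - 1))) e \<bullet> Y > 0)" for e Y
    unfolding sign_ok_def length_map by (intro conj_cong ball_cong refl) (subst (1 2) nth_map, auto)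
  have "sa (\<lambda>e. \<exists>f. sign_ok (map (\<lambda>i. mat_at (a i) e) is) I (?Y f))"
  proof (rule sa_ex_fun[where m = m])
    fix w :: "'n \<times> 'n \<Rightarrow> nat"
    have Y: "?Y (\<lambda>i. e (w i)) = mat_at (\<lambda>r c. w (r, c)) e" for e by (simp add: vec_eq_iff)
    show "sa (\<lambda>e. sign_ok (map (\<lambda>i. mat_at (a i) e) is) I (?Y (\<lambda>i. e (w i))))"
      unfolding Y eq
    proof (intro sa_conj sa_PDS sa_ball)
      fix j
      show "sa (\<lambda>e. if j \<in> I then mat_at (a (is ! (j - 1))) e \<bullet> mat_at (\<lambda>r c. w (r, c)) e = 0
          else mat_at (a (is ! (j - 1))) e \<bullet> mat_at (\<lambda>r c. w (r, c)) e > 0)"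
        by (cases "j \<in> I") (simp_all add: sa_eq_0 sa_pos pf_inner_mat_at)
    qed simp
  next
    fix e e' :: "nat \<Rightarrow> real" and f :: "'n \<times> 'n \<Rightarrow> real"
    assume e: "\<And>k. k < m \<Longrightarrow> e k = e' k"
    have "map (\<lambda>i. mat_at (a i) e) is = map (\<lambda>i. mat_at (a i) e') is"
      using e assms by (intro map_cong refl) (simp add: vec_eq_iff)
    then show "sign_ok (map (\<lambda>i. mat_at (a i) e) is) I (?Y f) = sign_ok (map (\<lambda>i. mat_at (a i) e') is) I (?Y f)"
      by (simp only:)
  qed
  moreover have "(\<exists>f. sign_ok As I (?Y f)) \<longleftrightarrow> (\<exists>Y. sign_ok As I Y)" for As
  proof -
    have "?Y (\<lambda>(r, c). Y $ r $ c) = Y" for Y :: "real ^ 'n ^ 'n" by (simp add: vec_eq_iff)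
    then show ?thesis by metis
  qed
  ultimately show "sa (\<lambda>e. \<exists>Y. sign_ok (map (\<lambda>i. mat_at (a i) e) is) I Y)" by simp
qed

section \<open>Positions of the matrix entries in the encoded input\<close>

lemma nth_concat_map:
  assumes "\<And>x. x \<in> set xs \<Longrightarrow> length (f x) = N" "i < length xs" "p < N"
  shows "i * N + p < length (concat (map f xs))" "concat (map f xs) ! (i * N + p) = f (xs ! i) ! p"
  using assms
proof (induction xs arbitrary: i)
  case (Cons x xs)
  case 1
  then show ?case using Cons.IH(1) by (cases i) auto
next
  case (Cons x xs)
  case 2
  then show ?case using Cons.IH(2)
    by (cases i) (auto simp: nth_append)
qed simp_all

lemma length_concat_map: "(\<And>x. x \<in> set xs \<Longrightarrow> length (f x) = N) \<Longrightarrow> length (concat (map f xs)) = length xs * N"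
  by (induction xs) auto

text \<open>A guess: the number of input matrices, the positions of the retained ones, the zero sets
  of the faces, and the integer matrices for the samples. The type is countable, so all guesses can
  be enumerated.\<close>

type_synonym 'm hyp = "nat \<times> nat list \<times> nat list list \<times> ('m \<Rightarrow> 'm \<Rightarrow> int) list"

context
  fixes ns :: "'n :: finite list"
  assumes ns: "set ns = (UNIV :: 'n set)"
begin

definition position :: "'n \<Rightarrow> nat" where
  "position r = (SOME p. p < length ns \<and> ns ! p = r)"

lemma position: "position r < length ns" "ns ! position r = r"
proof -
  have "\<exists>p. p < length ns \<and> ns ! p = r" using ns by (metis UNIV_I in_set_conv_nth)
  then have "position r < length ns \<and> ns ! position r = r" unfolding position_def by (rule someI_ex)
  then show "position r < length ns" "ns ! position r = r" by auto
qed

definition entries :: nat where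
  "entries = length ns * length ns"

definition entry_pos :: "'n \<Rightarrow> 'n \<Rightarrow> nat" where
  "entry_pos r c = position r * length ns + position c"

lemma length_enc_matrix: "length (enc_matrix ns A) = entries"
  unfolding enc_matrix_def entries_def by (subst length_concat_map[where N = "length ns"]) auto

lemma enc_matrix_nth: "entry_pos r c < entries" "enc_matrix ns A ! entry_pos r c = A $ r $ c"
proof -
  show e: "enc_matrix ns A ! entry_pos r c = A $ r $ c"
    unfolding enc_matrix_def entry_pos_def
    using position by (subst nth_concat_map(2)[where N = "length ns"]) auto
  have "position r * length ns + position c < length (concat (map (\<lambda>r. map (\<lambda>c. A $ r $ c) ns) ns))"
    by (rule nth_concat_map(1)) (use position in auto)
  then show "entry_pos r c < entries"
    unfolding length_enc_matrix[of A, symmetric] enc_matrix_def entry_pos_def .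
qed

text \<open>The input variable that holds entry \<open>(r, c)\<close> of the \<open>i\<close>-th matrix; variable 0 is the length of
  the input, and the matrices follow the \<open>entries\<close> entries of the point and their number.\<close>

definition var :: "nat \<Rightarrow> 'n \<Rightarrow> 'n \<Rightarrow> nat" where
  "var i r c = entries + 2 + i * entries + entry_pos r c"

lemma mat_at_input:
  assumes "i < length As"
  shows "mat_at (var i) (input_env (enc_input ns Z As)) = As ! i"
proof -
  have "input_env (enc_input ns Z As) (var i r c) = As ! i $ r $ c" for r c
  proof -
    let ?C = "concat (map (enc_matrix ns) As)"
    have q: "i * entries + entry_pos r c < length ?C" "?C ! (i * entries + entry_pos r c) = As ! i $ r $ c"
      using nth_concat_map[of As "enc_matrix ns" entries i "entry_pos r c"] assms
      by (simp_all add: length_enc_matrix enc_matrix_nth)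
    have "var i r c - 1 = length (enc_matrix ns Z) + Suc (i * entries + entry_pos r c)"
      by (simp add: var_def length_enc_matrix)
    then have "enc_input ns Z As ! (var i r c - 1) = As ! i $ r $ c"
      using q(2) by (simp only: enc_input_def nth_append_length_plus enc_matrices_def nth_Cons_Suc)
    moreover have "var i r c \<noteq> 0" "var i r c \<le> length (enc_input ns Z As)"
      using q(1) by (simp_all add: var_def enc_input_def enc_matrices_def length_enc_matrix)
    ultimately show ?thesis by (simp add: input_env_def)
  qed
  then show ?thesis by (simp add: vec_eq_iff)
qed

text \<open>The length of the input determines the number of matrices, so the guard can test the
  guessed number on variable 0.\<close>

definition input_length :: "nat \<Rightarrow> nat" where
  "input_length k = entries + 1 + k * entries"

lemma length_enc_input: "length (enc_input ns Z As) = input_length (length As)"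
  unfolding enc_input_def enc_matrices_def input_length_def
  by (simp add: length_enc_matrix length_concat_map[where N = entries])

lemma input_length_inj: "input_length k = input_length l \<Longrightarrow> k = l"
proof -
  have "length ns > 0" using position(1) by (metis gr0I not_less0)
  then show "input_length k = input_length l \<Longrightarrow> k = l" by (simp add: input_length_def entries_def)
qed

section \<open>The stage that tests and writes out one guess\<close>

definition kept :: "nat list \<Rightarrow> (nat \<Rightarrow> real) \<Rightarrow> (real ^ 'n ^ 'n) list" where
  "kept idx e = map (\<lambda>i. mat_at (var i) e) idx"

definition sample :: "nat list \<Rightarrow> nat list \<Rightarrow> ('n \<Rightarrow> 'n \<Rightarrow> int) \<Rightarrow> (nat \<Rightarrow> real) \<Rightarrow> real ^ 'n ^ 'n" where
  "sample idx I Z e = pr (map (\<lambda>S. S e) (map (\<lambda>i. mat_at (var (idx ! (i - 1)))) I)) (symz Z)"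

fun valid :: "'n hyp \<Rightarrow> bool" where
  "valid (k, idx, Is, Zs) \<longleftrightarrow> set idx \<subseteq> {..<k} \<and> length Zs = length Is \<and> distinct (map set Is) \<and>
     (\<forall>I\<in>set Is. set I \<subseteq> {1..length idx})"

text \<open>Matrices are compared by value, because the input may repeat them. The clause over
  \<open>Pow\<close> says that no realized zero set is missing, and the last clause that each listed
  one is realized by its own sample. All bounded quantifiers range over finite sets fixed by the
  guess, so that the guard is one Boolean combination.\<close>

fun guard :: "'n hyp \<Rightarrow> (nat \<Rightarrow> real) \<Rightarrow> bool" where
  "guard (k, idx, Is, Zs) e \<longleftrightarrow> valid (k, idx, Is, Zs) \<and> e 0 - real (input_length k) = 0 \<and>
     (\<forall>i\<in>{..<length idx}. \<forall>j\<in>{..<length idx}. i \<noteq> j \<longrightarrow> mat_at (var (idx ! i)) e \<noteq> mat_at (var (idx ! j)) e) \<and>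
     (\<forall>i\<in>{..<k}. \<exists>j\<in>set idx. mat_at (var i) e = mat_at (var j) e) \<and>
     (\<forall>I\<in>Pow {1..length idx}. I \<in> set (map set Is) \<or> \<not> (\<exists>Y. sign_ok (kept idx e) I Y)) \<and>
     (\<forall>j\<in>{..<length Is}. sign_ok (kept idx e) (set (Is ! j)) (sample idx (Is ! j) (Zs ! j) e))"

fun stage_output :: "'n hyp \<Rightarrow> (nat \<Rightarrow> real) \<Rightarrow> real list" where
  "stage_output (k, idx, Is, Zs) e = enc_output ns (kept idx e) Is (pos_list Is)
     (map (\<lambda>j. sample idx (Is ! j) (Zs ! j) e) [0..<length Is])"

lemma efM_mat_at: "efM (mat_at y)"
  by (simp add: efM_def ef_var)

lemma efM_const: "efM (\<lambda>e. symz Z)"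
  unfolding efM_def symz_def by (simp add: ef_of_int del: of_int_add)

lemma efM_sample: "efM (sample idx I Z)"
  unfolding sample_def by (rule efM_pr) (auto simp: efM_mat_at efM_const)

lemma efL_output: "efL (stage_output h)"
proof -
  obtain k idx Is Zs where h: "h = (k, idx, Is, Zs)" by (cases h)
  have "efL (\<lambda>e. stage_output (k, idx, Is, Zs) e)"
    unfolding stage_output.simps enc_output_def kept_def
    by (intro efL_append efL_matrices efL_array efM_mat_at efM_sample)
  then show ?thesis unfolding h .
qed

lemma dec_guard: "dec (guard h)"
proof -
  obtain k idx Is Zs where h: "h = (k, idx, Is, Zs)" by (cases h)
  have bound: "var i r c < entries + 2 + k * entries" if "i < k" for i r c
  proof -
    have "Suc i * entries \<le> k * entries" using that by (intro mult_right_mono) auto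
    then show ?thesis using enc_matrix_nth(1)[of r c] by (simp add: var_def)
  qed
  show ?thesis
  \<comment> \<open>Only for a valid guess do the positions in \<open>idx\<close> stay below
    \<open>k\<close>, which bounds the variables that the feasibility clause reads; otherwise the
    guard is constantly false.\<close>
  proof (cases "valid h")
    case True
    then have idx: "set idx \<subseteq> {..<k}" by (simp add: h)
    have "dec (\<lambda>e. guard (k, idx, Is, Zs) e)"
      unfolding guard.simps
    proof (intro dec_conj dec_const dec_ball dec_bex dec_imp dec_not dec_disj dec_matrix_eq efM_mat_at dec_eq_0 ef_diff ef_var ef_of_nat)
      show "dec (\<lambda>e. \<exists>Y. sign_ok (kept idx e) I Y)" for I
        unfolding kept_def by (rule dec_feasible[where m = "entries + 2 + k * entries"]) (use bound idx in auto)
      show "dec (\<lambda>e. sign_ok (kept idx e) (set (Is ! j)) (sample idx (Is ! j) (Zs ! j) e))" for j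
        unfolding kept_def by (rule dec_sign_ok) (simp_all add: efM_mat_at efM_sample)
    qed simp_all
    then show ?thesis unfolding h .
  next
    case False
    then have "\<not> guard h e" for e unfolding h guard.simps by blast
    then have "guard h = (\<lambda>e. False)" by blast
    then show ?thesis using dec_const by simp
  qed
qed

lemma guard_describes:
  assumes As: "set As \<subseteq> Sym" and g: "guard h (input_env (enc_input ns Z As))"
  shows "\<exists>As' Lface Lpos Lsamp. stage_output h (input_env (enc_input ns Z As)) = enc_output ns As' Lface Lpos Lsamp \<and>
    describes_faces As As' Lface Lpos Lsamp"
proof -
  let ?e = "input_env (enc_input ns Z As)"
  obtain k idx Is Zs where h: "h = (k, idx, Is, Zs)" by (cases h)
  note g = g[unfolded h guard.simps]
  have "real (length (enc_input ns Z As)) = real (input_length k)" using g by (simp add: input_env_def)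
  then have k: "k = length As" using input_length_inj[of k "length As"] by (simp add: length_enc_input)
  have idx: "set idx \<subseteq> {..<k}" "length Zs = length Is" "distinct (map set Is)" "\<forall>I\<in>set Is. set I \<subseteq> {1..length idx}"
    using g by simp_all
  have rep: "\<forall>i\<in>{..<k}. \<exists>j\<in>set idx. mat_at (var i) ?e = mat_at (var j) ?e"
    and compl: "\<forall>I\<in>Pow {1..length idx}. I \<in> set (map set Is) \<or> \<not> (\<exists>Y. sign_ok (kept idx ?e) I Y)"
    and samp: "\<forall>j\<in>{..<length Is}. sign_ok (kept idx ?e) (set (Is ! j)) (sample idx (Is ! j) (Zs ! j) ?e)"
    using g by blast+
  have kept: "kept idx ?e = map ((!) As) idx"
    unfolding kept_def using idx(1) k by (intro map_cong refl mat_at_input) auto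
  let ?K = "kept idx ?e"
  have len: "length ?K = length idx" by (simp add: kept_def)
  have "describes_faces As ?K Is (pos_list Is) (map (\<lambda>j. sample idx (Is ! j) (Zs ! j) ?e) [0..<length Is])"
  proof (rule describes_facesI[OF As])
    show "distinct ?K" unfolding distinct_conv_nth len using g by (simp add: kept_def)
    show "set ?K = set As"
    proof
      show "set ?K \<subseteq> set As" unfolding kept using idx(1) k by auto
      show "set As \<subseteq> set ?K"
      proof
        fix A assume "A \<in> set As"
        then obtain i where i: "i < k" "A = As ! i" unfolding k by (auto simp: in_set_conv_nth)
        then obtain j where "j \<in> set idx" "mat_at (var i) ?e = mat_at (var j) ?e" using rep by blast
        moreover have "mat_at (var i) ?e = A" using mat_at_input[of i As Z] i k by simp
        ultimately show "A \<in> set ?K" unfolding kept_def by simp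
      qed
    qed
    show "distinct (map set Is)" by (rule idx(3))
    show "set I \<subseteq> {1..length ?K}" if "I \<in> set Is" for I using idx(4) that unfolding len by blast
    show "sign_ok ?K (set (Is ! j)) (map (\<lambda>j. sample idx (Is ! j) (Zs ! j) ?e) [0..<length Is] ! j)"
      if "j < length Is" for j using samp that by simp
    show "I \<in> set (map set Is)" if "I \<subseteq> {1..length ?K}" "sign_ok ?K I Y" for I Y
      using compl that unfolding len by blast
  qed simp
  then show ?thesis unfolding h stage_output.simps by blast
qed

text \<open>The correct combinatorial answer is itself a guess: keep one position for each distinct
  matrix, list all realized zero sets, and take the integer matrices from
  \<open>ex_integer_sample\<close>.\<close>

lemma ex_guard:
  assumes As: "set As \<subseteq> Sym"
  shows "\<exists>h. guard h (input_env (enc_input ns Z As))"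
proof -
  let ?e = "input_env (enc_input ns Z As)" and ?k = "length As"
  have "\<forall>A. \<exists>i. A \<in> set As \<longrightarrow> i < ?k \<and> As ! i = A" by (metis in_set_conv_nth)
  then obtain p where p: "\<And>A. A \<in> set As \<Longrightarrow> p A < ?k \<and> As ! p A = A" by metis
  define idx where "idx = map p (remdups As)"
  have idx: "set idx \<subseteq> {..<?k}" unfolding idx_def using p by auto
  have mat: "mat_at (var i) ?e = As ! i" if "i < ?k" for i using mat_at_input[OF that] .
  have kept: "kept idx ?e = remdups As"
  proof -
    have "kept idx ?e = map (\<lambda>A. A) (remdups As)"
      unfolding kept_def idx_def map_map comp_def by (rule map_cong[OF refl]) (use p mat in auto)
    then show ?thesis by simp
  qed
  let ?K = "remdups As"
  have len: "length idx = length ?K" by (simp add: idx_def)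
  interpret cone_system "set ?K" using As by unfold_locales auto
  have cs: "cone_system (set ?K)" by unfold_locales
  define \<I> where "\<I> = {I \<in> Pow {1..length idx}. \<exists>Y. sign_ok ?K I Y}"
  have "finite \<I>" unfolding \<I>_def by simp
  then obtain Ls where Ls: "set Ls = \<I>" "distinct Ls" using finite_distinct_list by blast
  define Is where "Is = map sorted_list_of_set Ls"
  have finI: "finite I" if "I \<in> \<I>" for I using that finite_subset unfolding \<I>_def by blast
  have mapset: "map set Is = Ls" unfolding Is_def map_map comp_def using finI Ls(1) by (intro map_idI) auto
  have "\<exists>Z. sign_ok ?K (set I) (sample idx I Z ?e)" if I: "I \<in> set Is" for I
  proof -
    have "set I \<in> \<I>" using I mapset Ls(1) by (metis image_eqI image_set)
    then obtain Y where sub: "set I \<subseteq> {1..length ?K}" and Y: "sign_ok ?K (set I) Y" unfolding \<I>_def len by blast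
    let ?J = "map (\<lambda>i. ?K ! (i - 1)) I"
    have J: "set ?J = members ?K (set I)" by (simp add: members_def)
    have iff: "sign_ok ?K (set I) Y \<longleftrightarrow> feas (set ?J) Y" for Y
      unfolding J by (rule sign_ok_feas[OF cs _ sub]) simp
    obtain Z where "feas (set ?J) (pr ?J (symz Z))"
      using ex_integer_sample[of ?J Y] members_subset[OF sub] iff Y unfolding J by blast
    moreover have "sample idx I Z ?e = pr ?J (symz Z)"
    proof -
      have "mat_at (var (idx ! (i - 1))) ?e = ?K ! (i - 1)" if "i \<in> set I" for i
      proof -
        have "i - 1 < length idx" using sub that unfolding len by fastforce
        then show ?thesis unfolding kept[symmetric] kept_def by simp
      qed
      then show ?thesis unfolding sample_def map_map comp_def by (simp cong: map_cong)
    qed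
    ultimately show ?thesis using iff by metis
  qed
  then obtain f where f: "\<And>I. I \<in> set Is \<Longrightarrow> sign_ok ?K (set I) (sample idx I (f I) ?e)" by metis
  have "guard (?k, idx, Is, map f Is) ?e"
    unfolding guard.simps
  proof (intro conjI ballI impI)
    have "\<forall>I\<in>set Is. set I \<subseteq> {1..length idx}"
    proof
      fix I assume "I \<in> set Is"
      then have "set I \<in> \<I>" using mapset Ls(1) by (metis image_eqI image_set)
      then show "set I \<subseteq> {1..length idx}" unfolding \<I>_def by blast
    qed
    then show "valid (?k, idx, Is, map f Is)" using idx Ls(2) mapset by simp
    show "?e 0 - real (input_length ?k) = 0" by (simp add: input_env_def length_enc_input)
  next
    fix i j assume "i \<in> {..<length idx}" "j \<in> {..<length idx}" "i \<noteq> j"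
    moreover have "distinct (kept idx ?e)" unfolding kept by simp
    ultimately show "mat_at (var (idx ! i)) ?e \<noteq> mat_at (var (idx ! j)) ?e"
      unfolding kept_def by (simp add: distinct_conv_nth)
  next
    fix i assume "i \<in> {..<?k}"
    then have "mat_at (var i) ?e \<in> set (kept idx ?e)" unfolding kept using mat by simp
    then show "\<exists>j\<in>set idx. mat_at (var i) ?e = mat_at (var j) ?e" unfolding kept_def by auto
  next
    fix I assume "I \<in> Pow {1..length idx}"
    then show "I \<in> set (map set Is) \<or> \<not> (\<exists>Y. sign_ok (kept idx ?e) I Y)"
      unfolding mapset Ls(1) kept \<I>_def by blast
  next
    fix j assume "j \<in> {..<length Is}"
    then show "sign_ok (kept idx ?e) (set (Is ! j)) (sample idx (Is ! j) (map f Is ! j) ?e)"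
      unfolding kept using f by simp
  qed
  then show ?thesis by blast
qed

end

theorem theorem5p1:
  fixes ns :: "'n::finite list"
  assumes "distinct ns" and "set ns = UNIV"
  shows "\<exists>M :: bss_machine.
    \<forall>(X :: real ^ 'n ^ 'n) Z (As' :: (real ^ 'n ^ 'n) list).
      X \<in> Pspace \<longrightarrow> represents Z X \<longrightarrow> set As' \<subseteq> Sym \<longrightarrow>
      (\<exists>As Lface Lpos Lsamp.
         bss_computes M (enc_input ns Z As') (enc_output ns As Lface Lpos Lsamp) \<and>
         describes_faces As' As Lface Lpos Lsamp)"
proof -
  note ns = assms(2)
  \<comment> \<open>\<open>from_nat\<close> is surjective onto a countable type, so every guess is
    reached by some stage.\<close>
  define hyp :: "nat \<Rightarrow> 'n hyp" where "hyp = from_nat"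
  have "\<forall>h. \<exists>fs. (\<forall>g\<in>set fs. ef g) \<and> (\<forall>e. stage_output ns (hyp h) e = map (\<lambda>g. g e) fs)"
    using efL_output[OF ns] unfolding efL_def by blast
  then obtain outs where outs: "\<And>h g. g \<in> set (outs h) \<Longrightarrow> ef g"
    "\<And>h e. stage_output ns (hyp h) e = map (\<lambda>g. g e) (outs h)" by metis
  have "\<exists>M. \<forall>xs. (\<exists>h. guard ns (hyp h) (input_env xs)) \<longrightarrow>
      (\<exists>h. guard ns (hyp h) (input_env xs) \<and> bss_computes M xs (map (\<lambda>f. f (input_env xs)) (outs h)))"
    by (rule search_machine[OF dec_guard[OF ns]]) (rule outs(1))
  then obtain M where M: "\<And>xs. \<exists>h. guard ns (hyp h) (input_env xs) \<Longrightarrow>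
      \<exists>h. guard ns (hyp h) (input_env xs) \<and> bss_computes M xs (stage_output ns (hyp h) (input_env xs))"
    unfolding outs(2) by blast
  show ?thesis
  proof (intro exI[of _ M] allI impI)
    fix X Z :: "real ^ 'n ^ 'n" and As' :: "(real ^ 'n ^ 'n) list"
    assume As': "set As' \<subseteq> Sym"
    let ?xs = "enc_input ns Z As'"
    obtain h0 where "guard ns h0 (input_env ?xs)" using ex_guard[OF ns As'] by blast
    then have "guard ns (hyp (to_nat h0)) (input_env ?xs)" by (simp add: hyp_def)
    then obtain h where h: "guard ns (hyp h) (input_env ?xs)"
      "bss_computes M ?xs (stage_output ns (hyp h) (input_env ?xs))"
      using M[of ?xs] by blast
    then show "\<exists>As Lface Lpos Lsamp. bss_computes M ?xs (enc_output ns As Lface Lpos Lsamp) \<and>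
         describes_faces As' As Lface Lpos Lsamp"
      using guard_describes[OF ns As' h(1)] by metis
  qed
qed

end
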